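(* Assume (A1), (A2) and (A3) hold and fix $\theta\in\mathbb R$. Let - $\hat\varphi_{i,j;1}$ be a nonincreasing pulsating traveling front of (1.1) in direction $(\cos\theta,\sin\theta)$ with speed $\hat v$, connecting $1$ (at $-\infty$) to $0$ (at $+\infty$); - $\tilde\varphi_{i,j;2}$ be a nondecreasing pulsating traveling front with speed $\tilde v_1$, connecting $0$ (at $-\infty$) to $a$ (at $+\infty$); - $\tilde\varphi_{i,j;3}$ be a nondecreasing pulsating traveling front with speed $v_2$, connecting $a$ (at $-\infty$) to $1$ (at $+\infty$). Suppose $\hat v<\tilde v_1<v_2$. Then there exist an entire solution $U=\{U_{i,j}(t)\}_{i,j\in\mathbb Z}$ of (1.1) with values in $[0,1]$ and a constant $\omega\in\mathbb R$ with the following two properties. First, $$\lim_{t\to+\infty}\sup_{i,j\in\mathbb Z}|U_{i,j}(t)-1|=0.$$ Second, setting $x_{i,j}=i\cos\theta+j\sin\theta$, $m_1(t)=-\frac{(\hat v+\tilde v_1)t}{2}$ and $m_2(t)=-\frac{(\tilde v_1+v_2)t}{2}$, $$\lim_{t\to-\infty}\Big\{\sup_{x_{i,j}\le m_1(t)}\big|U_{i,j}(t)-\hat\varphi_{i,j;1}(x_{i,j}+\hat vt-\omega)\big|+\sup_{m_1(t)\le x_{i,j}\le m_2(t)}\big|U_{i,j}(t)-\tilde\varphi_{i,j;2}(x_{i,j}+\tilde v_1t+\omega)\big|+\sup_{x_{i,j}\ge m_2(t)}\big|U_{i,j}(t)-\tilde\varphi_{i,j;3}(x_{i,j}+v_2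t+\omega)\big|\Big\}=0.$$
   Context: Let $0<a<1$ be fixed. Consider the nonlocal periodic lattice system $$u_{i,j}'(t)=\sum_{k_1\in\mathbb Z}\sum_{k_2\in\mathbb Z}J(k_1,k_2)\,u_{i-k_1,j-k_2}(t)-u_{i,j}(t)+f_{i,j}(u_{i,j}(t)),\qquad i,j\in\mathbb Z,\ t\in\mathbb R. \tag{1.1}$$ The kernel $J:\mathbb Z\times\mathbb Z\to[0,\infty)$ satisfies: - it is even; - $\sum_{k_1,k_2}J(k_1,k_2)=1$; - there is $k_0>0$ with $J(k_1,k_2)=0$ whenever $|k_1|>k_0$ or $|k_2|>k_0$. Each $f_{i,j}\in C^2(\mathbb R)$, and the following hypotheses are imposed. - (A1) For all $i,j$: $f_{i,j}(0)=f_{i,j}(a)=f_{i,j}(1)=0$; $f_{i,j}'(0)<0$, $f_{i,j}'(1)<0$, $f_{i,j}'(a)>0$; $f_{i,j}(u)<0$ for $u\in(0,a)$ and $f_{i,j}(u)>0$ for $u\in(a,1)$. - (A2) There are fixed positive integers $N_1,N_2$ such that $f_{i,j}=f_{i+N_1,j}=f_{i,j+N_2}$ for all $i,j\in\mathbb Z$. - (A3) For all $i,j$: $f_{i,j}(u)\ge f_{i,j}'(a)(u-a)$ for $u\in[0,a]$, and $f_{i,j}(u)\le f_{i,j}'(a)(u-a)$ for $u\in[a,1]$. A pulsating traveling front of (1.1) in direction $(\cos\theta,\sin\theta)$ with speed $c$, connecting $e_-$ to $e_+$ (where $e_\pm\in\{0,a,1\}$), is a solution of the form $u_{i,j}(t)=\varphi_{i,j}(i\cos\theta+j\sin\theta+ct)$.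 Here the functions $\varphi_{i,j}:\mathbb R\to\mathbb R$ are $C^1$ and satisfy: - $\varphi_{i+N_1,j}=\varphi_{i,j}=\varphi_{i,j+N_2}$; - $\varphi_{i,j}(-\infty)=e_-$ and $\varphi_{i,j}(+\infty)=e_+$ for all $i,j$. Equivalently, for all $\xi\in\mathbb R$, $$c\varphi_{i,j}'(\xi)=\sum_{k_1,k_2}J(k_1,k_2)\varphi_{i-k_1,j-k_2}(\xi-k_1\cos\theta-k_2\sin\theta)-\varphi_{i,j}(\xi)+f_{i,j}(\varphi_{i,j}(\xi)).$$ An entire solution of (1.1) is a family $\{u_{i,j}(t)\}_{i,j\in\mathbb Z}$ such that each $u_{i,j}$ is differentiable on all of $\mathbb R$ and (1.1) holds for all $i,j\in\mathbb Z$ and $t\in\mathbb R$. *)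

theory Defs
  imports "HOL-Analysis.Analysis"
begin

definition kernel_ok :: "(int \<Rightarrow> int \<Rightarrow> real) \<Rightarrow> bool" where
  "kernel_ok J \<longleftrightarrow>
     (\<forall>k1 k2. J k1 k2 \<ge> 0) \<and>
     (\<forall>k1 k2. J (-k1) (-k2) = J k1 k2) \<and>
     ((\<lambda>(k1,k2). J k1 k2) has_sum 1) UNIV \<and>
     (\<exists>k0>0. \<forall>k1 k2. \<bar>k1\<bar> > k0 \<or> \<bar>k2\<bar> > k0 \<longrightarrow> J k1 k2 = 0)"

definition conv :: "(int \<Rightarrow> int \<Rightarrow> real) \<Rightarrow> (int \<Rightarrow> int \<Rightarrow> real) \<Rightarrow> int \<Rightarrow> int \<Rightarrow> real" where
  "conv J u i j = (\<Sum>\<^sub>\<infinity>(k1,k2)\<in>UNIV. J k1 k2 * u (i - k1) (j - k2))"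

definition C1_fun :: "(real \<Rightarrow> real) \<Rightarrow> bool" where
  "C1_fun g \<longleftrightarrow> (\<forall>x. g differentiable (at x)) \<and> continuous_on UNIV (deriv g)"

definition C2_fun :: "(real \<Rightarrow> real) \<Rightarrow> bool" where
  "C2_fun g \<longleftrightarrow> (\<forall>x. g differentiable (at x)) \<and> (\<forall>x. deriv g differentiable (at x))
                  \<and> continuous_on UNIV (deriv (deriv g))"

definition hyp_f :: "real \<Rightarrow> int \<Rightarrow> int \<Rightarrow> (int \<Rightarrow> int \<Rightarrow> real \<Rightarrow> real) \<Rightarrow> bool" where
  "hyp_f a N1 N2 f \<longleftrightarrow>
     (\<forall>i j. C2_fun (f i j)) \<and>
     (\<forall>i j. f i j 0 = 0 \<and> f i j a = 0 \<and> f i j 1 = 0 \<and>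
            deriv (f i j) 0 < 0 \<and> deriv (f i j) 1 < 0 \<and> deriv (f i j) a > 0 \<and>
            (\<forall>u. 0 < u \<and> u < a \<longrightarrow> f i j u < 0) \<and>
            (\<forall>u. a < u \<and> u < 1 \<longrightarrow> f i j u > 0)) \<and>
     N1 > 0 \<and> N2 > 0 \<and>
     (\<forall>i j. f i j = f (i + N1) j \<and> f i j = f i (j + N2)) \<and>
     (\<forall>i j. (\<forall>u. 0 \<le> u \<and> u \<le> a \<longrightarrow> f i j u \<ge> deriv (f i j) a * (u - a)) \<and>
            (\<forall>u. a \<le> u \<and> u \<le> 1 \<longrightarrow> f i j u \<le> deriv (f i j) a * (u - a)))"

definition pulsating_front ::
  "(int \<Rightarrow> int \<Rightarrow> real) \<Rightarrow> (int \<Rightarrow> int \<Rightarrow> real \<Rightarrow> real) \<Rightarrow> int \<Rightarrow> int \<Rightarrow> real \<Rightarrow> real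
    \<Rightarrow> real \<Rightarrow> real \<Rightarrow> (int \<Rightarrow> int \<Rightarrow> real \<Rightarrow> real) \<Rightarrow> bool" where
  "pulsating_front J f N1 N2 \<theta> c e_minus e_plus \<phi> \<longleftrightarrow>
     (\<forall>i j. C1_fun (\<phi> i j)) \<and>
     (\<forall>i j. \<phi> (i + N1) j = \<phi> i j \<and> \<phi> i (j + N2) = \<phi> i j) \<and>
     (\<forall>i j. (\<phi> i j \<longlongrightarrow> e_minus) at_bot \<and> (\<phi> i j \<longlongrightarrow> e_plus) at_top) \<and>
     (\<forall>i j \<xi>. c * deriv (\<phi> i j) \<xi> =
        conv J (\<lambda>i' j'. \<phi> i' j' (\<xi> - real_of_int (i - i') * cos \<theta> - real_of_int (j - j') * sin \<theta>)) i j
        - \<phi> i j \<xi> + f i j (\<phi> i j \<xi>))"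

definition entire_solution ::
  "(int \<Rightarrow> int \<Rightarrow> real) \<Rightarrow> (int \<Rightarrow> int \<Rightarrow> real \<Rightarrow> real) \<Rightarrow> (int \<Rightarrow> int \<Rightarrow> real \<Rightarrow> real) \<Rightarrow> bool" where
  "entire_solution J f U \<longleftrightarrow>
     (\<forall>i j t. (U i j has_real_derivative
         (conv J (\<lambda>i' j'. U i' j' t) i j - U i j t + f i j (U i j t))) (at t))"

text \<open>Supremum with the convention sup of the empty set = 0 (used only for sups of
  nonnegative quantities).\<close>
definition sup0 :: "real set \<Rightarrow> real" where
  "sup0 A = (if A = {} then 0 else Sup A)"

end

theory Submission
  imports Defs
begin

text \<open>
  Normalise each front to a nondecreasing profile that leaves \<open>0\<close> at \<open>-\<infinity>\<close>. Summing the profile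
  equation over a period cell gives a first integral; it determines the signs
  \<open>v_hat < v1 < 0 < v2\<close> and, without any spectral theory, exponential decay at \<open>-\<infinity>\<close>, both at stable
  and at unstable states. The profiles are strictly increasing because a zero of a solution
  spreads to all sites that interact with it.

  Let \<open>e = exp (\<kappa> t)\<close>, with small \<open>\<kappa> > 0\<close>, and centre the nonlinearity at \<open>a\<close>. With \<open>Q\<close> the part of
  the third front above \<open>a\<close> and \<open>P\<close> the part of the second front below \<open>a\<close>, each shifted by a
  multiple of \<open>e\<close>, the functions \<open>a + (1 \<plusminus> e) Q - (1 \<minusplus> e) P\<close> are a super- and a subsolution for
  very negative \<open>t\<close>: in the front zones the shift absorbs the error, near \<open>a\<close> the growth of \<open>e\<close>
  does, and near the stable states the sign of the derivative of the nonlinearity. To the left of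
  the midpoint between the first two fronts the supersolution is replaced by the shifted first
  front plus a small term that increases in \<open>x\<close>, so that the two cross there.

  The solution is the limit of a monotone iteration for the integral equation over \<open>(-\<infinity>, t]\<close>. Its
  starting subsolution contains the first front for all times. From some time on it also contains
  a wave that exceeds \<open>a\<close> on the right and retreats with a speed strictly between those of the
  first two fronts. The first front catches up with this wave, after which the solution lies above
  \<open>a\<close> uniformly and converges to \<open>1\<close>. The phase \<open>\<omega>\<close> can be taken to be \<open>0\<close>.
\<close>

section \<open>Pulsating profiles\<close>

text \<open>All estimates are measured against \<open>e = exp (\<kappa> * t)\<close>. As t tends to
  -\<infinity> the fronts separate linearly. If \<kappa> is small compared with decay rates times
  relative speeds, their interaction is O(e^2), while the growth of e, the shift and the stable
  slopes gain terms of order e. The obstacle is the upper bound. To the left of the second front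
  \<open>upper\<close> levels off at a * e, whereas the first front rises to 1 there; and
  \<open>cap\<close> is a supersolution only where its increasing term is small. So there are no two
  global supersolutions whose minimum could be taken, and the bounds have to be matched along the
  moving point m. The level a * e is the reason why the increasing term of \<open>cap\<close> equals
  a * e exactly at m. The integral equation over (-\<infinity>, t] suits such matching: each piece
  is compared separately, site by site, over its own region of space-time, without initial value
  problems. For late times, when \<open>lower\<close> is no longer known to be a subsolution,
  something else must keep the right half of the lattice above a; this is the role of the retreating
  wave.\<close>

lemma periodic_mod_int:
  fixes g :: "int \<Rightarrow> 'a"
  assumes per: "\<And>i. g (i + N) = g i"
  shows "g (i mod N) = g i"
proof -
  have nat: "g (i + N * int n) = g i" for i n
  proof (induction n)
    case (Suc n)
    have "g (i + N * int (Suc n)) = g ((i + N * int n) + N)"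
      by (simp add: algebra_simps)
    then show ?case using per Suc by simp
  qed simp
  have mult: "g (i + N * m) = g i" for i m
  proof (cases "m \<ge> 0")
    case True
    then show ?thesis using nat[of i "nat m"] by simp
  next
    case False
    then show ?thesis using nat[of "i + N * m" "nat (- m)"] by simp
  qed
  show "g (i mod N) = g i"
    using mult[of "i mod N" "i div N"] by (simp add: algebra_simps)
qed

lemma sum_shift_period_int:
  fixes g :: "int \<Rightarrow> 'a::comm_monoid_add"
  assumes N: "N > 0" and per: "\<And>i. g (i + N) = g i"
  shows "(\<Sum>i\<in>{0..<N}. g (i - k)) = (\<Sum>i\<in>{0..<N}. g i)"
  by (rule sum.reindex_bij_witness[where i = "\<lambda>i. (i + k) mod N" and j = "\<lambda>i. (i - k) mod N"])
     (use N in \<open>auto simp: mod_simps periodic_mod_int[of g, OF per]\<close>)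

text \<open>Each property has to persist for smaller \<open>e'\<close>, so that the least of
  finitely many thresholds serves all members. Applied to the finite range of a periodic family this
  gives constants uniform over all sites; an upper bound M is fitted in as 1 / e.\<close>

lemma finite_uniform_small:
  assumes "finite R" "\<And>g. g \<in> R \<Longrightarrow> \<exists>e>0. \<forall>e'. 0 < e' \<and> e' \<le> e \<longrightarrow> Pr g (e'::real)"
  shows "\<exists>e>0. \<forall>g\<in>R. Pr g e"
proof -
  have "\<exists>e>0. \<forall>g\<in>R. \<forall>e'. 0 < e' \<and> e' \<le> e \<longrightarrow> Pr g e'"
    using assms
  proof (induction R rule: finite_induct)
    case empty
    then show ?case by (intro exI[of _ 1]) auto
  next
    case (insert x F)
    obtain e1 where "e1 > 0" "\<forall>g\<in>F. \<forall>e'. 0 < e' \<and> e' \<le> e1 \<longrightarrow> Pr g e'"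
      using insert.IH insert.prems by blast
    moreover obtain e2 where "e2 > 0" "\<forall>e'. 0 < e' \<and> e' \<le> e2 \<longrightarrow> Pr x e'"
      using insert.prems by blast
    ultimately show ?case by (intro exI[of _ "min e1 e2"]) auto
  qed
  then show ?thesis by force
qed

text \<open>Halving over each step of length D is geometric decay, with rate ln 2 / D as a function
  of x. Boundedness extends the estimate beyond M to the whole line.\<close>

lemma exp_decay_of_halving:
  fixes F :: "real \<Rightarrow> real"
  assumes mono: "\<And>x y. x \<le> y \<Longrightarrow> F x \<le> F y" and nonneg: "\<And>x. F x \<ge> 0"
    and bdd: "\<And>x. F x \<le> B" and D: "D > 0"
    and half: "\<And>y. y \<le> M \<Longrightarrow> F (y - D) \<le> F y / 2"
  shows "\<exists>C>0. \<exists>lam>0. \<forall>x. F x \<le> C * exp (lam * x)"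
proof -
  define lam where "lam = ln 2 / D"
  have lam: "lam > 0" using D by (simp add: lam_def)
  have B: "B \<ge> 0" using nonneg[of 0] bdd[of 0] by linarith
  have it: "F (M - real n * D) \<le> B / 2 ^ n" for n
  proof (induction n)
    case (Suc n)
    have eq: "M - real (Suc n) * D = (M - real n * D) - D" by (simp add: algebra_simps)
    have "F ((M - real n * D) - D) \<le> F (M - real n * D) / 2"
      using D by (intro half) simp
    then have "F (M - real (Suc n) * D) \<le> (B / 2 ^ n) / 2" using divide_right_mono[OF Suc, of 2] unfolding eq by (auto intro: order_trans)
    then show ?case by (simp add: field_simps)
  qed (use bdd in simp)
  \<comment> \<open>The factor 2 pays for rounding (M - x) / D down to n, and B + 1 in place of B
    makes C positive even if B = 0.\<close>
  define C where "C = 2 * (B + 1) * exp (- lam * M)"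
  have C: "C > 0" using B by (simp add: C_def)
  have "F x \<le> C * exp (lam * x)" for x
  proof (cases "x \<le> M")
    case True
    define n where "n = nat \<lfloor>(M - x) / D\<rfloor>"
    have q: "(M - x) / D \<ge> 0" using True D by simp
    have n1: "real n \<le> (M - x) / D" and n2: "(M - x) / D \<le> real n + 1"
      using q by (auto simp: n_def of_nat_floor)
    have "x \<le> M - real n * D" using n1 D by (simp add: field_simps)
    then have "F x \<le> B / 2 ^ n" using mono it order_trans by blast
    also have "\<dots> \<le> (B + 1) / 2 ^ n" by (simp add: divide_right_mono)
    also have "\<dots> = 2 * (B + 1) * exp (- ln 2 * (real n + 1))"
    proof -
      have "exp (- ln 2 * (real n + 1)) = inverse (exp (real (Suc n) * ln 2))"
        by (simp add: exp_minus[symmetric] algebra_simps)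
      also have "\<dots> = inverse (2 ^ Suc n)" unfolding exp_of_nat_mult by simp
      finally show ?thesis by (simp add: field_simps)
    qed
    also have "\<dots> \<le> 2 * (B + 1) * exp (- ln 2 * ((M - x) / D))"
    proof -
      have "- ln 2 * (real n + 1) \<le> - ln 2 * ((M - x) / D)"
        using mult_left_mono[OF n2, of "ln 2"] by simp
      then show ?thesis using B by (intro mult_left_mono) auto
    qed
    also have "\<dots> = C * exp (lam * x)"
      by (simp add: C_def lam_def exp_add[symmetric] algebra_simps diff_divide_distrib)
    finally show ?thesis .
  next
    case False
    have "F x \<le> B" by (rule bdd)
    also have "\<dots> \<le> 2 * (B + 1) * 1" using B by simp
    also have "\<dots> \<le> 2 * (B + 1) * exp (lam * (x - M))"
      using False lam B by (intro mult_left_mono) auto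
    also have "\<dots> = C * exp (lam * x)"
      by (simp add: C_def exp_add[symmetric] algebra_simps)
    finally show ?thesis .
  qed
  then show ?thesis using C lam by blast
qed

section \<open>The periodic lattice and sums over a period cell\<close>

locale lattice =
  fixes S :: "(int \<times> int) set" and J :: "int \<times> int \<Rightarrow> real" and N1 N2 :: int
  assumes finite_S: "finite S" and J_nonneg: "\<And>k. J k \<ge> 0" and sum_J: "sum J S = 1"
    and S_sym: "\<And>k. k \<in> S \<Longrightarrow> - k \<in> S" and J_sym: "\<And>k. J (- k) = J k"
    and N1_pos: "N1 > 0" and N2_pos: "N2 > 0"
begin

definition cell :: "(int \<times> int) set" where "cell = {0..<N1} \<times> {0..<N2}"

lemma finite_cell: "finite cell" by (simp add: cell_def)

lemma cell_nonempty: "(0, 0) \<in> cell" using N1_pos N2_pos by (simp add: cell_def)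

lemma sum_cell_shift:
  fixes g :: "int \<times> int \<Rightarrow> real"
  assumes "\<And>i j. g (i + N1, j) = g (i, j)" "\<And>i j. g (i, j + N2) = g (i, j)"
  shows "(\<Sum>s\<in>cell. g (s - k)) = (\<Sum>s\<in>cell. g s)"
proof -
  have "(\<Sum>s\<in>cell. g (s - k)) = (\<Sum>i\<in>{0..<N1}. \<Sum>j\<in>{0..<N2}. g (i - fst k, j - snd k))"
    unfolding cell_def sum.cartesian_product
    by (intro sum.cong) (auto simp: minus_prod_def)
  also have "\<dots> = (\<Sum>i\<in>{0..<N1}. \<Sum>j\<in>{0..<N2}. g (i - fst k, j))"
  proof (rule sum.cong[OF refl])
    fix i
    show "(\<Sum>j\<in>{0..<N2}. g (i - fst k, j - snd k)) = (\<Sum>j\<in>{0..<N2}. g (i - fst k, j))"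
      by (rule sum_shift_period_int[OF N2_pos, of "\<lambda>j. g (i - fst k, j)"]) (rule assms(2))
  qed
  also have "\<dots> = (\<Sum>i\<in>{0..<N1}. \<Sum>j\<in>{0..<N2}. g (i, j))"
    by (rule sum_shift_period_int[OF N1_pos, of "\<lambda>i. \<Sum>j\<in>{0..<N2}. g (i, j)"])
       (simp add: assms(1))
  also have "\<dots> = (\<Sum>s\<in>cell. g s)"
    unfolding cell_def sum.cartesian_product by (intro sum.cong) auto
  finally show ?thesis .
qed

lemma cell_rep:
  fixes g :: "int \<times> int \<Rightarrow> 'b"
  assumes "\<And>i j. g (i + N1, j) = g (i, j)" "\<And>i j. g (i, j + N2) = g (i, j)"
  shows "\<exists>s0\<in>cell. g s = g s0"
proof
  show "(fst s mod N1, snd s mod N2) \<in> cell"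
    using N1_pos N2_pos by (simp add: cell_def)
  show "g s = g (fst s mod N1, snd s mod N2)"
    using periodic_mod_int[of "\<lambda>i. g (i, snd s mod N2)" N1 "fst s"]
      periodic_mod_int[of "\<lambda>j. g (fst s, j)" N2 "snd s"] assms
    by simp
qed

lemma finite_range_periodic:
  fixes g :: "int \<times> int \<Rightarrow> 'b"
  assumes "\<And>i j. g (i + N1, j) = g (i, j)" "\<And>i j. g (i, j + N2) = g (i, j)"
  shows "finite (range g)"
proof -
  have "range g \<subseteq> g ` cell" using cell_rep[of g, OF assms] by blast
  then show ?thesis using finite_cell finite_surj by blast
qed

end

text \<open>A front is turned into a nondecreasing profile that leaves \<open>0\<close> at \<open>-\<infinity>\<close>: its limit on the
  side of interest is subtracted, and if necessary the front variable is reflected, which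
  replaces \<open>x\<close> by \<open>- x\<close> and changes the sign of the speed.\<close>

locale front = lattice S J N1 N2 for S J N1 N2 +
  fixes x :: "int \<times> int \<Rightarrow> real" and c :: real
    and h h' g g' :: "int \<times> int \<Rightarrow> real \<Rightarrow> real" and b C :: real
  assumes x_diff: "\<And>s k. x (s - k) = x s - x k"
    and g_deriv: "\<And>s y. (g s has_real_derivative g' s y) (at y)"
    and g_eq: "\<And>s y. c * g' s y = (\<Sum>k\<in>S. J k * g (s - k) (y - x k)) - g s y + h s (g s y)"
    and g_mono: "\<And>s y z. y \<le> z \<Longrightarrow> g s y \<le> g s z"
    and g_bot: "\<And>s. (g s \<longlongrightarrow> 0) at_bot" and g_top: "\<And>s. (g s \<longlongrightarrow> b) at_top"
    and g_per: "\<And>i j. g (i + N1, j) = g (i, j)" "\<And>i j. g (i, j + N2) = g (i, j)"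
    and b_pos: "b > 0" and b_le: "b \<le> 1"
    and h_deriv: "\<And>s w. (h s has_real_derivative h' s w) (at w)"
    and h'_bound: "\<And>s w. \<bar>w\<bar> \<le> 1 \<Longrightarrow> \<bar>h' s w\<bar> \<le> C"
    and h_0: "\<And>s. h s 0 = 0"
begin

section \<open>Elementary bounds for a normalised profile\<close>

lemma g_nonneg: "g s y \<ge> 0"
proof (rule tendsto_upperbound[OF g_bot])
  show "\<forall>\<^sub>F z in at_bot. g s z \<le> g s y"
    using eventually_le_at_bot[of y] by eventually_elim (rule g_mono)
qed simp

lemma g_le: "g s y \<le> b"
proof (rule tendsto_lowerbound[OF g_top])
  show "\<forall>\<^sub>F z in at_top. g s y \<le> g s z"
    using eventually_ge_at_top[of y] by eventually_elim (rule g_mono)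
qed simp

lemma g'_nonneg: "g' s y \<ge> 0"
proof (rule tendsto_lowerbound)
  show "((\<lambda>z. (g s z - g s y) / (z - y)) \<longlongrightarrow> g' s y) (at y)"
    using g_deriv[of s y] by (simp add: has_field_derivative_iff)
  show "\<forall>\<^sub>F z in at y. 0 \<le> (g s z - g s y) / (z - y)"
  proof (rule always_eventually, rule allI)
    fix z show "0 \<le> (g s z - g s y) / (z - y)"
      using g_mono[of y z s] g_mono[of z y s] by (cases "y \<le> z") (auto simp: divide_nonpos_nonpos)
  qed
qed simp

lemma g_cont: "continuous_on A (g s)"
  by (meson DERIV_continuous_on g_deriv has_field_derivative_at_within)

lemma g_isCont: "isCont (g s) y"
  using DERIV_isCont g_deriv by blast

lemma finite_range_g: "finite (range g)"
  by (rule finite_range_periodic) (rule g_per)+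

lemma h_lip:
  assumes "\<bar>v\<bar> \<le> 1" "\<bar>w\<bar> \<le> 1"
  shows "\<bar>h s v - h s w\<bar> \<le> C * \<bar>v - w\<bar>"
proof -
  have "norm (h s v - h s w) \<le> C * norm (v - w)"
    by (rule field_differentiable_bound[of "{-1..1}" "h s" "h' s"])
       (use assms in \<open>auto intro!: h'_bound intro: h_deriv has_field_derivative_at_within\<close>)
  then show ?thesis by simp
qed

lemma C_nonneg: "C \<ge> 0"
  using h'_bound[of 0 undefined] by force

lemma h_le: "0 \<le> w \<Longrightarrow> w \<le> b \<Longrightarrow> \<bar>h s w\<bar> \<le> C * w"
  using h_lip[of w 0 s] h_0[of s] b_le by simp

lemma uniform_limits:
  assumes e: "e > 0"
  shows "\<exists>M>0. \<forall>s y. (y \<le> - M \<longrightarrow> g s y \<le> e) \<and> (y \<ge> M \<longrightarrow> b - e \<le> g s y)"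
proof -
  \<comment> \<open>The bound M is written as 1 / e0, since \<open>finite_uniform_small\<close>
    produces small numbers.\<close>
  have "\<exists>e0>0. \<forall>v\<in>range g. \<forall>y. (y \<le> - (1 / e0) \<longrightarrow> v y \<le> e) \<and> (y \<ge> 1 / e0 \<longrightarrow> b - e \<le> v y)"
  proof (rule finite_uniform_small[OF finite_range_g])
    fix v assume "v \<in> range g"
    then obtain s where v: "v = g s" by auto
    have "\<forall>\<^sub>F y in at_bot. v y < e" unfolding v by (rule order_tendstoD(2)[OF g_bot e])
    then obtain M1 where M1: "\<And>y. y \<le> M1 \<Longrightarrow> v y < e" by (auto simp: eventually_at_bot_linorder)
    have "\<forall>\<^sub>F y in at_top. v y > b - e" unfolding v using e by (intro order_tendstoD(1)[OF g_top]) simp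
    then obtain M2 where M2: "\<And>y. y \<ge> M2 \<Longrightarrow> v y > b - e" by (auto simp: eventually_at_top_linorder)
    define M where "M = \<bar>M1\<bar> + \<bar>M2\<bar> + 1"
    have M: "M > 0" by (simp add: M_def)
    show "\<exists>e0>0. \<forall>e'. 0 < e' \<and> e' \<le> e0 \<longrightarrow> (\<forall>y. (y \<le> - (1 / e') \<longrightarrow> v y \<le> e) \<and> (y \<ge> 1 / e' \<longrightarrow> b - e \<le> v y))"
    proof (intro exI[of _ "1 / M"] conjI allI impI)
      show "1 / M > 0" using M by simp
      fix e' y :: real assume e': "0 < e' \<and> e' \<le> 1 / M"
      then have "M \<le> 1 / e'" using M by (simp add: field_simps)
      then have M12: "- (1 / e') \<le> M1" "1 / e' \<ge> M2" by (auto simp: M_def)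
      show "v y \<le> e" if "y \<le> - (1 / e')"
        using M1[of y] that M12 by simp
      show "b - e \<le> v y" if "y \<ge> 1 / e'"
        using M2[of y] that M12 by simp
    qed
  qed
  then obtain e0 where "e0 > 0" "\<forall>v\<in>range g. \<forall>y. (y \<le> - (1 / e0) \<longrightarrow> v y \<le> e) \<and> (y \<ge> 1 / e0 \<longrightarrow> b - e \<le> v y)"
    by blast
  then show ?thesis by (intro exI[of _ "1 / e0"]) auto
qed

section \<open>First integral, exponential decay and the sign of the speed\<close>

definition R0 where "R0 = (\<Sum>k\<in>S. \<bar>x k\<bar>)"

lemma x_le_R0: "k \<in> S \<Longrightarrow> \<bar>x k\<bar> \<le> R0"
  unfolding R0_def by (rule member_le_sum) (auto simp: finite_S)

lemma R0_nonneg: "R0 \<ge> 0" by (simp add: R0_def sum_nonneg)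

definition Phi where "Phi y = (\<Sum>s\<in>cell. g s y)"

lemma Phi_nonneg: "Phi y \<ge> 0" by (simp add: Phi_def sum_nonneg g_nonneg)

lemma Phi_mono: "y \<le> z \<Longrightarrow> Phi y \<le> Phi z"
  by (simp add: Phi_def sum_mono g_mono)

lemma g_le_Phi: "g s y \<le> Phi y"
proof -
  obtain s0 where s0: "s0 \<in> cell" "g s = g s0" using cell_rep[of g s, OF g_per] by blast
  have "g s0 y \<le> Phi y" unfolding Phi_def
    by (rule member_le_sum) (use s0 finite_cell g_nonneg in auto)
  then show ?thesis using s0 by simp
qed

lemma x_0: "x 0 = 0" using x_diff[of 0 0] by simp

lemma x_minus: "x (- k) = - x k" using x_diff[of 0 k] x_0 by simp

text \<open>An even kernel has no drift. Therefore the limit of the first integral at +\<infinity>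
  contains only the speed, from which \<open>speed_pos\<close> reads off its sign.\<close>

lemma J_first_moment: "(\<Sum>k\<in>S. J k * x k) = 0"
proof -
  have "(\<Sum>k\<in>S. J k * x k) = (\<Sum>k\<in>S. J (- k) * x (- k))"
    by (rule sum.reindex_bij_witness[where i = uminus and j = uminus]) (auto simp: S_sym)
  also have "\<dots> = - (\<Sum>k\<in>S. J k * x k)" by (simp add: J_sym x_minus sum_negf)
  finally show ?thesis by simp
qed

text \<open>Summed over a period cell, the equation has the first integral below up to the reaction
  terms. It yields both the sign of the speed and the exponential decay, whatever the sign of
  the reaction.\<close>

lemma first_integral:
  "\<exists>E P. (\<forall>y. (P has_real_derivative Phi y) (at y)) \<and>
     (\<forall>y. E y = c * Phi y - (\<Sum>k\<in>S. J k * (P (y - x k) - P y))) \<and>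
     (\<forall>y. (E has_real_derivative (\<Sum>s\<in>cell. h s (g s y))) (at y))"
proof -
  have "\<exists>P. \<forall>y::real. - \<infinity> < ereal y \<longrightarrow> ereal y < \<infinity> \<longrightarrow> (P has_vector_derivative Phi y) (at y)"
    unfolding Phi_def by (rule einterval_antiderivative) (auto intro!: continuous_intros g_isCont)
  then obtain P where P: "\<And>y. (P has_real_derivative Phi y) (at y)"
    by (auto simp: has_real_derivative_iff_has_vector_derivative)
  \<comment> \<open>Differentiating the differences of \<open>P\<close> gives back the nonlocal term
    of the summed equation, so only the reaction survives in the derivative of
    \<open>E\<close>.\<close>
  define E where "E = (\<lambda>y. c * Phi y - (\<Sum>k\<in>S. J k * (P (y - x k) - P y)))"
  have dPhi: "(Phi has_real_derivative (\<Sum>s\<in>cell. g' s y)) (at y)" for y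
    unfolding Phi_def by (auto intro!: derivative_eq_intros g_deriv)
  have dP: "((\<lambda>y. P (y - a)) has_real_derivative Phi (y - a)) (at y)" for y a
    by (rule DERIV_chain2[where f = P and g = "\<lambda>y. y - a" and Db = 1, simplified])
       (auto intro!: derivative_eq_intros P)
  have "(E has_real_derivative (\<Sum>s\<in>cell. h s (g s y))) (at y)" for y
  proof -
    have "(E has_real_derivative c * (\<Sum>s\<in>cell. g' s y) - (\<Sum>k\<in>S. J k * (Phi (y - x k) - Phi y))) (at y)"
      unfolding E_def
      by (intro DERIV_diff DERIV_cmult DERIV_sum dPhi dP P)
    moreover have "c * (\<Sum>s\<in>cell. g' s y) - (\<Sum>k\<in>S. J k * (Phi (y - x k) - Phi y)) = (\<Sum>s\<in>cell. h s (g s y))"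
    proof -
      have sh: "(\<Sum>s\<in>cell. g (s - k) z) = Phi z" for k z
        unfolding Phi_def by (rule sum_cell_shift[of "\<lambda>s. g s z"]) (simp_all add: g_per)
      have "c * (\<Sum>s\<in>cell. g' s y) = (\<Sum>s\<in>cell. (\<Sum>k\<in>S. J k * g (s - k) (y - x k)) - g s y + h s (g s y))"
        by (simp add: sum_distrib_left g_eq)
      also have "\<dots> = (\<Sum>s\<in>cell. \<Sum>k\<in>S. J k * g (s - k) (y - x k)) - Phi y + (\<Sum>s\<in>cell. h s (g s y))"
        by (simp add: sum.distrib sum_subtractf Phi_def)
      also have "(\<Sum>s\<in>cell. \<Sum>k\<in>S. J k * g (s - k) (y - x k)) = (\<Sum>k\<in>S. J k * Phi (y - x k))"
        by (subst sum.swap) (simp add: sum_distrib_left[symmetric] sh)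
      finally have 1: "c * (\<Sum>s\<in>cell. g' s y) = (\<Sum>k\<in>S. J k * Phi (y - x k)) - Phi y + (\<Sum>s\<in>cell. h s (g s y))" .
      have "(\<Sum>k\<in>S. J k * (Phi (y - x k) - Phi y)) = (\<Sum>k\<in>S. J k * Phi (y - x k)) - Phi y"
        by (simp add: right_diff_distrib sum_subtractf sum_distrib_right[symmetric] sum_J)
      then show ?thesis using 1 by simp
    qed
    ultimately show ?thesis by simp
  qed
  then show ?thesis using P by (intro exI[of _ E] exI[of _ P]) (auto simp: E_def)
qed

text \<open>Each difference of \<open>P\<close> integrates \<open>Phi\<close> over an interval of
  length at most \<open>R0\<close> to the left of y + R0, and \<open>Phi\<close> is monotone. So
  \<open>E\<close> vanishes at -\<infinity> and is controlled by a shifted copy of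
  \<open>Phi\<close> itself.\<close>

lemma first_integral_bound:
  assumes P: "\<And>y. (P has_real_derivative Phi y) (at y)"
    and E: "\<And>y. E y = c * Phi y - (\<Sum>k\<in>S. J k * (P (y - x k) - P y))"
  shows "\<bar>E y\<bar> \<le> (\<bar>c\<bar> + R0) * Phi (y + R0)"
proof -
  have Pd: "\<bar>P (y - z) - P y\<bar> \<le> R0 * Phi (y + R0)" if z: "\<bar>z\<bar> \<le> R0" for y z
  proof -
    have "norm (P (y - z) - P y) \<le> Phi (y + R0) * norm (y - z - y)"
    proof (rule field_differentiable_bound[of "{..y + R0}" P Phi])
      fix w assume "w \<in> {..y + R0}"
      then show "norm (Phi w) \<le> Phi (y + R0)" using Phi_nonneg Phi_mono by simp
    qed (use z R0_nonneg in \<open>auto intro: P has_field_derivative_at_within\<close>)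
    also have "\<dots> \<le> Phi (y + R0) * R0" using z Phi_nonneg by (intro mult_left_mono) auto
    finally show ?thesis by (simp add: mult.commute)
  qed
  have "\<bar>\<Sum>k\<in>S. J k * (P (y - x k) - P y)\<bar> \<le> (\<Sum>k\<in>S. J k * (R0 * Phi (y + R0)))"
  proof (rule order_trans[OF sum_abs], rule sum_mono)
    fix k assume "k \<in> S"
    then show "\<bar>J k * (P (y - x k) - P y)\<bar> \<le> J k * (R0 * Phi (y + R0))"
      using Pd[OF x_le_R0] J_nonneg[of k] by (simp add: abs_mult mult_left_mono)
  qed
  also have "\<dots> = R0 * Phi (y + R0)" by (simp add: sum_distrib_right[symmetric] sum_J)
  finally have 1: "\<bar>\<Sum>k\<in>S. J k * (P (y - x k) - P y)\<bar> \<le> R0 * Phi (y + R0)" .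
  have "\<bar>c * Phi y\<bar> \<le> \<bar>c\<bar> * Phi (y + R0)"
    using Phi_nonneg Phi_mono[of y "y + R0"] R0_nonneg by (simp add: abs_mult mult_left_mono)
  then show ?thesis unfolding E using 1 by (simp add: distrib_right)
qed

text \<open>Over an interval of length R far to the left the reaction changes \<open>E\<close> by at
  least R * d times the value of \<open>Phi\<close> at the left end, but \<open>E\<close> is at most
  a multiple of \<open>Phi\<close> slightly further right. A long interval therefore forces
  \<open>Phi\<close> to halve. The factor \<open>sg\<close> is 1 at an unstable zero and -1 at a
  stable one; absolute values make the two cases alike.\<close>

lemma exp_decay:
  assumes sg: "sg = 1 \<or> sg = - 1" and d: "d > 0" and eta: "eta > 0"
    and sgn: "\<And>s w. 0 \<le> w \<Longrightarrow> w \<le> eta \<Longrightarrow> sg * h s w \<ge> d * w"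
  shows "\<exists>K>0. \<exists>lam>0. \<forall>s y. g s y \<le> K * exp (lam * y)"
proof -
  obtain E P where P: "\<And>y. (P has_real_derivative Phi y) (at y)"
    and E: "\<And>y. E y = c * Phi y - (\<Sum>k\<in>S. J k * (P (y - x k) - P y))"
    and dE: "\<And>y. (E has_real_derivative (\<Sum>s\<in>cell. h s (g s y))) (at y)"
    using first_integral by blast
  define A where "A = \<bar>c\<bar> + R0"
  have Eb: "\<bar>E y\<bar> \<le> A * Phi (y + R0)" for y
    unfolding A_def by (rule first_integral_bound[OF P E])
  have A: "A \<ge> 0" by (simp add: A_def R0_nonneg)
  obtain M where M: "M > 0" "\<And>s y. y \<le> - M \<Longrightarrow> g s y \<le> eta"
    using uniform_limits[OF eta] by blast
  have dl: "d * Phi y \<le> \<bar>\<Sum>s\<in>cell. h s (g s y)\<bar>" if "y \<le> - M" for y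
  proof -
    have "d * Phi y \<le> (\<Sum>s\<in>cell. sg * h s (g s y))"
      unfolding Phi_def sum_distrib_left by (intro sum_mono sgn g_nonneg M that)
    also have "\<dots> = sg * (\<Sum>s\<in>cell. h s (g s y))" by (simp add: sum_distrib_left)
    also have "\<dots> \<le> \<bar>\<Sum>s\<in>cell. h s (g s y)\<bar>" using sg by auto
    finally show ?thesis .
  qed
  \<comment> \<open>This gives R * d = 4 * A + d, so that 2 * A * Phi y is at most half of R * d *
    Phi y. The shift by \<open>R0\<close> below keeps the arguments of \<open>Phi\<close> in both
    estimates of \<open>E\<close> at or before y.\<close>
  define R where "R = 4 * A / d + 1"
  have R: "R > 0" using A d by (simp add: R_def add_nonneg_pos)
  have half: "Phi (y - (R + R0)) \<le> Phi y / 2" if y: "y \<le> - M" for y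
  proof -
    define z where "z = y - R0"
    have z: "z \<le> - M" using y R0_nonneg by (simp add: z_def)
    obtain w where w: "z - R < w" "w < z" "E z - E (z - R) = (z - (z - R)) * (\<Sum>s\<in>cell. h s (g s w))"
      using MVT2[of "z - R" z E "\<lambda>y. \<Sum>s\<in>cell. h s (g s y)"] R dE by auto
    have "R * (d * Phi (z - R)) \<le> R * (d * Phi w)"
      using w R d by (intro mult_left_mono Phi_mono) auto
    also have "\<dots> \<le> R * \<bar>\<Sum>s\<in>cell. h s (g s w)\<bar>"
      using R w z by (intro mult_left_mono dl) auto
    also have "\<dots> = \<bar>E z - E (z - R)\<bar>" using w R by (simp add: abs_mult)
    also have "\<dots> \<le> A * Phi (z + R0) + A * Phi (z - R + R0)"
      using Eb[of z] Eb[of "z - R"] by linarith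
    also have "\<dots> \<le> A * Phi y + A * Phi y"
      using A R by (intro add_mono mult_left_mono Phi_mono) (auto simp: z_def)
    finally have 1: "(R * d) * Phi (z - R) \<le> 2 * A * Phi y" by simp
    have Rd: "R * d = 4 * A + d" using d by (simp add: R_def field_simps)
    have "(4 * A + d) * Phi (z - R) \<le> (4 * A + d) * (Phi y / 2)"
    proof -
      have "0 \<le> d * Phi y" using d Phi_nonneg by simp
      then show ?thesis using 1 unfolding Rd by (simp add: algebra_simps)
    qed
    then have "Phi (z - R) \<le> Phi y / 2"
      using d A by (subst (asm) mult_le_cancel_left_pos) auto
    then show ?thesis by (simp add: z_def algebra_simps)
  qed
  have "Phi y \<le> (\<Sum>s\<in>cell. b)" for y unfolding Phi_def by (intro sum_mono g_le)
  then have "\<exists>K>0. \<exists>lam>0. \<forall>y. Phi y \<le> K * exp (lam * y)"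
    using half R R0_nonneg
    by (intro exp_decay_of_halving[where D = "R + R0" and M = "- M" and B = "\<Sum>s\<in>cell. b"])
       (auto intro: Phi_mono Phi_nonneg)
  then show ?thesis using g_le_Phi order_trans by meson
qed

text \<open>The first integral is nondecreasing, since the reaction is nonnegative along the
  profile, and vanishes at -\<infinity>. At +\<infinity> it is at most c * B up to a vanishing
  error. With c \<le> 0 it would be identically 0, hence so would the reaction along the profile,
  but the profile takes the value b / 2.\<close>

lemma speed_pos:
  assumes pos: "\<And>s w. 0 < w \<Longrightarrow> w < b \<Longrightarrow> h s w > 0" and h_b: "\<And>s. h s b = 0"
  shows "c > 0"
proof -
  obtain E P where P: "\<And>y. (P has_real_derivative Phi y) (at y)"
    and E: "\<And>y. E y = c * Phi y - (\<Sum>k\<in>S. J k * (P (y - x k) - P y))"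
    and dE: "\<And>y. (E has_real_derivative (\<Sum>s\<in>cell. h s (g s y))) (at y)"
    using first_integral by blast
  have hn: "h s (g s y) \<ge> 0" for s y
  proof -
    have "0 < g s y \<and> g s y < b \<or> g s y = 0 \<or> g s y = b"
      using g_nonneg[of s y] g_le[of s y] by linarith
    then show ?thesis
      using less_imp_le[OF pos] h_0 h_b by (metis order_refl)
  qed
  have mono: "E y \<le> E z" if "y \<le> z" for y z
    using that by (rule DERIV_nonneg_imp_nondecreasing) (metis dE sum_nonneg hn)
  define B where "B = (\<Sum>s\<in>cell. b)"
  have Phi_top: "(Phi \<longlongrightarrow> B) at_top"
    unfolding Phi_def[abs_def] B_def by (intro tendsto_sum g_top)
  have "(Phi \<longlongrightarrow> (\<Sum>s\<in>cell. 0)) at_bot"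
    unfolding Phi_def[abs_def] by (intro tendsto_sum g_bot)
  then have Phi_bot: "(Phi \<longlongrightarrow> 0) at_bot" by simp
  have PhiB: "Phi y \<le> B" for y unfolding Phi_def B_def by (intro sum_mono g_le)
  \<comment> \<open>\<open>P\<close> is compared with the line of slope \<open>B\<close>, the limit
    of its own slope at +\<infinity>. The error is controlled by B - Phi, and the linear part drops
    out of the sum over the kernel.\<close>
  have Pd: "\<bar>P (y - z) - P y + z * B\<bar> \<le> R0 * (B - Phi (y - R0))" if z: "\<bar>z\<bar> \<le> R0" for y z
  proof -
    have "norm ((P (y - z) - B * (y - z)) - (P y - B * y)) \<le> (B - Phi (y - R0)) * norm (y - z - y)"
    proof (rule field_differentiable_bound[of "{y - R0..}" "\<lambda>w. P w - B * w" "\<lambda>w. Phi w - B"])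
      fix w assume w: "w \<in> {y - R0..}"
      then show "norm (Phi w - B) \<le> B - Phi (y - R0)"
        using PhiB[of w] Phi_mono[of "y - R0" w] by simp
      show "((\<lambda>w. P w - B * w) has_real_derivative Phi w - B) (at w within {y - R0..})"
        using has_field_derivative_at_within[OF P] by (auto intro!: derivative_eq_intros)
    qed (use z R0_nonneg in auto)
    also have "\<dots> \<le> (B - Phi (y - R0)) * R0" using z PhiB[of "y - R0"] by (intro mult_left_mono) auto
    finally show ?thesis by (simp add: algebra_simps)
  qed
  have Etop: "E y \<le> c * Phi y + R0 * (B - Phi (y - R0))" for y
  proof -
    have "(\<Sum>k\<in>S. J k * (P (y - x k) - P y)) = (\<Sum>k\<in>S. J k * (P (y - x k) - P y + x k * B)) - (\<Sum>k\<in>S. J k * x k) * B"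
      by (simp add: sum_distrib_left sum.distrib sum_subtractf algebra_simps)
    then have eq: "(\<Sum>k\<in>S. J k * (P (y - x k) - P y)) = (\<Sum>k\<in>S. J k * (P (y - x k) - P y + x k * B))"
      by (simp add: J_first_moment)
    have "\<bar>\<Sum>k\<in>S. J k * (P (y - x k) - P y + x k * B)\<bar> \<le> (\<Sum>k\<in>S. J k * (R0 * (B - Phi (y - R0))))"
    proof (rule order_trans[OF sum_abs], rule sum_mono)
      fix k assume "k \<in> S"
      then show "\<bar>J k * (P (y - x k) - P y + x k * B)\<bar> \<le> J k * (R0 * (B - Phi (y - R0)))"
        using Pd[OF x_le_R0] J_nonneg[of k] by (simp add: abs_mult mult_left_mono)
    qed
    also have "\<dots> = R0 * (B - Phi (y - R0))" by (simp add: sum_distrib_right[symmetric] sum_J)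
    finally show ?thesis unfolding E eq by linarith
  qed
  have E_nonneg: "E y \<ge> 0" for y
  proof (rule tendsto_upperbound)
    have sh: "filterlim (\<lambda>z. z + R0) at_bot at_bot"
      unfolding filterlim_at_bot
    proof
      fix Z show "\<forall>\<^sub>F z in at_bot. z + R0 \<le> Z"
        using eventually_le_at_bot[of "Z - R0"] by eventually_elim simp
    qed
    show "((\<lambda>z. - ((\<bar>c\<bar> + R0) * Phi (z + R0))) \<longlongrightarrow> 0) at_bot"
      by (rule tendsto_eq_intros filterlim_compose[OF Phi_bot sh] refl)+ simp
    show "\<forall>\<^sub>F z in at_bot. - ((\<bar>c\<bar> + R0) * Phi (z + R0)) \<le> E y"
      using eventually_le_at_bot[of y]
    proof eventually_elim
      case (elim z)
      then show ?case using mono[of z y] first_integral_bound[OF P E, of z] by linarith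
    qed
  qed simp
  show ?thesis
  proof (rule ccontr)
    assume "\<not> c > 0"
    then have c: "c \<le> 0" by simp
    have "E y \<le> 0" for y
    proof (rule tendsto_lowerbound)
      have sh: "filterlim (\<lambda>z. z - R0) at_top at_top"
        unfolding filterlim_at_top
      proof
        fix Z show "\<forall>\<^sub>F z in at_top. Z \<le> z - R0"
          using eventually_ge_at_top[of "Z + R0"] by eventually_elim simp
      qed
      show "((\<lambda>z. R0 * (B - Phi (z - R0))) \<longlongrightarrow> 0) at_top"
        by (rule tendsto_eq_intros filterlim_compose[OF Phi_top sh] refl)+ simp
      show "\<forall>\<^sub>F z in at_top. E y \<le> R0 * (B - Phi (z - R0))"
        using eventually_ge_at_top[of y]
      proof eventually_elim
        case (elim z)
        have "c * Phi z \<le> 0" using c Phi_nonneg by (simp add: mult_nonpos_nonneg)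
        then show ?case using mono[OF elim] Etop[of z] by linarith
      qed
    qed simp
    then have "E = (\<lambda>_. 0)" using E_nonneg by (auto intro: antisym)
    then have z: "(\<Sum>s\<in>cell. h s (g s y)) = 0" for y
      using DERIV_unique[OF dE[of y], of 0] by simp
    have hz: "h (0, 0) (g (0, 0) y) = 0" for y
      using z[of y] hn cell_nonempty by (simp add: sum_nonneg_eq_0_iff finite_cell)
    obtain M where M: "M > 0" "\<And>y. y \<le> - M \<Longrightarrow> g (0, 0) y \<le> b / 4" "\<And>y. y \<ge> M \<Longrightarrow> b - b / 4 \<le> g (0, 0) y"
      using uniform_limits[of "b / 4"] b_pos by auto
    have "\<exists>y. - M \<le> y \<and> y \<le> M \<and> g (0, 0) y = b / 2"
      using M(1) M(2)[of "- M"] M(3)[of M] b_pos by (intro IVT) (auto intro: g_isCont)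
    then obtain y where "g (0, 0) y = b / 2" by blast
    then show False using pos[of "g (0, 0) y" "(0, 0)"] hz[of y] b_pos by simp
  qed
qed

text \<open>Along \<open>y = x s + c t\<close> the profile is a solution of the lattice system. A zero spreads at
  once to all sites that interact with it, and on this set of sites the solution then stays zero
  at later times, although it must tend to \<open>b\<close>.\<close>

lemma g_pos:
  assumes c: "c > 0"
  shows "g s y > 0"
proof (rule ccontr)
  assume "\<not> g s y > 0"
  then have gs0: "g s y = 0" using g_nonneg[of s y] by simp
  define z where "z = (\<lambda>s t. g s (x s + c * t))"
  define zd where "zd = (\<lambda>s t. (\<Sum>k\<in>S. J k * z (s - k) t) - z s t + h s (z s t))"
  have z_deriv: "(z s has_real_derivative zd s t) (at t)" for s t
  proof -
    have "((\<lambda>t. g s (x s + c * t)) has_real_derivative g' s (x s + c * t) * c) (at t)"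
      by (rule DERIV_chain2[OF g_deriv]) (auto intro!: derivative_eq_intros)
    moreover have "g' s (x s + c * t) * c = zd s t"
      using g_eq[of s "x s + c * t"] by (simp add: zd_def z_def x_diff algebra_simps)
    ultimately show ?thesis by (simp add: z_def)
  qed
  have z_nonneg: "z s t \<ge> 0" and z_le: "z s t \<le> b" for s t
    by (simp_all add: z_def g_nonneg g_le)
  define Z where "Z = (\<lambda>t. {s. z s t = 0})"
  \<comment> \<open>A zero is a minimum in time, so the time derivative vanishes, and the equation
    then leaves a sum of nonnegative terms equal to 0.\<close>
  have spread: "s - k \<in> Z t" if "s \<in> Z t" "k \<in> S" "J k \<noteq> 0" for s k t
  proof -
    have "zd s t = 0"
      by (rule DERIV_local_min[OF z_deriv zero_less_one]) (use that z_nonneg in \<open>simp add: Z_def\<close>)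
    then have "(\<Sum>k\<in>S. J k * z (s - k) t) = 0" using that by (simp add: zd_def Z_def h_0)
    then have "J k * z (s - k) t = 0"
      using that J_nonneg z_nonneg by (subst (asm) sum_nonneg_eq_0_iff) (auto simp: finite_S)
    then show ?thesis using that by (simp add: Z_def)
  qed
  \<comment> \<open>On the sites of \<open>Z t\<close> the derivative is at most 1 + C times a bound
    for the values there, and these start from 0. A time interval of length d, with d * (1 + C) = 1
    / 2, thus halves every bound, and iterating gives 0.\<close>
  define d where "d = 1 / (2 * (1 + C))"
  have d: "d > 0" using C_nonneg by (simp add: d_def)
  have half: "z s u \<le> b / 2 ^ n" if "s \<in> Z t" "t \<le> u" "u \<le> t + d" for s t u n
    using that
  proof (induction n arbitrary: s u)
    case 0
    then show ?case using z_le by simp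
  next
    case (Suc n)
    show ?case
    proof (cases "t = u")
      case True
      then show ?thesis using Suc.prems b_pos by (simp add: Z_def)
    next
      case False
      obtain w where w: "t < w" "w < u" "z s u - z s t = (u - t) * zd s w"
        using MVT2[of t u "z s" "zd s"] z_deriv False Suc.prems by auto
      have nb: "J k * z (s - k) w \<le> J k * (b / 2 ^ n)" if "k \<in> S" for k
      proof (cases "J k = 0")
        case False
        then have "z (s - k) w \<le> b / 2 ^ n"
          using Suc.IH[of "s - k" w] spread[OF Suc.prems(1) that] w Suc.prems by simp
        then show ?thesis by (rule mult_left_mono[OF _ J_nonneg])
      qed simp
      have zs: "z s w \<le> b / 2 ^ n" using Suc.IH[of s w] w Suc.prems by simp
      have "zd s w \<le> (\<Sum>k\<in>S. J k * (b / 2 ^ n)) + C * (b / 2 ^ n)"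
      proof -
        have "(\<Sum>k\<in>S. J k * z (s - k) w) \<le> (\<Sum>k\<in>S. J k * (b / 2 ^ n))" by (intro sum_mono nb)
        moreover have "h s (z s w) \<le> C * z s w" using h_le[OF z_nonneg z_le, of s s w] by linarith
        moreover have "C * z s w \<le> C * (b / 2 ^ n)" by (rule mult_left_mono[OF zs C_nonneg])
        ultimately show ?thesis using z_nonneg[of s w] by (simp add: zd_def)
      qed
      also have "\<dots> = (1 + C) * (b / 2 ^ n)"
        by (simp only: sum_distrib_right[symmetric] sum_J distrib_right)
      finally have zd: "zd s w \<le> (1 + C) * (b / 2 ^ n)" .
      have "z s u = (u - t) * zd s w" using w Suc.prems by (simp add: Z_def)
      also have "\<dots> \<le> (u - t) * ((1 + C) * (b / 2 ^ n))"
        using zd w by (intro mult_left_mono) auto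
      also have "\<dots> \<le> d * ((1 + C) * (b / 2 ^ n))"
        using Suc.prems b_pos C_nonneg by (intro mult_right_mono) auto
      also have "\<dots> = (d * (1 + C)) * (b / 2 ^ n)" by simp
      also have "d * (1 + C) = 1 / 2" using C_nonneg by (simp add: d_def)
      also have "1 / 2 * (b / 2 ^ n) = b / 2 ^ Suc n" by simp
      finally show ?thesis .
    qed
  qed
  have step: "s \<in> Z (t + d)" if "s \<in> Z t" for s t
  proof -
    have "(\<lambda>n. b * (1 / 2) ^ n) \<longlonglongrightarrow> b * 0"
      by (intro tendsto_mult tendsto_const LIMSEQ_power_zero) simp
    moreover have "\<forall>n. z s (t + d) \<le> b * (1 / 2) ^ n"
      using half[OF that, of "t + d"] d by (simp add: power_one_over field_simps)
    ultimately have "z s (t + d) \<le> b * 0" by (intro LIMSEQ_le_const) auto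
    then show ?thesis using z_nonneg[of s "t + d"] by (simp add: Z_def)
  qed
  define t0 where "t0 = (y - x s) / c"
  have "s \<in> Z (t0 + real n * d)" for n
  proof (induction n)
    case 0
    then show ?case using gs0 c by (simp add: Z_def z_def t0_def)
  next
    case (Suc n)
    then show ?case using step[OF Suc] by (simp add: algebra_simps)
  qed
  then have zero: "g s (y + real n * (c * d)) = 0" for n
  proof -
    have "x s + c * (t0 + real n * d) = y + real n * (c * d)"
      using c by (simp add: t0_def field_simps)
    then show ?thesis using \<open>s \<in> Z (t0 + real n * d)\<close> by (simp add: Z_def z_def)
  qed
  obtain M where M: "\<And>y. y \<ge> M \<Longrightarrow> b - b / 2 \<le> g s y"
    using uniform_limits[of "b / 2"] b_pos by (metis half_gt_zero)
  obtain n where "(M - y) / (c * d) \<le> real n" using real_arch_simple by blast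
  then have "M \<le> y + real n * (c * d)" using c d by (simp add: field_simps)
  then show False using M zero[of n] b_pos by fastforce
qed

text \<open>The derivative solves a linear equation whose nonlocal term is nonnegative. Multiplied
  by exp (B * y) it is nondecreasing, so a zero extends to the whole left half-line. The profile
  would be constant there, hence equal to its limit 0, against \<open>g_pos\<close>.\<close>

lemma g'_pos:
  assumes c: "c > 0"
  shows "g' s y > 0"
proof (rule ccontr)
  assume "\<not> g' s y > 0"
  then have gs0: "g' s y = 0" using g'_nonneg[of s y] by simp
  define B where "B = (1 + C) / c"
  define gg where "gg = (\<lambda>y. ((\<Sum>k\<in>S. J k * g' (s - k) (y - x k)) - g' s y + h' s (g s y) * g' s y) / c)"
  have d2: "(g' s has_real_derivative gg y) (at y)" for y
  proof -
    have eq: "g' s = (\<lambda>y. ((\<Sum>k\<in>S. J k * g (s - k) (y - x k)) - g s y + h s (g s y)) / c)"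
      using c by (auto simp: g_eq[symmetric])
    have sh: "((\<lambda>y. g (s - k) (y - x k)) has_real_derivative g' (s - k) (y - x k)) (at y)" for k y
      by (rule DERIV_chain2[where f = "g (s - k)" and g = "\<lambda>y. y - x k" and Db = 1, simplified])
         (auto intro!: derivative_eq_intros g_deriv)
    have "((\<lambda>y. ((\<Sum>k\<in>S. J k * g (s - k) (y - x k)) - g s y + h s (g s y)) / c) has_real_derivative gg y) (at y)"
      unfolding gg_def
      by (intro DERIV_cdivide DERIV_add DERIV_diff DERIV_sum DERIV_cmult sh g_deriv
          DERIV_chain2[OF h_deriv])
    then show ?thesis by (simp add: eq[symmetric])
  qed
  have ge: "gg y + B * g' s y \<ge> 0" for y
  proof -
    have "(\<Sum>k\<in>S. J k * g' (s - k) (y - x k)) \<ge> 0"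
      by (intro sum_nonneg mult_nonneg_nonneg J_nonneg g'_nonneg)
    moreover have "(h' s (g s y) + C) * g' s y \<ge> 0"
      using h'_bound[of "g s y" s] g_nonneg[of s y] g_le[of s y] b_le
      by (intro mult_nonneg_nonneg g'_nonneg) auto
    ultimately have "((\<Sum>k\<in>S. J k * g' (s - k) (y - x k)) - g' s y + h' s (g s y) * g' s y) + (1 + C) * g' s y \<ge> 0"
      by (simp add: algebra_simps)
    then have "(((\<Sum>k\<in>S. J k * g' (s - k) (y - x k)) - g' s y + h' s (g s y) * g' s y) + (1 + C) * g' s y) / c \<ge> 0"
      using c by simp
    moreover have "((1 + C) * g' s y) / c = B * g' s y" by (simp add: B_def)
    ultimately show ?thesis by (simp add: gg_def add_divide_distrib)
  qed
  have z: "g' s w = 0" if "w \<le> y" for w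
  proof -
    have "exp (B * w) * g' s w \<le> exp (B * y) * g' s y"
    proof (rule DERIV_nonneg_imp_nondecreasing[OF that])
      fix v
      have "((\<lambda>v. exp (B * v) * g' s v) has_real_derivative exp (B * v) * (gg v + B * g' s v)) (at v)"
        by (auto intro!: derivative_eq_intros d2 simp: algebra_simps)
      then show "\<exists>y. ((\<lambda>v. exp (B * v) * g' s v) has_real_derivative y) (at v) \<and> 0 \<le> y"
        using ge[of v] by (meson exp_ge_zero mult_nonneg_nonneg)
    qed
    then have "exp (B * w) * g' s w \<le> exp (B * w) * 0" by (simp add: gs0)
    then have "g' s w \<le> 0" by (simp only: mult_le_cancel_left_pos[OF exp_gt_zero])
    then show ?thesis using g'_nonneg[of s w] by simp
  qed
  have const: "g s w = g s y" if "w \<le> y" for w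
  proof (cases "w = y")
    case False
    then have "w < y" using that by simp
    then obtain v where "w < v" "v < y" "g s y - g s w = (y - w) * g' s v"
      using MVT2[of w y "g s" "g' s", OF _ g_deriv] by blast
    then show ?thesis using z[of v] by simp
  qed simp
  have "\<forall>\<^sub>F w in at_bot. g s w = g s y"
    using eventually_le_at_bot[of y] by eventually_elim (rule const)
  then have "(g s \<longlongrightarrow> g s y) at_bot" by (rule tendsto_eventually)
  then have "g s y = 0" by (rule tendsto_unique[OF trivial_limit_at_bot_linorder _ g_bot])
  then show False using g_pos[OF c, of s y] by simp
qed

section \<open>Uniform bounds for the derivative of a profile\<close>

lemma finite_range_g_g': "finite (range (\<lambda>s. (g s, g' s)))"
proof (rule finite_range_periodic)
  have *: "g' s = g' s'" if "g s = g s'" for s s'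
  proof
    fix y show "g' s y = g' s' y"
      using g_deriv[of s y] g_deriv[of s' y] that DERIV_unique by metis
  qed
  show "(g (i + N1, j), g' (i + N1, j)) = (g (i, j), g' (i, j))" for i j
    using *[OF g_per(1)] by (simp add: g_per)
  show "(g (i, j + N2), g' (i, j + N2)) = (g (i, j), g' (i, j))" for i j
    using *[OF g_per(2)] by (simp add: g_per)
qed

lemma g'_cont:
  assumes c: "c > 0"
  shows "continuous_on A (g' s)"
proof -
  have eq: "g' s = (\<lambda>y. ((\<Sum>k\<in>S. J k * g (s - k) (y - x k)) - g s y + h s (g s y)) / c)"
    using c by (auto simp: g_eq[symmetric])
  have sh: "continuous_on A (\<lambda>y. g (s - k) (y - x k))" for k
    by (rule continuous_on_compose2[OF g_cont[of UNIV]]) (auto intro!: continuous_intros)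
  have hg: "continuous_on A (\<lambda>y. h s (g s y))"
    by (rule continuous_on_compose2[of UNIV "h s"])
       (auto intro: g_cont DERIV_continuous_on h_deriv has_field_derivative_at_within)
  show ?thesis unfolding eq
    using c by (intro continuous_intros sh hg g_cont) auto
qed

lemma g'_lower_bound:
  assumes c: "c > 0"
  shows "\<exists>e>0. \<forall>s y. \<bar>y\<bar> \<le> M \<longrightarrow> g' s y \<ge> e"
proof -
  have "\<exists>e>0. \<forall>v\<in>range (\<lambda>s. (g s, g' s)). \<forall>y. \<bar>y\<bar> \<le> M \<longrightarrow> snd v y \<ge> e"
  proof (rule finite_uniform_small[OF finite_range_g_g'])
    fix v assume "v \<in> range (\<lambda>s. (g s, g' s))"
    then obtain s where v: "snd v = g' s" by auto
    show "\<exists>e>0. \<forall>e'. 0 < e' \<and> e' \<le> e \<longrightarrow> (\<forall>y. \<bar>y\<bar> \<le> M \<longrightarrow> snd v y \<ge> e')"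
    proof (cases "M \<ge> 0")
      case True
      then have "\<exists>y\<in>{-M..M}. \<forall>z\<in>{-M..M}. g' s y \<le> g' s z"
        by (intro continuous_attains_inf g'_cont[OF c]) auto
      then obtain y where "\<And>z. \<bar>z\<bar> \<le> M \<Longrightarrow> g' s y \<le> g' s z" by (metis abs_le_D1 abs_le_D2 atLeastAtMost_iff minus_le_iff)
      then show ?thesis unfolding v using g'_pos[OF c, of s y]
        by (intro exI[of _ "g' s y"]) (auto intro: order_trans)
    qed (auto intro!: exI[of _ 1])
  qed
  then show ?thesis by fastforce
qed

lemma g'_le:
  assumes c: "c > 0"
  shows "g' s y \<le> (1 + C) / c"
proof -
  have "(\<Sum>k\<in>S. J k * g (s - k) (y - x k)) \<le> (\<Sum>k\<in>S. J k * b)"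
    by (intro sum_mono mult_left_mono g_le J_nonneg)
  then have 1: "(\<Sum>k\<in>S. J k * g (s - k) (y - x k)) \<le> b" by (simp add: sum_distrib_right[symmetric] sum_J)
  have 2: "h s (g s y) \<le> C * b"
    using h_le[OF g_nonneg g_le, of s s y] mult_left_mono[OF g_le[of s y] C_nonneg] by linarith
  have "C * b \<le> C" using b_le C_nonneg by (simp add: mult_left_le)
  then have "c * g' s y \<le> 1 + C" using 1 2 g_eq[of s y] g_nonneg[of s y] b_le by linarith
  then show ?thesis using c by (simp add: field_simps)
qed

lemma g_lip:
  assumes c: "c > 0"
  shows "\<bar>g s y - g s z\<bar> \<le> (1 + C) / c * \<bar>y - z\<bar>"
proof -
  have "norm (g s y - g s z) \<le> (1 + C) / c * norm (y - z)"
    by (rule field_differentiable_bound[of UNIV "g s" "g' s"])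
       (use g'_le[OF c] g'_nonneg in \<open>auto intro!: g_deriv\<close>)
  then show ?thesis by simp
qed

end

section \<open>Two profiles facing each other\<close>

lemma DERIV_exp_mult: "((\<lambda>t. exp (k * t)) has_real_derivative k * exp (k * t)) (at t)" for k :: real
  by (auto intro!: derivative_eq_intros)

text \<open>As a function of w the difference vanishes at 0, and its derivative is of order e * w;
  the mean value inequality gives order e * w^2. Near the unstable state this quadratic order makes
  the error smaller than the growth \<kappa> * e * w.\<close>

lemma scaling_error:
  fixes h h' :: "real \<Rightarrow> real"
  assumes der: "\<And>w. (h has_real_derivative h' w) (at w)"
    and lip: "\<And>v w. \<bar>v\<bar> \<le> 3 \<Longrightarrow> \<bar>w\<bar> \<le> 3 \<Longrightarrow> \<bar>h' v - h' w\<bar> \<le> C * \<bar>v - w\<bar>"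
    and h0: "h 0 = 0" and e: "\<bar>e\<bar> \<le> 1" and w: "\<bar>w\<bar> \<le> 1" and C: "C \<ge> 0"
  shows "\<bar>h ((1 + e) * w) - (1 + e) * h w\<bar> \<le> 2 * C * \<bar>e\<bar> * w\<^sup>2"
proof -
  have "norm ((h ((1 + e) * w) - (1 + e) * h w) - (h ((1 + e) * 0) - (1 + e) * h 0))
      \<le> (2 * (C * \<bar>e\<bar> * \<bar>w\<bar>)) * norm (w - 0)"
  proof (rule field_differentiable_bound[of "{- \<bar>w\<bar>..\<bar>w\<bar>}" _ "\<lambda>u. (1 + e) * (h' ((1 + e) * u) - h' u)"])
    fix u assume u: "u \<in> {- \<bar>w\<bar>..\<bar>w\<bar>}"
    have "((\<lambda>u. (1 + e) * u) has_real_derivative 1 + e) (at u)"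
      by (auto intro!: derivative_eq_intros)
    from DERIV_diff[OF DERIV_chain2[OF der this] DERIV_cmult[OF der]]
    have "((\<lambda>u. h ((1 + e) * u) - (1 + e) * h u) has_real_derivative
        h' ((1 + e) * u) * (1 + e) - (1 + e) * h' u) (at u)" .
    moreover have "h' ((1 + e) * u) * (1 + e) - (1 + e) * h' u = (1 + e) * (h' ((1 + e) * u) - h' u)"
      by (simp only: right_diff_distrib mult.commute)
    ultimately show "((\<lambda>u. h ((1 + e) * u) - (1 + e) * h u) has_real_derivative
        (1 + e) * (h' ((1 + e) * u) - h' u)) (at u within {- \<bar>w\<bar>..\<bar>w\<bar>})"
      by (simp only: has_field_derivative_at_within)
    have uw: "\<bar>u\<bar> \<le> \<bar>w\<bar>" using u by auto
    have e2: "\<bar>1 + e\<bar> \<le> 2" using e by auto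
    have "\<bar>(1 + e) * u\<bar> \<le> 2 * 1" unfolding abs_mult using e2 uw w by (intro mult_mono) auto
    then have "\<bar>h' ((1 + e) * u) - h' u\<bar> \<le> C * \<bar>(1 + e) * u - u\<bar>"
      using uw w by (intro lip) auto
    also have "\<dots> = C * \<bar>e\<bar> * \<bar>u\<bar>" by (simp add: algebra_simps abs_mult)
    also have "\<dots> \<le> C * \<bar>e\<bar> * \<bar>w\<bar>" using uw C by (intro mult_left_mono) auto
    finally have "\<bar>h' ((1 + e) * u) - h' u\<bar> \<le> C * \<bar>e\<bar> * \<bar>w\<bar>" .
    then show "norm ((1 + e) * (h' ((1 + e) * u) - h' u)) \<le> 2 * (C * \<bar>e\<bar> * \<bar>w\<bar>)"
      unfolding real_norm_def abs_mult using e2 by (intro mult_mono) auto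
  qed auto
  then show ?thesis by (simp add: h0 power2_eq_square mult.assoc)
qed

text \<open>The mixed second difference vanishes if y or z is 0, so it is bounded by their product.
  For two fronts far apart one of the factors is exponentially small.\<close>

lemma superposition_error:
  fixes h h' :: "real \<Rightarrow> real"
  assumes der: "\<And>w. (h has_real_derivative h' w) (at w)"
    and lip: "\<And>v w. \<bar>v\<bar> \<le> 3 \<Longrightarrow> \<bar>w\<bar> \<le> 3 \<Longrightarrow> \<bar>h' v - h' w\<bar> \<le> C * \<bar>v - w\<bar>"
    and h0: "h 0 = 0" and y: "0 \<le> y" "y \<le> 3" and z: "0 \<le> z" "z \<le> 3"
  shows "\<bar>h (y - z) - h y - h (- z)\<bar> \<le> C * z * y"
proof -
  have "norm ((h (y - z) - h y) - (h (0 - z) - h 0)) \<le> (C * z) * norm (y - 0)"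
  proof (rule field_differentiable_bound[of "{0..y}" _ "\<lambda>u. h' (u - z) - h' u"])
    fix u assume u: "u \<in> {0..y}"
    have "((\<lambda>u. u - z) has_real_derivative 1) (at u)"
      by (auto intro!: derivative_eq_intros)
    from DERIV_diff[OF DERIV_chain2[OF der this] der]
    have "((\<lambda>u. h (u - z) - h u) has_real_derivative h' (u - z) - h' u) (at u)"
      by (simp only: mult_1_right)
    then show "((\<lambda>u. h (u - z) - h u) has_real_derivative h' (u - z) - h' u) (at u within {0..y})"
      by (rule has_field_derivative_at_within)
    have "\<bar>u - z\<bar> \<le> 3" "\<bar>u\<bar> \<le> 3" using u y z by (auto simp: abs_le_iff)
    from lip[OF this] show "norm (h' (u - z) - h' u) \<le> C * z" using z by simp
  qed (use y in auto)
  then show ?thesis using y by (simp add: h0)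
qed

lemma deriv_le_imp_diff_le:
  fixes h h' :: "real \<Rightarrow> real"
  assumes der: "\<And>w. (h has_real_derivative h' w) (at w)"
    and vw: "v \<le> w" and bound: "\<And>u. v \<le> u \<Longrightarrow> u \<le> w \<Longrightarrow> h' u \<le> m"
  shows "h w - h v \<le> m * (w - v)"
proof (cases "v = w")
  case False
  then obtain z where "v < z" "z < w" "h w - h v = (w - v) * h' z"
    using MVT2[of v w h h', OF _ der] vw by auto
  then show ?thesis using bound[of z] mult_left_mono[of "h' z" m "w - v"] vw by (simp add: mult.commute)
qed simp

text \<open>The unstable state is moved to \<open>0\<close>; \<open>Q\<close> is the profile from \<open>0\<close> to \<open>\<beta>\<close>, and \<open>- P\<close>, read
  from right to left, the one from \<open>0\<close> to \<open>- \<alpha>\<close>.\<close>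

locale front_pair =
  Q: front S J N1 N2 x cQ h h' Q Q' \<beta> C +
  P: front S J N1 N2 "\<lambda>k. - x k" cP "\<lambda>s w. - h s (- w)" "\<lambda>s w. h' s (- w)" P P' \<alpha> C
  for S J N1 N2 x h h' cQ cP Q Q' P P' \<alpha> \<beta> C +
  fixes \<delta> \<eta> :: real
  assumes cQ_pos: "cQ > 0" and cP_pos: "cP > 0"
    and bd3: "\<And>s w. \<bar>w\<bar> \<le> 3 \<Longrightarrow> \<bar>h' s w\<bar> \<le> C"
    and lip3: "\<And>s v w. \<bar>v\<bar> \<le> 3 \<Longrightarrow> \<bar>w\<bar> \<le> 3 \<Longrightarrow> \<bar>h' s v - h' s w\<bar> \<le> C * \<bar>v - w\<bar>"
    and \<delta>_pos: "\<delta> > 0" and \<eta>_pos: "\<eta> > 0" and \<eta>_le: "4 * \<eta> \<le> \<alpha>" "4 * \<eta> \<le> \<beta>"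
    and stable_\<beta>: "\<And>s w. \<bar>w - \<beta>\<bar> \<le> \<eta> \<Longrightarrow> h' s w \<le> - \<delta>"
    and stable_\<alpha>: "\<And>s w. \<bar>w + \<alpha>\<bar> \<le> \<eta> \<Longrightarrow> h' s w \<le> - \<delta>"
    and unstable: "\<And>s w. \<bar>w\<bar> \<le> \<eta> \<Longrightarrow> h' s w \<ge> \<delta>"
    and h_\<beta>: "\<And>s. h s \<beta> = 0" and h_\<alpha>: "\<And>s. h s (- \<alpha>) = 0"
    and h_pos: "\<And>s w. 0 < w \<Longrightarrow> w < \<beta> \<Longrightarrow> h s w > 0"
    and h_neg: "\<And>s w. - \<alpha> < w \<Longrightarrow> w < 0 \<Longrightarrow> h s w < 0"
begin

section \<open>Decay of the two profiles and estimates of the defect\<close>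

lemma h_nonneg: "0 \<le> w \<Longrightarrow> w \<le> \<beta> \<Longrightarrow> h s w \<ge> 0"
  using h_pos[of w s] h_\<beta>[of s] Q.h_0[of s] by (cases "w = 0 \<or> w = \<beta>") auto

lemma h_nonpos: "- \<alpha> \<le> w \<Longrightarrow> w \<le> 0 \<Longrightarrow> h s w \<le> 0"
  using h_neg[of w s] h_\<alpha>[of s] Q.h_0[of s] by (cases "w = 0 \<or> w = - \<alpha>") auto

lemma Q_decay: "\<exists>K>0. \<exists>lam>0. \<forall>s y. Q s y \<le> K * exp (lam * y)"
proof (rule Q.exp_decay[of 1 \<delta> \<eta>])
  fix s w assume w: "0 \<le> w" "w \<le> \<eta>"
  have "(- h s w) - (- h s 0) \<le> - \<delta> * (w - 0)"
    by (rule deriv_le_imp_diff_le[of "\<lambda>w. - h s w" "\<lambda>w. - h' s w"])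
       (use w in \<open>auto intro!: DERIV_minus Q.h_deriv unstable\<close>)
  then show "1 * h s w \<ge> \<delta> * w" by (simp add: Q.h_0)
qed (use \<delta>_pos \<eta>_pos in auto)

lemma P_decay: "\<exists>K>0. \<exists>lam>0. \<forall>s y. P s y \<le> K * exp (lam * y)"
proof (rule P.exp_decay[of 1 \<delta> \<eta>])
  fix s w assume w: "0 \<le> w" "w \<le> \<eta>"
  have "(- h s 0) - (- h s (- w)) \<le> - \<delta> * (0 - - w)"
    by (rule deriv_le_imp_diff_le[of "\<lambda>w. - h s w" "\<lambda>w. - h' s w"])
       (use w in \<open>auto intro!: DERIV_minus Q.h_deriv unstable\<close>)
  then show "1 * - h s (- w) \<ge> \<delta> * w" by (simp add: Q.h_0)
qed (use \<delta>_pos \<eta>_pos in auto)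

text \<open>By how much the ansatz \<open>W\<close> below fails to solve the equation before its growth and its shift
  are taken into account.\<close>

definition defect where
  "defect s e q p = h s ((1 + e) * q - (1 - e) * p) - (1 + e) * h s q - (1 - e) * h s (- p)"

text \<open>One superposition error for the scaled profiles and one scaling error for each of them.
  The product is small by separation of the fronts, and the squares carry a factor e.\<close>

lemma defect_le:
  assumes q: "0 \<le> q" "q \<le> 1" and p: "0 \<le> p" "p \<le> 1" and e: "0 \<le> e" "e \<le> 1 / 2"
  shows "defect s e q p \<le> 2 * C * (q * p + e * (q\<^sup>2 + p\<^sup>2))"
proof -
  have q2: "(1 + e) * q \<le> 3" "(1 - e) * p \<le> 3"
    using mult_mono[of "1 + e" "3/2" q 1] mult_mono[of "1 - e" 1 p 1] q p e by auto
  have 1: "\<bar>h s ((1 + e) * q - (1 - e) * p) - h s ((1 + e) * q) - h s (- ((1 - e) * p))\<bar> \<le> C * ((1 - e) * p) * ((1 + e) * q)"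
    by (rule superposition_error[OF Q.h_deriv lip3 Q.h_0]) (use q2 q p e in auto)
  have 2: "\<bar>h s ((1 + e) * q) - (1 + e) * h s q\<bar> \<le> 2 * C * \<bar>e\<bar> * q\<^sup>2"
    by (rule scaling_error[OF Q.h_deriv lip3 Q.h_0]) (use q e Q.C_nonneg in auto)
  have 3: "\<bar>h s ((1 + - e) * (- p)) - (1 + - e) * h s (- p)\<bar> \<le> 2 * C * \<bar>- e\<bar> * (- p)\<^sup>2"
    by (rule scaling_error[OF Q.h_deriv lip3 Q.h_0]) (use p e Q.C_nonneg in auto)
  have "C * ((1 - e) * p) * ((1 + e) * q) = C * (q * p) * (1 - e * e)" by (simp add: algebra_simps)
  also have "\<dots> \<le> C * (q * p) * 2"
  proof -
    have "0 \<le> e * e" by simp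
    then have "1 - e * e \<le> 2" by linarith
    then show ?thesis using q p Q.C_nonneg by (intro mult_left_mono mult_nonneg_nonneg)
  qed
  finally show ?thesis using 1 2 3 e by (simp add: defect_def algebra_simps)
qed

text \<open>Because of the factor 1 + e the argument exceeds q by at least e * q - p, and the slope
  there is at most - \<delta>. This gains \<delta> * e * q, to be played off against terms linear in
  p, which are O(e^2) in the application.\<close>

lemma defect_near_\<beta>:
  assumes q: "\<beta> - \<eta> \<le> q" "q \<le> \<beta>" and p: "0 \<le> p" "p \<le> 1" and e: "0 \<le> e" "e \<le> 1 / 2" "e \<le> \<eta>" and pe: "p \<le> e * q"
  shows "defect s e q p \<le> - \<delta> * (e * q) + (\<delta> + C) * p"
proof -
  define w where "w = (1 + e) * q - (1 - e) * p"
  have q0: "q \<ge> 0" using q \<eta>_le \<eta>_pos by simp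
  have ep: "(1 - e) * p \<le> p" "0 \<le> (1 - e) * p" using e p by (auto intro: mult_left_le_one_le)
  have wq: "w - q \<ge> e * q - p" "w \<ge> q" using ep pe by (auto simp: w_def algebra_simps)
  have "e * q \<le> \<eta> * 1" using e q q0 Q.b_le \<eta>_pos by (intro mult_mono) auto
  then have wb: "w \<le> \<beta> + \<eta>" using ep q by (simp add: w_def algebra_simps)
  have "h s w - h s q \<le> - \<delta> * (w - q)"
    by (rule deriv_le_imp_diff_le[OF Q.h_deriv]) (use wq wb q in \<open>auto intro!: stable_\<beta>\<close>)
  also have "\<dots> \<le> - \<delta> * (e * q - p)" using wq \<delta>_pos by simp
  finally have 1: "h s w - h s q \<le> - \<delta> * (e * q - p)" .
  have 2: "e * h s q \<ge> 0" using h_nonneg[OF q0] q e by simp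
  have "- h s (- p) \<le> C * p" using Q.h_lip[of "- p" 0 s] p by (simp add: Q.h_0)
  then have "(1 - e) * (- h s (- p)) \<le> (1 - e) * (C * p)" using e by (intro mult_left_mono) auto
  also have "\<dots> \<le> C * p" using e p Q.C_nonneg by (simp add: mult_left_le_one_le)
  finally have 3: "- ((1 - e) * h s (- p)) \<le> C * p" by simp
  have "defect s e q p = (h s w - h s q) - e * h s q - (1 - e) * h s (- p)"
    unfolding defect_def w_def by (simp add: distrib_right)
  then show ?thesis using 1 2 3 by (simp add: left_diff_distrib right_diff_distrib distrib_right)
qed

text \<open>Every term has the favourable sign: the argument lies above - p, in a range where
  \<open>h\<close> decreases, while h (- p) \<le> 0 and h q \<ge> 0.\<close>

lemma defect_near_\<alpha>:
  assumes p: "\<alpha> - \<eta> / 2 \<le> p" "p \<le> \<alpha>" and q: "0 \<le> q" "q \<le> \<eta> / 8" and e: "0 \<le> e" "e \<le> 1 / 2" "e \<le> \<eta> / 4"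
  shows "defect s e q p \<le> 0"
proof -
  define w where "w = (1 + e) * q - (1 - e) * p"
  have p0: "p \<ge> 0" "p \<le> 1" using p \<eta>_le \<eta>_pos P.b_le by auto
  have "e * p \<le> (\<eta> / 4) * 1" "e * q \<le> 1 * q" using e p0 q by (intro mult_mono; simp)+
  moreover have "e * p \<ge> 0" "e * q \<ge> 0" using e p0 q by auto
  ultimately have w: "- p \<le> w" "w \<le> - \<alpha> + \<eta>" using p q \<eta>_pos by (auto simp: w_def algebra_simps)
  have "h s w - h s (- p) \<le> - \<delta> * (w - - p)"
    by (rule deriv_le_imp_diff_le[OF Q.h_deriv]) (use w p \<eta>_pos in \<open>auto intro!: stable_\<alpha>\<close>)
  also have "\<dots> \<le> 0" using w \<delta>_pos by (simp add: mult_le_0_iff)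
  finally have 1: "h s w - h s (- p) \<le> 0" .
  have 2: "e * h s (- p) \<le> 0" using h_nonpos[of "- p" s] p p0 e by (simp add: mult_nonneg_nonpos)
  have "q \<le> \<beta>" using q \<eta>_le \<eta>_pos by simp
  then have 3: "(1 + e) * h s q \<ge> 0" using h_nonneg q e by simp
  have "defect s e q p = (h s w - h s (- p)) + e * h s (- p) - (1 + e) * h s q"
    unfolding defect_def w_def by (simp add: left_diff_distrib)
  then show ?thesis using 1 2 3 by (simp add: left_diff_distrib right_diff_distrib distrib_right)
qed

text \<open>Each change made to Q - P raises it: the amplitude of \<open>Q\<close> grows, that of
  \<open>P\<close> shrinks, and both profiles are displaced to the left by K * exp (\<kappa> *
  t).\<close>

definition W where
  "W \<kappa> K s t = (1 + exp (\<kappa> * t)) * Q s (x s + cQ * t + K * exp (\<kappa> * t))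
     - (1 - exp (\<kappa> * t)) * P s (- x s + cP * t - K * exp (\<kappa> * t))"

text \<open>The profile equations cancel all linear terms, including transport at the speeds
  \<open>cQ\<close> and \<open>cP\<close>. What remains is the growth of the amplitudes, the gain
  from the moving shift, and the defect.\<close>

lemma W_supersolution_aux:
  fixes \<kappa> K t :: real
  defines "e \<equiv> exp (\<kappa> * t)"
  defines "yQ \<equiv> \<lambda>s. x s + cQ * t + K * e" and "yP \<equiv> \<lambda>s. - x s + cP * t - K * e"
  shows "\<exists>D. (W \<kappa> K s has_real_derivative D) (at t) \<and>
    D - ((\<Sum>k\<in>S. J k * W \<kappa> K (s - k) t) - W \<kappa> K s t + h s (W \<kappa> K s t)) =
    \<kappa> * e * (Q s (yQ s) + P s (yP s)) + K * \<kappa> * e * ((1 + e) * Q' s (yQ s) + (1 - e) * P' s (yP s))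
      - defect s e (Q s (yQ s)) (P s (yP s))"
proof -
  have de: "((\<lambda>t. exp (\<kappa> * t)) has_real_derivative \<kappa> * e) (at t)"
    unfolding e_def by (rule DERIV_exp_mult)
  have dyQ: "((\<lambda>t. x s + cQ * t + K * exp (\<kappa> * t)) has_real_derivative cQ + K * (\<kappa> * e)) (at t)"
    by (rule DERIV_cong[OF DERIV_add[OF DERIV_add[OF DERIV_const DERIV_cmult[OF DERIV_ident]] DERIV_cmult[OF de]]]) simp
  have dyP: "((\<lambda>t. - x s + cP * t - K * exp (\<kappa> * t)) has_real_derivative cP - K * (\<kappa> * e)) (at t)"
    by (rule DERIV_cong[OF DERIV_diff[OF DERIV_add[OF DERIV_const DERIV_cmult[OF DERIV_ident]] DERIV_cmult[OF de]]]) simp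
  have dQ: "((\<lambda>t. Q s (x s + cQ * t + K * exp (\<kappa> * t))) has_real_derivative Q' s (yQ s) * (cQ + K * (\<kappa> * e))) (at t)"
    unfolding yQ_def e_def by (rule DERIV_chain2[OF Q.g_deriv dyQ[unfolded e_def]])
  have dP: "((\<lambda>t. P s (- x s + cP * t - K * exp (\<kappa> * t))) has_real_derivative P' s (yP s) * (cP - K * (\<kappa> * e))) (at t)"
    unfolding yP_def e_def by (rule DERIV_chain2[OF P.g_deriv dyP[unfolded e_def]])
  define D where "D = \<kappa> * e * Q s (yQ s) + (Q' s (yQ s) * (cQ + K * (\<kappa> * e))) * (1 + e)
     - (- (\<kappa> * e) * P s (yP s) + (P' s (yP s) * (cP - K * (\<kappa> * e))) * (1 - e))"
  have "(W \<kappa> K s has_real_derivative D) (at t)"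
  proof -
    have "((\<lambda>t. 1 + exp (\<kappa> * t)) has_real_derivative \<kappa> * e) (at t)"
      "((\<lambda>t. 1 - exp (\<kappa> * t)) has_real_derivative - (\<kappa> * e)) (at t)"
      using DERIV_add[OF DERIV_const de] DERIV_diff[OF DERIV_const de] by simp_all
    from DERIV_diff[OF DERIV_mult[OF this(1) dQ] DERIV_mult[OF this(2) dP]]
    show ?thesis unfolding W_def[abs_def] D_def yQ_def yP_def e_def .
  qed
  moreover have "D - ((\<Sum>k\<in>S. J k * W \<kappa> K (s - k) t) - W \<kappa> K s t + h s (W \<kappa> K s t)) =
    \<kappa> * e * (Q s (yQ s) + P s (yP s)) + K * \<kappa> * e * ((1 + e) * Q' s (yQ s) + (1 - e) * P' s (yP s))
      - defect s e (Q s (yQ s)) (P s (yP s))"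
  proof -
    have sh: "yQ (s - k) = yQ s - x k" "yP (s - k) = yP s - - x k" for k
      by (simp_all add: yQ_def yP_def Q.x_diff)
    have W: "W \<kappa> K s t = (1 + e) * Q s (yQ s) - (1 - e) * P s (yP s)" for s
      by (simp add: W_def yQ_def yP_def e_def)
    have eqQ: "(\<Sum>k\<in>S. J k * Q (s - k) (yQ s - x k)) = cQ * Q' s (yQ s) + Q s (yQ s) - h s (Q s (yQ s))"
      using Q.g_eq[of s "yQ s"] by simp
    have eqP: "(\<Sum>k\<in>S. J k * P (s - k) (yP s - - x k)) = cP * P' s (yP s) + P s (yP s) + h s (- P s (yP s))"
      using P.g_eq[of s "yP s"] by simp
    have "(\<Sum>k\<in>S. J k * W \<kappa> K (s - k) t) = (\<Sum>k\<in>S. (1 + e) * (J k * Q (s - k) (yQ s - x k)) - (1 - e) * (J k * P (s - k) (yP s - - x k)))"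
      unfolding W sh by (intro sum.cong refl) (simp add: algebra_simps)
    also have "\<dots> = (1 + e) * (\<Sum>k\<in>S. J k * Q (s - k) (yQ s - x k)) - (1 - e) * (\<Sum>k\<in>S. J k * P (s - k) (yP s - - x k))"
      by (simp only: sum_subtractf sum_distrib_left)
    finally have JW: "(\<Sum>k\<in>S. J k * W \<kappa> K (s - k) t) =
      (1 + e) * (cQ * Q' s (yQ s) + Q s (yQ s) - h s (Q s (yQ s)))
       - (1 - e) * (cP * P' s (yP s) + P s (yP s) + h s (- P s (yP s)))"
      unfolding eqQ eqP .
    show ?thesis unfolding JW unfolding W D_def defect_def by (simp add: algebra_simps)
  qed
  ultimately show ?thesis by blast
qed

text \<open>\<kappa> remains free below a threshold, with \<open>K\<close> and \<open>T\<close>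
  chosen after it, because one \<kappa> must later serve several bounds at once. The smallness of
  \<kappa> makes one of the two profile values O(e^2) at every site.\<close>

theorem W_supersolution:
  "\<exists>\<kappa>0>0. \<forall>\<kappa>. 0 < \<kappa> \<and> \<kappa> \<le> \<kappa>0 \<longrightarrow> (\<exists>K>0. \<exists>T. \<forall>t\<le>T. \<forall>s. \<exists>D. (W \<kappa> K s has_real_derivative D) (at t) \<and>
     D \<ge> (\<Sum>k\<in>S. J k * W \<kappa> K (s - k) t) - W \<kappa> K s t + h s (W \<kappa> K s t))"
proof -
  obtain KQ lQ where KQ: "KQ > 0" "lQ > 0" "\<And>s y. Q s y \<le> KQ * exp (lQ * y)"
    using Q_decay by blast
  obtain KP lP where KP: "KP > 0" "lP > 0" "\<And>s y. P s y \<le> KP * exp (lP * y)"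
    using P_decay by blast
  \<comment> \<open>The two profile arguments add up to (cQ + cP) * t = 4 * cc * t, so one of them
    is at most 2 * cc * t. With \<kappa> \<le> \<open>\<kappa>0\<close> the corresponding
    exponential bound is at most a multiple of e^2.\<close>
  define cc where "cc = (cQ + cP) / 4"
  have cc: "cc > 0" using cQ_pos cP_pos by (simp add: cc_def)
  define \<kappa>0 where "\<kappa>0 = min lQ lP * cc"
  have \<kappa>0: "\<kappa>0 > 0" using KQ KP cc by (simp add: \<kappa>0_def)
  show ?thesis
  proof (rule exI[of _ \<kappa>0], rule conjI[OF \<kappa>0], intro allI impI)
    fix \<kappa> assume \<kappa>: "0 < \<kappa> \<and> \<kappa> \<le> \<kappa>0"
    define B where "B = KQ + KP"
    have B: "B > 0" using KQ KP by (simp add: B_def)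
    \<comment> \<open>When both profiles lie below \<theta>, the squares cost at most 2 * C *
      \<theta> * e * (q + p), which is at most half of the growth \<kappa> * e * (q + p). The other
      half pays for the product q * p.\<close>
    define \<theta> where "\<theta> = min (\<kappa> / (4 * C + 1)) (\<eta> / 4)"
    have \<theta>: "\<theta> > 0" "\<theta> \<le> \<eta> / 4" "2 * C * \<theta> \<le> \<kappa> / 2"
    proof -
      show "\<theta> > 0" using \<kappa> \<eta>_pos Q.C_nonneg by (simp add: \<theta>_def)
      show "\<theta> \<le> \<eta> / 4" unfolding \<theta>_def by (rule min.cobounded2)
      have "2 * C * \<theta> \<le> 2 * C * (\<kappa> / (4 * C + 1))"
        using Q.C_nonneg by (intro mult_left_mono) (auto simp: \<theta>_def)
      also have "\<dots> \<le> \<kappa> / 2" using \<kappa> Q.C_nonneg by (simp add: field_simps)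
      finally show "2 * C * \<theta> \<le> \<kappa> / 2" .
    qed
    obtain MQ where MQ: "\<And>s y. y \<le> - MQ \<Longrightarrow> Q s y \<le> \<theta> / 2" "\<And>s y. y \<ge> MQ \<Longrightarrow> \<beta> - \<theta> / 2 \<le> Q s y"
      using Q.uniform_limits[of "\<theta> / 2"] \<theta> by auto
    obtain MP where MP: "\<And>s y. y \<le> - MP \<Longrightarrow> P s y \<le> \<theta> / 2" "\<And>s y. y \<ge> MP \<Longrightarrow> \<alpha> - \<theta> / 2 \<le> P s y"
      using P.uniform_limits[of "\<theta> / 2"] \<theta> by auto
    obtain eQ where eQ: "eQ > 0" "\<And>s y. \<bar>y\<bar> \<le> MQ \<Longrightarrow> Q' s y \<ge> eQ"
      using Q.g'_lower_bound[OF cQ_pos, of MQ] by blast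
    obtain eP where eP: "eP > 0" "\<And>s y. \<bar>y\<bar> \<le> MP \<Longrightarrow> P' s y \<ge> eP"
      using P.g'_lower_bound[OF cP_pos, of MP] by blast
    define c0 where "c0 = min eQ eP"
    have c0: "c0 > 0" using eQ eP by (simp add: c0_def)
    \<comment> \<open>Where one slope is at least \<open>c0\<close>, the shift gains at least K *
      \<kappa> * e * c0 / 2, as 1 - e \<ge> 1 / 2. This is to exceed the general bound 2 * C * (B +
      2) * e of the defect.\<close>
    define K where "K = 2 * (2 * C * (B + 2) + 1) / (\<kappa> * c0)"
    have K: "K > 0" using \<kappa> c0 B Q.C_nonneg by (simp add: K_def add_nonneg_pos)
    have K\<kappa>: "K * \<kappa> * c0 = 2 * (2 * C * (B + 2) + 1)" using \<kappa> c0 by (simp add: K_def)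
    \<comment> \<open>In order: amplitudes between 1 / 2 and 3 / 2; arguments within \<eta> of the
      stable states; m \<le> \<eta> / 8, which decides which profile is the small one; the stable
      gain at \<beta> against the term in p; the product q * p against half the growth; and p \<le>
      e * q near \<beta>.\<close>
    define e0 where "e0 = Min {1 / 2, \<eta> / 4, \<eta> / (8 * (B + 1)), \<delta> * \<beta> / (2 * ((\<delta> + C) * B + 1)),
      \<kappa> / (4 * (C * B + 1)), \<beta> / (4 * (B + 1))}"
    have den: "(\<delta> + C) * B + 1 > 0" "C * B + 1 > 0" "B + 1 > 0"
      using B Q.C_nonneg \<delta>_pos by (auto intro: add_nonneg_pos)
    have canc: "a * (u / (v * a)) = u / v" if "a > 0" for a u v :: real
      using that by simp
    have e0: "e0 > 0" using \<eta>_pos \<delta>_pos \<kappa> den Q.b_pos unfolding e0_def by (subst Min_gr_iff) auto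
    define T where "T = min 0 (ln e0 / \<kappa>)"
    show "\<exists>K>0. \<exists>T. \<forall>t\<le>T. \<forall>s. \<exists>D. (W \<kappa> K s has_real_derivative D) (at t) \<and>
      D \<ge> (\<Sum>k\<in>S. J k * W \<kappa> K (s - k) t) - W \<kappa> K s t + h s (W \<kappa> K s t)"
    proof (rule exI[of _ K], rule conjI[OF K], rule exI[of _ T], intro allI impI)
      fix t s assume t: "t \<le> T"
      define e where "e = exp (\<kappa> * t)"
      have t0: "t \<le> 0" using t by (simp add: T_def)
      have e_pos: "e > 0" by (simp add: e_def)
      have "\<kappa> * t \<le> ln e0" using t \<kappa> by (simp add: T_def field_simps)
      then have "e \<le> e0" unfolding e_def using e0 by (metis exp_le_cancel_iff exp_ln)
      then have e_le: "e \<le> 1 / 2" "e \<le> \<eta> / 4" "e \<le> \<eta> / (8 * (B + 1))" "e \<le> \<delta> * \<beta> / (2 * ((\<delta> + C) * B + 1))"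
        "e \<le> \<kappa> / (4 * (C * B + 1))" "e \<le> \<beta> / (4 * (B + 1))"
        by (simp_all add: e0_def)
      define yQ where "yQ = x s + cQ * t + K * e"
      define yP where "yP = - x s + cP * t - K * e"
      define q where "q = Q s yQ"
      define p where "p = P s yP"
      have q: "0 \<le> q" "q \<le> \<beta>" "q \<le> 1" and p: "0 \<le> p" "p \<le> \<alpha>" "p \<le> 1"
        using Q.g_nonneg[of s yQ] Q.g_le[of s yQ] P.g_nonneg[of s yP] P.g_le[of s yP] Q.b_le P.b_le
        by (auto simp: q_def p_def)
      have Q'0: "Q' s yQ \<ge> 0" and P'0: "P' s yP \<ge> 0" using Q.g'_nonneg P.g'_nonneg by auto
      define m where "m = B * e\<^sup>2"
      have e2: "exp (l * (2 * cc * t)) \<le> e\<^sup>2" if "l \<ge> min lQ lP" for l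
      proof -
        have "\<kappa> \<le> l * cc" using \<kappa> that cc unfolding \<kappa>0_def
          by (meson less_imp_le mult_right_mono order_trans)
        then have "l * cc * t \<le> \<kappa> * t" using t0 by (simp add: mult_right_mono_neg)
        then show ?thesis by (simp add: e_def exp_double[symmetric] algebra_simps flip: exp_add power2_eq_square)
      qed
      have pq: "q \<le> m \<or> p \<le> m"
      proof -
        have "yQ + yP = 4 * cc * t" by (simp add: yQ_def yP_def cc_def algebra_simps)
        then consider "yQ \<le> 2 * cc * t" | "yP \<le> 2 * cc * t" by linarith
        then show ?thesis
        proof cases
          case 1
          have "q \<le> KQ * exp (lQ * yQ)" unfolding q_def by (rule KQ)
          also have "\<dots> \<le> KQ * exp (lQ * (2 * cc * t))" using 1 KQ by simp
          also have "\<dots> \<le> B * e\<^sup>2" using e2[of lQ] KQ KP by (intro mult_mono) (auto simp: B_def)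
          finally show ?thesis by (simp add: m_def)
        next
          case 2
          have "p \<le> KP * exp (lP * yP)" unfolding p_def by (rule KP)
          also have "\<dots> \<le> KP * exp (lP * (2 * cc * t))" using 2 KP by simp
          also have "\<dots> \<le> B * e\<^sup>2" using e2[of lP] KQ KP by (intro mult_mono) (auto simp: B_def)
          finally show ?thesis by (simp add: m_def)
        qed
      qed
      have Be: "B * e \<le> \<eta> / 8"
      proof -
        have "B * e \<le> (B + 1) * (\<eta> / (8 * (B + 1)))" using e_le B e_pos by (intro mult_mono) auto
        then show ?thesis unfolding canc[OF den(3)] .
      qed
      have m_le: "m \<le> B * e" "m \<le> \<eta> / 8"
      proof -
        show "m \<le> B * e" using e_le e_pos B by (simp add: m_def power2_eq_square)
        then show "m \<le> \<eta> / 8" using Be by simp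
      qed
      have main: "defect s e q p \<le> \<kappa> * e * (q + p) + K * \<kappa> * e * ((1 + e) * Q' s yQ + (1 - e) * P' s yP)"
      proof -
        have A0: "0 \<le> \<kappa> * e * (q + p)" using \<kappa> e_pos q p by simp
        have S0: "0 \<le> K * \<kappa> * e * ((1 + e) * Q' s yQ + (1 - e) * P' s yP)"
          using K \<kappa> e_pos e_le Q'0 P'0 by simp
        have dl: "defect s e q p \<le> 2 * C * (q * p + e * (q\<^sup>2 + p\<^sup>2))"
          using q p e_pos e_le by (intro defect_le) auto
        have mid: "defect s e q p \<le> 2 * C * (B + 2) * e"
        proof -
          have "q * p \<le> m"
            using pq
          proof
            assume "q \<le> m" then show ?thesis using q p mult_mono[of q m p 1] by simp
          next
            assume "p \<le> m" then show ?thesis using q p mult_mono[of q 1 p m] by simp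
          qed
          moreover have "q\<^sup>2 \<le> 1" "p\<^sup>2 \<le> 1" using q p by (auto simp: power_le_one)
          then have "e * (q\<^sup>2 + p\<^sup>2) \<le> e * 2" using e_pos by (intro mult_left_mono) auto
          ultimately have "q * p + e * (q\<^sup>2 + p\<^sup>2) \<le> (B + 2) * e" using m_le by (simp add: algebra_simps)
          then have "2 * C * (q * p + e * (q\<^sup>2 + p\<^sup>2)) \<le> 2 * C * ((B + 2) * e)"
            using Q.C_nonneg by (intro mult_left_mono) auto
          then show ?thesis using dl by (simp add: mult.assoc)
        qed
        have absorb: "2 * C * (B + 2) * e \<le> K * \<kappa> * e * ((1 + e) * Q' s yQ + (1 - e) * P' s yP)"
          if "Q' s yQ \<ge> c0 \<or> P' s yP \<ge> c0"
        proof -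
          have "c0 / 2 \<le> (1 + e) * Q' s yQ + (1 - e) * P' s yP"
            using that
          proof
            assume a: "Q' s yQ \<ge> c0"
            have "1 * c0 \<le> (1 + e) * Q' s yQ" using a e_pos c0 by (intro mult_mono) auto
            moreover have "0 \<le> (1 - e) * P' s yP" using e_le P'0 by simp
            ultimately show ?thesis using c0 by linarith
          next
            assume a: "P' s yP \<ge> c0"
            have "(1 / 2) * c0 \<le> (1 - e) * P' s yP" using a e_le c0 by (intro mult_mono) auto
            moreover have "0 \<le> (1 + e) * Q' s yQ" using e_pos Q'0 by simp
            ultimately show ?thesis by linarith
          qed
          then have "K * \<kappa> * e * (c0 / 2) \<le> K * \<kappa> * e * ((1 + e) * Q' s yQ + (1 - e) * P' s yP)"
            using K \<kappa> e_pos by (intro mult_left_mono) auto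
          moreover have "K * \<kappa> * e * (c0 / 2) = (K * \<kappa> * c0) * (e / 2)" by simp
          moreover have "\<dots> = 2 * C * (B + 2) * e + e" unfolding K\<kappa> by (simp add: distrib_right)
          ultimately show ?thesis using e_pos by linarith
        qed
        \<comment> \<open>Near either stable state the other profile is necessarily the small one.
          In the intermediate ranges the argument of the profile lies in a bounded interval, where
          its slope is at least \<open>c0\<close>. In the last case both profiles are near the
          unstable state.\<close>
        consider (stP) "p \<ge> \<alpha> - \<eta> / 2" | (stQ) "q \<ge> \<beta> - \<eta> / 2"
          | (midP) "\<theta> \<le> p" "p < \<alpha> - \<eta> / 2" | (midQ) "\<theta> \<le> q" "q < \<beta> - \<eta> / 2" | (small) "p < \<theta>" "q < \<theta>"
          by linarith
        then show ?thesis
        proof cases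
          case stP
          have "\<not> p \<le> m" using stP m_le \<eta>_le \<eta>_pos by linarith
          then have "q \<le> \<eta> / 8" using pq m_le by linarith
          then have "defect s e q p \<le> 0"
            using stP p q e_pos e_le by (intro defect_near_\<alpha>) auto
          then show ?thesis using A0 S0 by linarith
        next
          case stQ
          have "\<not> q \<le> m" using stQ m_le \<eta>_le \<eta>_pos by linarith
          then have pm: "p \<le> m" using pq by linarith
          have qb: "\<beta> / 2 \<le> q" using stQ \<eta>_le \<eta>_pos by linarith
          have "(\<delta> + C) * p \<le> \<delta> * (e * q)"
          proof -
            have "(\<delta> + C) * p \<le> (\<delta> + C) * m" using pm \<delta>_pos Q.C_nonneg by (intro mult_left_mono) auto
            also have "\<dots> = (((\<delta> + C) * B) * e) * e" by (simp add: m_def power2_eq_square)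
            also have "\<dots> \<le> (((\<delta> + C) * B + 1) * (\<delta> * \<beta> / (2 * ((\<delta> + C) * B + 1)))) * e"
              using e_le e_pos B \<delta>_pos Q.C_nonneg by (intro mult_right_mono mult_mono) auto
            also have "\<dots> = \<delta> * e * (\<beta> / 2)" unfolding canc[OF den(1)] by simp
            also have "\<dots> \<le> \<delta> * e * q" using qb \<delta>_pos e_pos by (intro mult_left_mono) auto
            finally show ?thesis by simp
          qed
          moreover have "p \<le> e * q"
          proof -
            have "p \<le> (B * e) * e" using pm by (simp add: m_def power2_eq_square)
            also have "\<dots> \<le> ((B + 1) * (\<beta> / (4 * (B + 1)))) * e"
              using e_le e_pos B by (intro mult_right_mono mult_mono) auto
            also have "\<dots> = (\<beta> / 4) * e" unfolding canc[OF den(3)] ..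
            also have "\<dots> \<le> q * e" using qb Q.b_pos e_pos by (intro mult_right_mono) auto
            finally show ?thesis by (simp add: mult.commute)
          qed
          then have "defect s e q p \<le> - \<delta> * (e * q) + (\<delta> + C) * p"
            using stQ \<eta>_pos p q e_pos e_le by (intro defect_near_\<beta>) auto
          ultimately show ?thesis using A0 S0 by linarith
        next
          case midP
          have "\<not> yP \<le> - MP" using MP(1)[of yP s] midP \<theta> by (auto simp: p_def)
          moreover have "\<not> yP \<ge> MP" using MP(2)[of yP s] midP \<theta> \<eta>_pos by (auto simp: p_def)
          ultimately have "P' s yP \<ge> c0" using eP(2)[of yP s] min.cobounded2[of eQ eP] unfolding c0_def by linarith
          then show ?thesis using mid absorb A0 by linarith
        next
          case midQ
          have "\<not> yQ \<le> - MQ" using MQ(1)[of yQ s] midQ \<theta> by (auto simp: q_def)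
          moreover have "\<not> yQ \<ge> MQ" using MQ(2)[of yQ s] midQ \<theta> \<eta>_pos by (auto simp: q_def)
          ultimately have "Q' s yQ \<ge> c0" using eQ(2)[of yQ s] min.cobounded1[of eQ eP] unfolding c0_def by linarith
          then show ?thesis using mid absorb A0 by linarith
        next
          case small
          have "q * p \<le> m * (q + p)"
            using pq
          proof
            assume a: "q \<le> m"
            have "q * p \<le> m * p" "0 \<le> m * q" using a p q by (auto intro: mult_right_mono)
            then show ?thesis by (simp add: distrib_left)
          next
            assume a: "p \<le> m"
            have "q * p \<le> q * m" "0 \<le> m * p" using a p q by (auto intro: mult_left_mono)
            then show ?thesis by (simp add: algebra_simps)
          qed
          also have "\<dots> \<le> (B * e\<^sup>2) * (q + p)" by (simp add: m_def)
          finally have a: "q * p \<le> (B * e) * e * (q + p)" by (simp add: power2_eq_square)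
          have "q\<^sup>2 \<le> \<theta> * q" "p\<^sup>2 \<le> \<theta> * p" using small q p by (auto simp: power2_eq_square intro: mult_right_mono)
          then have "e * (q\<^sup>2 + p\<^sup>2) \<le> e * (\<theta> * (q + p))" using e_pos by (intro mult_left_mono) (auto simp: distrib_left)
          then have "q * p + e * (q\<^sup>2 + p\<^sup>2) \<le> (B * e + \<theta>) * (e * (q + p))" using a by (simp add: algebra_simps)
          then have "2 * C * (q * p + e * (q\<^sup>2 + p\<^sup>2)) \<le> 2 * C * ((B * e + \<theta>) * (e * (q + p)))"
            using Q.C_nonneg by (intro mult_left_mono) auto
          also have "\<dots> = (2 * (C * B * e) + 2 * C * \<theta>) * (e * (q + p))" by (simp add: algebra_simps)
          also have "\<dots> \<le> \<kappa> * (e * (q + p))"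
          proof -
            have "C * B * e \<le> (C * B + 1) * (\<kappa> / (4 * (C * B + 1)))"
              using e_le e_pos B Q.C_nonneg by (intro mult_mono) auto
            also have "\<dots> = \<kappa> / 4" by (rule canc[OF den(2)])
            finally have "2 * (C * B * e) + 2 * C * \<theta> \<le> \<kappa>" using \<theta> by linarith
            moreover have "0 \<le> e * (q + p)" using e_pos q p by simp
            ultimately show ?thesis by (rule mult_right_mono)
          qed
          finally show ?thesis using dl S0 by (simp add: mult.assoc)
        qed
      qed
      obtain D where D: "(W \<kappa> K s has_real_derivative D) (at t)"
        "D - ((\<Sum>k\<in>S. J k * W \<kappa> K (s - k) t) - W \<kappa> K s t + h s (W \<kappa> K s t)) =
        \<kappa> * e * (q + p) + K * \<kappa> * e * ((1 + e) * Q' s yQ + (1 - e) * P' s yP) - defect s e q p"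
        using W_supersolution_aux[of \<kappa> K s t] unfolding q_def p_def yQ_def yP_def e_def by blast
      have "D \<ge> (\<Sum>k\<in>S. J k * W \<kappa> K (s - k) t) - W \<kappa> K s t + h s (W \<kappa> K s t)"
        using D(2) main by linarith
      then show "\<exists>D. (W \<kappa> K s has_real_derivative D) (at t) \<and>
        D \<ge> (\<Sum>k\<in>S. J k * W \<kappa> K (s - k) t) - W \<kappa> K s t + h s (W \<kappa> K s t)"
        using D(1) by blast
    qed
  qed
qed

end

section \<open>Monotone iteration for entire solutions\<close>

text \<open>For bounded continuous \<open>w\<close> this is the solution of v' = w - K * v that
  stays bounded at -\<infinity>, by variation of constants. Starting the integral at -\<infinity>
  leaves no initial value to choose.\<close>

definition memory :: "real \<Rightarrow> (real \<Rightarrow> real) \<Rightarrow> real \<Rightarrow> real" where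
  "memory K w t = (LINT r|lborel. indicator {..t} r * (exp (K * (r - t)) * w r))"

lemma exp_kernel_integral:
  fixes K :: real
  assumes K: "K > 0"
  shows "has_bochner_integral lborel (\<lambda>r. indicator {..t} r * exp (K * (r - t))) (1 / K)"
proof -
  define f where "f = (\<lambda>x::real. indicator {0..} x * exp (- K * x))"
  have "((\<lambda>x. exp (- K * x)) has_integral 1 / K) {0..}"
    using has_integral_exp_minus_to_infinity[OF K, of 0] by simp
  then have "((\<lambda>x. if x \<in> {0..} then exp (- K * x) else 0) has_integral 1 / K) UNIV"
    by (simp only: has_integral_restrict_UNIV)
  moreover have "(\<lambda>x. if x \<in> {0..} then exp (- K * x) else 0) = f"
    by (auto simp: f_def indicator_def)
  ultimately have f: "(f has_integral 1 / K) UNIV" by simp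
  have "f \<in> borel_measurable borel" unfolding f_def by measurable
  moreover have "f x \<ge> 0" for x by (simp add: f_def indicator_def)
  ultimately have "has_bochner_integral lborel f (1 / K)"
    using f K by (intro has_bochner_integral_nn_integral nn_integral_has_integral_lborel) auto
  then have "has_bochner_integral lborel (\<lambda>r. f (t + (- 1) * r)) ((1 / K) /\<^sub>R \<bar>- 1\<bar>)"
    by (subst (asm) lborel_has_bochner_integral_real_affine_iff[of "- 1" _ _ t]) simp_all
  moreover have "(\<lambda>r. f (t + (- 1) * r)) = (\<lambda>r. indicator {..t} r * exp (K * (r - t)))"
    by (auto simp: f_def indicator_def algebra_simps)
  ultimately show ?thesis by simp
qed

context
  fixes K :: real
  assumes K_pos: "K > 0"
begin

lemma memory_integrable:
  assumes [measurable]: "w \<in> borel_measurable borel" and B: "\<And>r. \<bar>w r\<bar> \<le> B"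
  shows "integrable lborel (\<lambda>r. indicator {..t} r * (exp (K * (r - t)) * w r))"
proof (rule Bochner_Integration.integrable_bound)
  show "integrable lborel (\<lambda>r. B * (indicator {..t} r * exp (K * (r - t))))"
    using exp_kernel_integral[OF K_pos, of t]
    by (intro integrable_mult_right) (simp add: has_bochner_integral_iff)
  show "AE r in lborel. norm (indicator {..t} r * (exp (K * (r - t)) * w r))
      \<le> norm (B * (indicator {..t} r * exp (K * (r - t))))"
  proof (rule AE_I2)
    fix r
    have "\<bar>w r\<bar> \<le> \<bar>B\<bar>" using B[of r] by simp
    then show "norm (indicator {..t} r * (exp (K * (r - t)) * w r))
      \<le> norm (B * (indicator {..t} r * exp (K * (r - t))))"
      by (simp add: abs_mult indicator_def)
  qed
qed simp

lemma memory_const: "memory K (\<lambda>_. c) t = c / K"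
proof -
  have "memory K (\<lambda>_. c) t = (LINT r|lborel. c * (indicator {..t} r * exp (K * (r - t))))"
    unfolding memory_def by (intro Bochner_Integration.integral_cong refl) simp
  also have "\<dots> = c * (1 / K)"
    using exp_kernel_integral[OF K_pos, of t] by (simp add: has_bochner_integral_iff)
  finally show ?thesis by simp
qed

lemma memory_mono:
  assumes "v \<in> borel_measurable borel" "\<And>r. \<bar>v r\<bar> \<le> B" "w \<in> borel_measurable borel" "\<And>r. \<bar>w r\<bar> \<le> B"
    and le: "\<And>r. r \<le> t \<Longrightarrow> v r \<le> w r"
  shows "memory K v t \<le> memory K w t"
  unfolding memory_def
proof (rule integral_mono)
  show "integrable lborel (\<lambda>r. indicator {..t} r * (exp (K * (r - t)) * v r))"
    "integrable lborel (\<lambda>r. indicator {..t} r * (exp (K * (r - t)) * w r))"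
    using memory_integrable assms by blast+
  fix r
  show "indicator {..t} r * (exp (K * (r - t)) * v r) \<le> indicator {..t} r * (exp (K * (r - t)) * w r)"
    using le[of r] by (simp add: indicator_def)
qed

lemma memory_bounds:
  assumes "w \<in> borel_measurable borel" "\<And>r. 0 \<le> w r" "\<And>r. w r \<le> K"
  shows "0 \<le> memory K w t" "memory K w t \<le> 1"
proof -
  have b: "\<And>r. \<bar>w r\<bar> \<le> K" by (simp add: assms)
  have "memory K (\<lambda>_. 0) t \<le> memory K w t"
    by (rule memory_mono[where B = K]) (use assms b K_pos in auto)
  then show "0 \<le> memory K w t" by (simp add: memory_const)
  have "memory K w t \<le> memory K (\<lambda>_. K) t"
    by (rule memory_mono[where B = K]) (use assms b K_pos in auto)
  then show "memory K w t \<le> 1" using K_pos by (simp add: memory_const)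
qed

text \<open>After multiplication by exp (K * t) the integrand no longer depends on t, so the
  integral splits at any earlier time. Comparison, continuity and differentiation all rest on
  this.\<close>

lemma memory_split:
  assumes w[measurable]: "w \<in> borel_measurable borel" and B: "\<And>r. \<bar>w r\<bar> \<le> B" and l: "l \<le> t"
  shows "(\<lambda>r. exp (K * r) * w r) integrable_on {l..t}"
    and "exp (K * t) * memory K w t = exp (K * l) * memory K w l + integral {l..t} (\<lambda>r. exp (K * r) * w r)"
proof -
  have scale: "exp (K * u) * memory K w u = (LINT r|lborel. indicator {..u} r * (exp (K * r) * w r))"
    and int: "integrable lborel (\<lambda>r. indicator {..u} r * (exp (K * r) * w r))" for u
  proof -
    have eq: "(\<lambda>r. exp (K * u) * (indicator {..u} r * (exp (K * (r - u)) * w r))) = (\<lambda>r. indicator {..u} r * (exp (K * r) * w r))"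
      by (rule ext) (simp add: right_diff_distrib exp_diff)
    show "integrable lborel (\<lambda>r. indicator {..u} r * (exp (K * r) * w r))"
      using integrable_mult_right[OF memory_integrable[OF w B, of u], of "exp (K * u)"] unfolding eq .
    show "exp (K * u) * memory K w u = (LINT r|lborel. indicator {..u} r * (exp (K * r) * w r))"
      unfolding memory_def eq[symmetric] by simp
  qed
  have si: "set_integrable lborel {l..t} (\<lambda>r. exp (K * r) * w r)"
    unfolding set_integrable_def real_scaleR_def
  proof (rule Bochner_Integration.integrable_bound[OF int[of t]])
    show "AE r in lborel. norm (indicator {l..t} r * (exp (K * r) * w r)) \<le> norm (indicator {..t} r * (exp (K * r) * w r))"
      by (intro AE_I2) (auto simp: indicator_def)
  qed simp
  then show "(\<lambda>r. exp (K * r) * w r) integrable_on {l..t}" by (rule set_borel_integral_eq_integral)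
  have "(LINT r|lborel. indicator {..t} r * (exp (K * r) * w r))
    = (LINT r|lborel. indicator {..l} r * (exp (K * r) * w r) + indicator {l..t} r * (exp (K * r) * w r))"
  proof (rule integral_cong_AE)
    show "AE r in lborel. indicator {..t} r * (exp (K * r) * w r)
      = indicator {..l} r * (exp (K * r) * w r) + indicator {l..t} r * (exp (K * r) * w r)"
      using AE_lborel_singleton[of l]
      by eventually_elim (use l in \<open>auto simp: indicator_def\<close>)
  qed simp_all
  also have "\<dots> = (LINT r|lborel. indicator {..l} r * (exp (K * r) * w r)) + (LINT r|lborel. indicator {l..t} r * (exp (K * r) * w r))"
    by (rule Bochner_Integration.integral_add[OF int]) (use si in \<open>simp add: set_integrable_def\<close>)
  also have "(LINT r|lborel. indicator {l..t} r * (exp (K * r) * w r)) = integral {l..t} (\<lambda>r. exp (K * r) * w r)"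
    using set_borel_integral_eq_integral(2)[OF si] by (simp add: set_lebesgue_integral_def)
  finally show "exp (K * t) * memory K w t = exp (K * l) * memory K w l + integral {l..t} (\<lambda>r. exp (K * r) * w r)"
    by (simp add: scale)
qed

lemma has_integral_exp_weight:
  fixes F Fd :: "real \<Rightarrow> real"
  assumes "l \<le> t" and F: "\<And>r. l \<le> r \<Longrightarrow> r \<le> t \<Longrightarrow> (F has_real_derivative Fd r) (at r)"
  shows "((\<lambda>r. exp (K * r) * (Fd r + K * F r)) has_integral exp (K * t) * F t - exp (K * l) * F l) {l..t}"
proof (rule fundamental_theorem_of_calculus[OF \<open>l \<le> t\<close>])
  fix r assume r: "r \<in> {l..t}"
  from DERIV_mult[OF DERIV_exp_mult[of K] F[of r]] r
  have "((\<lambda>r. exp (K * r) * F r) has_real_derivative exp (K * r) * (Fd r + K * F r)) (at r)"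
    by (simp add: algebra_simps)
  then show "((\<lambda>r. exp (K * r) * F r) has_vector_derivative exp (K * r) * (Fd r + K * F r)) (at r within {l..t})"
    by (simp add: has_field_derivative_at_within flip: has_real_derivative_iff_has_vector_derivative)
qed

text \<open>With exp as integrating factor the weighted difference of \<open>F\<close> and the
  memory term is nonincreasing, so an order at time l persists until t. The estimate is kept
  quantitative so that l can also be sent to -\<infinity>.\<close>

lemma sub_le_memory:
  assumes w: "w \<in> borel_measurable borel" and B: "\<And>r. \<bar>w r\<bar> \<le> B" and l: "l \<le> t"
    and F: "\<And>r. l \<le> r \<Longrightarrow> r \<le> t \<Longrightarrow> (F has_real_derivative Fd r) (at r)"
    and le: "\<And>r. l \<le> r \<Longrightarrow> r \<le> t \<Longrightarrow> Fd r + K * F r \<le> w r"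
  shows "exp (K * t) * (F t - memory K w t) \<le> exp (K * l) * (F l - memory K w l)"
proof -
  have "exp (K * t) * F t - exp (K * l) * F l \<le> integral {l..t} (\<lambda>r. exp (K * r) * w r)"
    by (rule has_integral_le[OF has_integral_exp_weight[OF l F] integrable_integral[OF memory_split(1)[OF w B l]]])
       (auto intro!: mult_left_mono le)
  then show ?thesis using memory_split(2)[OF w B l] by (simp add: right_diff_distrib)
qed

lemma memory_le_super:
  assumes w: "w \<in> borel_measurable borel" and B: "\<And>r. \<bar>w r\<bar> \<le> B" and l: "l \<le> t"
    and F: "\<And>r. l \<le> r \<Longrightarrow> r \<le> t \<Longrightarrow> (F has_real_derivative Fd r) (at r)"
    and le: "\<And>r. l \<le> r \<Longrightarrow> r \<le> t \<Longrightarrow> w r \<le> Fd r + K * F r"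
  shows "exp (K * l) * (F l - memory K w l) \<le> exp (K * t) * (F t - memory K w t)"
proof -
  have "integral {l..t} (\<lambda>r. exp (K * r) * w r) \<le> exp (K * t) * F t - exp (K * l) * F l"
    by (rule has_integral_le[OF integrable_integral[OF memory_split(1)[OF w B l]] has_integral_exp_weight[OF l F]])
       (auto intro!: mult_left_mono le)
  then show ?thesis using memory_split(2)[OF w B l] by (simp add: right_diff_distrib)
qed

lemma exp_small_at_bot: "((\<lambda>l. exp (K * l) * c) \<longlongrightarrow> 0) at_bot"
proof -
  have "filterlim (\<lambda>l. K * l) at_bot at_bot"
    by (rule filterlim_tendsto_pos_mult_at_bot[OF tendsto_const K_pos filterlim_ident])
  then have "((\<lambda>l. exp (K * l)) \<longlongrightarrow> 0) at_bot" by (rule filterlim_compose[OF exp_at_bot])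
  then show ?thesis using tendsto_mult_right[of _ 0 at_bot c] by fastforce
qed

lemma memory_abs_le:
  assumes "w \<in> borel_measurable borel" "\<And>r. \<bar>w r\<bar> \<le> B"
  shows "\<bar>memory K w t\<bar> \<le> B / K"
proof -
  have B: "B \<ge> 0" using assms(2)[of 0] by linarith
  have "memory K (\<lambda>_. - B) t \<le> memory K w t" "memory K w t \<le> memory K (\<lambda>_. B) t"
    by (rule memory_mono[where B = B]; use assms B in \<open>auto simp: abs_le_iff minus_le_iff\<close>)+
  then show ?thesis by (simp add: memory_const abs_le_iff)
qed

text \<open>The weighted difference at an early time l is at most exp (K * l) times a constant,
  because \<open>F\<close> is bounded above and the memory term is bounded. Letting l tend to
  -\<infinity> replaces an initial order.\<close>

lemma entire_sub_le_memory:
  assumes w: "w \<in> borel_measurable borel" and B: "\<And>r. \<bar>w r\<bar> \<le> B"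
    and F: "\<And>r. r \<le> t \<Longrightarrow> (F has_real_derivative Fd r) (at r)"
    and le: "\<And>r. r \<le> t \<Longrightarrow> Fd r + K * F r \<le> w r"
    and bdd: "\<And>r. r \<le> t \<Longrightarrow> F r \<le> A"
  shows "F t \<le> memory K w t"
proof -
  have "exp (K * t) * (F t - memory K w t) \<le> 0"
  proof (rule tendsto_lowerbound[OF exp_small_at_bot[of "A + B / K"]])
    show "\<forall>\<^sub>F l in at_bot. exp (K * t) * (F t - memory K w t) \<le> exp (K * l) * (A + B / K)"
      using eventually_le_at_bot[of t]
    proof eventually_elim
      case (elim l)
      have "exp (K * t) * (F t - memory K w t) \<le> exp (K * l) * (F l - memory K w l)"
        by (rule sub_le_memory[OF w B elim]) (use F le in auto)
      also have "\<dots> \<le> exp (K * l) * (A + B / K)"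
        using bdd[OF elim] memory_abs_le[OF w B, of l] by (intro mult_left_mono) (auto simp: abs_le_iff)
      finally show ?case .
    qed
  qed simp
  then have "exp (K * t) * (F t - memory K w t) \<le> exp (K * t) * 0" by simp
  then show ?thesis by (simp only: mult_le_cancel_left_pos[OF exp_gt_zero])
qed

lemma entire_memory_le_super:
  assumes w: "w \<in> borel_measurable borel" and B: "\<And>r. \<bar>w r\<bar> \<le> B"
    and F: "\<And>r. r \<le> t \<Longrightarrow> (F has_real_derivative Fd r) (at r)"
    and le: "\<And>r. r \<le> t \<Longrightarrow> w r \<le> Fd r + K * F r"
    and bdd: "\<And>r. r \<le> t \<Longrightarrow> A \<le> F r"
  shows "memory K w t \<le> F t"
proof -
  have "0 \<le> exp (K * t) * (F t - memory K w t)"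
  proof (rule tendsto_upperbound[OF exp_small_at_bot[of "A - B / K"]])
    show "\<forall>\<^sub>F l in at_bot. exp (K * l) * (A - B / K) \<le> exp (K * t) * (F t - memory K w t)"
      using eventually_le_at_bot[of t]
    proof eventually_elim
      case (elim l)
      have "exp (K * l) * (A - B / K) \<le> exp (K * l) * (F l - memory K w l)"
        using bdd[OF elim] memory_abs_le[OF w B, of l] by (intro mult_left_mono) (auto simp: abs_le_iff)
      also have "\<dots> \<le> exp (K * t) * (F t - memory K w t)"
        by (rule memory_le_super[OF w B elim]) (use F le in auto)
      finally show ?case .
    qed
  qed simp
  then have "exp (K * t) * 0 \<le> exp (K * t) * (F t - memory K w t)" by simp
  then show ?thesis by (simp only: mult_le_cancel_left_pos[OF exp_gt_zero])
qed

lemma memory_continuous: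
  assumes w: "w \<in> borel_measurable borel" and B: "\<And>r. \<bar>w r\<bar> \<le> B"
  shows "isCont (memory K w) t"
proof -
  define l where "l = t - 1"
  have eq: "memory K w u = (exp (K * l) * memory K w l + integral {l..u} (\<lambda>r. exp (K * r) * w r)) / exp (K * u)"
    if "u \<in> {l..t + 1}" for u
    using memory_split(2)[OF w B, of l u] that by (simp add: field_simps)
  have "continuous_on {l..t + 1} (\<lambda>u. (exp (K * l) * memory K w l + integral {l..u} (\<lambda>r. exp (K * r) * w r)) / exp (K * u))"
    by (intro continuous_intros indefinite_integral_continuous_1 memory_split(1)[OF w B]) (auto simp: l_def)
  then have "continuous_on {l..t + 1} (memory K w)"
    by (rule continuous_on_eq) (simp only: eq)
  then show ?thesis
    by (rule continuous_on_interior) (auto simp: l_def)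
qed

lemma memory_measurable:
  assumes w: "w \<in> borel_measurable borel" and B: "\<And>r. \<bar>w r\<bar> \<le> B"
  shows "memory K w \<in> borel_measurable borel"
  by (intro borel_measurable_continuous_onI continuous_at_imp_continuous_on ballI memory_continuous[OF assms])

lemma memory_deriv:
  assumes w: "\<And>t. isCont w t" and B: "\<And>r. \<bar>w r\<bar> \<le> B"
  shows "(memory K w has_real_derivative w t - K * memory K w t) (at t)"
proof -
  have wm: "w \<in> borel_measurable borel"
    by (intro borel_measurable_continuous_onI continuous_at_imp_continuous_on ballI w)
  define l where "l = t - 1"
  define I where "I = (\<lambda>u. exp (K * l) * memory K w l + integral {l..u} (\<lambda>r. exp (K * r) * w r))"
  have eq: "I u * exp (- K * u) = memory K w u" if "u \<in> {l<..<t + 1}" for u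
    using memory_split(2)[OF wm B, of l u] that by (simp add: I_def exp_minus field_simps)
  have t: "t \<in> {l<..<t + 1}" by (simp add: l_def)
  have c: "continuous_on {l..t + 1} (\<lambda>r. exp (K * r) * w r)"
    by (intro continuous_intros continuous_at_imp_continuous_on ballI w)
  have "((\<lambda>u. integral {l..u} (\<lambda>r. exp (K * r) * w r)) has_real_derivative exp (K * t) * w t) (at t within {l..t + 1})"
    by (rule integral_has_real_derivative[OF c]) (simp add: l_def)
  moreover have "at t within {l..t + 1} = at t" by (rule at_within_interior) (simp add: l_def)
  ultimately have i: "((\<lambda>u. integral {l..u} (\<lambda>r. exp (K * r) * w r)) has_real_derivative exp (K * t) * w t) (at t)"
    by simp
  have dI: "(I has_real_derivative exp (K * t) * w t) (at t)"
    unfolding I_def using DERIV_add[OF DERIV_const i] by simp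
  have "((\<lambda>u. I u * exp (- K * u)) has_real_derivative w t - K * memory K w t) (at t)"
  proof (rule DERIV_cong[OF DERIV_mult[OF dI DERIV_exp_mult[of "- K"]]])
    have "exp (K * t) * exp (- K * t) = 1" by (simp add: exp_minus)
    then have "exp (K * t) * w t * exp (- K * t) = w t" by (simp add: algebra_simps)
    then show "exp (K * t) * w t * exp (- K * t) + - K * exp (- K * t) * I t = w t - K * memory K w t"
      using eq[OF t] by (simp add: algebra_simps)
  qed
  then show ?thesis
    by (rule has_field_derivative_transform_within_open[of _ _ _ "{l<..<t + 1}"]) (use t eq in auto)
qed

end

lemma le_of_exp_mult:
  fixes v w r t :: real
  assumes "exp (r * t) * (v - w) \<le> exp (r * l) * d" "d \<le> 0"
  shows "v \<le> w"
proof -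
  have "exp (r * l) * d \<le> 0" using assms(2) by (simp add: mult_nonneg_nonpos)
  then have "exp (r * t) * (v - w) \<le> exp (r * t) * 0" using assms(1) by simp
  then show ?thesis by (simp only: mult_le_cancel_left_pos[OF exp_gt_zero])
qed

section \<open>The lattice equation as a monotone fixed-point problem\<close>

locale reaction = lattice S J N1 N2 for S J N1 N2 +
  fixes f f' :: "int \<times> int \<Rightarrow> real \<Rightarrow> real" and C :: real
  assumes f_deriv: "\<And>s w. (f s has_real_derivative f' s w) (at w)"
    and f'_bound: "\<And>s w. \<bar>w\<bar> \<le> 3 \<Longrightarrow> \<bar>f' s w\<bar> \<le> C"
    and f_0: "\<And>s. f s 0 = 0" and f_1: "\<And>s. f s 1 = 0"
begin

definition rhs where "rhs u s = (\<Sum>k\<in>S. J k * u (s - k)) - u s + f s (u s)"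

text \<open>Localised at one site and one time, since several of the bounds below satisfy their
  inequality in part of space-time only.\<close>

definition sub_at where
  "sub_at V s t \<longleftrightarrow> (\<exists>D. (V s has_real_derivative D) (at t) \<and> D \<le> rhs (\<lambda>s. V s t) s)"

definition super_at where
  "super_at V s t \<longleftrightarrow> (\<exists>D. (V s has_real_derivative D) (at t) \<and> rhs (\<lambda>s. V s t) s \<le> D)"

text \<open>C outweighs the slope of the reaction and 1 the term - u, so that adding rate * u makes
  the right-hand side nondecreasing in all its arguments, for values between -3 and 3.\<close>

definition rate where "rate = C + 1"

definition G where "G u s = rate * u s + rhs u s"

lemma rate_pos: "rate > 0"
  using f'_bound[of 0 "(0, 0)"] by (simp add: rate_def)

lemma f_lower_lip:
  assumes "v \<le> w" "- 3 \<le> v" "w \<le> 3"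
  shows "f s v - f s w \<le> C * (w - v)"
proof -
  have "(- f s w) - (- f s v) \<le> C * (w - v)"
  proof (rule deriv_le_imp_diff_le[of "\<lambda>w. - f s w" "\<lambda>w. - f' s w"])
    fix u assume "v \<le> u" "u \<le> w"
    then show "- f' s u \<le> C" using f'_bound[of u s] assms by (simp add: abs_le_iff)
  qed (auto intro: DERIV_minus f_deriv assms)
  then show ?thesis by simp
qed

lemma G_mono:
  assumes "u s \<le> v s" "\<And>k. k \<in> S \<Longrightarrow> u (s - k) \<le> v (s - k)" "- 3 \<le> u s" "v s \<le> 3"
  shows "G u s \<le> G v s"
proof -
  have "(\<Sum>k\<in>S. J k * u (s - k)) \<le> (\<Sum>k\<in>S. J k * v (s - k))"
    by (intro sum_mono mult_left_mono assms J_nonneg)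
  moreover have "f s (u s) - f s (v s) \<le> C * (v s - u s)"
    using assms by (intro f_lower_lip) auto
  ultimately show ?thesis by (simp add: G_def rhs_def rate_def algebra_simps)
qed

lemma G_0: "G (\<lambda>_. 0) s = 0" by (simp add: G_def rhs_def f_0)

lemma G_1: "G (\<lambda>_. 1) s = rate" by (simp add: G_def rhs_def f_1 sum_J)

definition admissible where
  "admissible u \<longleftrightarrow> (\<forall>s. u s \<in> borel_measurable borel) \<and> (\<forall>s t. 0 \<le> u s t \<and> u s (t::real) \<le> (1::real))"

lemma admissibleD:
  assumes "admissible u"
  shows "u s \<in> borel_measurable borel" "0 \<le> u s t" "u s t \<le> 1"
  using assms unfolding admissible_def by blast+

lemma f_isCont: "isCont (f s) w" by (rule DERIV_isCont[OF f_deriv])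

lemma G_measurable:
  assumes u: "admissible u"
  shows "(\<lambda>t. G (\<lambda>s. u s t) s) \<in> borel_measurable borel"
proof -
  note [measurable] = admissibleD(1)[OF u]
  have [measurable]: "f s \<in> borel_measurable borel"
    by (intro borel_measurable_continuous_onI continuous_at_imp_continuous_on ballI f_isCont)
  show ?thesis unfolding G_def rhs_def by measurable
qed

lemma G_bounds:
  assumes u: "admissible u"
  shows "0 \<le> G (\<lambda>s. u s t) s" "G (\<lambda>s. u s t) s \<le> rate" "\<bar>G (\<lambda>s. u s t) s\<bar> \<le> rate"
proof -
  note b = admissibleD(2,3)[OF u]
  have "G (\<lambda>_. 0) s \<le> G (\<lambda>s. u s t) s" by (intro G_mono b) (use b[of s t] in linarith)+
  then show 1: "0 \<le> G (\<lambda>s. u s t) s" by (simp add: G_0)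
  have "G (\<lambda>s. u s t) s \<le> G (\<lambda>_. 1) s" by (intro G_mono b) (use b[of s t] in linarith)+
  then show "G (\<lambda>s. u s t) s \<le> rate" by (simp add: G_1)
  with 1 show "\<bar>G (\<lambda>s. u s t) s\<bar> \<le> rate" by simp
qed

text \<open>Its admissible fixed points are entire solutions: u' = G u - rate * u is the lattice
  equation.\<close>

definition relax where "relax u s t = memory rate (\<lambda>r. G (\<lambda>s. u s r) s) t"

lemma relax_admissible:
  assumes "admissible u" shows "admissible (relax u)"
proof -
  have "relax u s = memory rate (\<lambda>r. G (\<lambda>s. u s r) s)" for s by (rule ext) (simp add: relax_def)
  then show ?thesis unfolding admissible_def
    using memory_measurable[OF rate_pos G_measurable[OF assms] G_bounds(3)[OF assms]]
      memory_bounds[OF rate_pos G_measurable[OF assms] G_bounds(1,2)[OF assms]]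
    by auto
qed

lemma relax_mono:
  assumes u: "admissible u" and v: "admissible v" and le: "\<And>s t. u s t \<le> v s t"
  shows "relax u s t \<le> relax v s t"
  unfolding relax_def
proof (rule memory_mono[OF rate_pos G_measurable[OF u] G_bounds(3)[OF u] G_measurable[OF v] G_bounds(3)[OF v]])
  fix r
  have "0 \<le> u s r" "v s r \<le> 1" by (rule admissibleD[OF u] admissibleD[OF v])+
  then show "G (\<lambda>s. u s r) s \<le> G (\<lambda>s. v s r) s" by (intro G_mono le) auto
qed

text \<open>Monotone iteration upwards, with 1 as ceiling. The convergence of the iterates is part
  of the conclusion because upper bounds for \<open>U\<close> are later proved for every iterate and
  passed to the limit.\<close>

theorem entire_solution_above:
  assumes L: "admissible L" and sub: "\<And>s t. L s t \<le> relax L s t"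
  shows "\<exists>U. (\<forall>s t. (U s has_real_derivative rhs (\<lambda>s. U s t) s) (at t)) \<and>
    (\<forall>s t. 0 \<le> U s t \<and> U s t \<le> 1 \<and> L s t \<le> U s t) \<and>
    (\<forall>s t. (\<lambda>n. (relax ^^ n) L s t) \<longlonglongrightarrow> U s t)"
proof -
  define u where "u = (\<lambda>n. (relax ^^ n) L)"
  have u_adm: "admissible (u n)" for n
    by (induction n) (simp_all add: u_def L relax_admissible)
  have Suc: "u (Suc n) s t = memory rate (\<lambda>r. G (\<lambda>s. u n s r) s) t" for n s t
    by (simp add: u_def relax_def)
  have inc: "u n s t \<le> u (Suc n) s t" for n s t
  proof (induction n arbitrary: s t)
    case 0
    then show ?case using sub by (simp add: u_def)
  next
    case (Suc n)
    have "relax (u n) s t \<le> relax (u (Suc n)) s t" by (rule relax_mono[OF u_adm u_adm Suc])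
    then show ?case by (simp add: u_def)
  qed
  have b: "0 \<le> u n s t" "u n s t \<le> 1" for n s t by (rule admissibleD[OF u_adm])+
  define U where "U = (\<lambda>s t. SUP n. u n s t)"
  have lim: "(\<lambda>n. u n s t) \<longlonglongrightarrow> U s t" for s t
    unfolding U_def
  proof (rule LIMSEQ_incseq_SUP)
    show "bdd_above (range (\<lambda>n. u n s t))" by (rule bdd_aboveI2) (rule b)
    show "incseq (\<lambda>n. u n s t)" by (rule incseq_SucI) (rule inc)
  qed
  have U01: "0 \<le> U s t" "U s t \<le> 1" for s t
    using LIMSEQ_le_const[OF lim, of 0] LIMSEQ_le_const2[OF lim, of _ _ 1] b by blast+
  have LU: "L s t \<le> U s t" for s t
  proof -
    have "u 0 s t \<le> U s t"
      unfolding U_def by (rule cSUP_upper[OF UNIV_I], rule bdd_aboveI2) (rule b)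
    then show ?thesis by (simp add: u_def)
  qed
  have "U s \<in> borel_measurable borel" for s
  proof (rule borel_measurable_LIMSEQ_real)
    show "(\<lambda>n. u n s t) \<longlonglongrightarrow> U s t" for t by (rule lim)
    show "u n s \<in> borel_measurable borel" for n by (rule admissibleD[OF u_adm])
  qed
  then have U_adm: "admissible U" using U01 by (simp add: admissible_def)
  have Glim: "(\<lambda>n. G (\<lambda>s. u n s r) s) \<longlonglongrightarrow> G (\<lambda>s. U s r) s" for r s
    unfolding G_def rhs_def
    by (intro tendsto_intros lim isCont_tendsto_compose[OF f_isCont])
  have fixed_point: "U s t = memory rate (\<lambda>r. G (\<lambda>s. U s r) s) t" for s t
  proof (rule LIMSEQ_unique[OF LIMSEQ_Suc[OF lim]])
    show "(\<lambda>n. u (Suc n) s t) \<longlonglongrightarrow> memory rate (\<lambda>r. G (\<lambda>s. U s r) s) t"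
      unfolding Suc memory_def
    proof (rule integral_dominated_convergence[where w = "\<lambda>r. rate * (indicator {..t} r * exp (rate * (r - t)))"])
      have Gm[measurable]: "(\<lambda>r. G (\<lambda>s. U s r) s) \<in> borel_measurable borel"
        "\<And>n. (\<lambda>r. G (\<lambda>s. u n s r) s) \<in> borel_measurable borel"
        by (rule G_measurable U_adm u_adm)+
      show "(\<lambda>r. indicator {..t} r * (exp (rate * (r - t)) * G (\<lambda>s. U s r) s)) \<in> borel_measurable lborel"
        "\<And>n. (\<lambda>r. indicator {..t} r * (exp (rate * (r - t)) * G (\<lambda>s. u n s r) s)) \<in> borel_measurable lborel"
        by measurable
      show "integrable lborel (\<lambda>r. rate * (indicator {..t} r * exp (rate * (r - t))))"
        using exp_kernel_integral[OF rate_pos, of t]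
        by (intro integrable_mult_right) (simp add: has_bochner_integral_iff)
      show "AE r in lborel. (\<lambda>n. indicator {..t} r * (exp (rate * (r - t)) * G (\<lambda>s. u n s r) s))
          \<longlonglongrightarrow> indicator {..t} r * (exp (rate * (r - t)) * G (\<lambda>s. U s r) s)"
        by (intro AE_I2 tendsto_mult tendsto_const Glim)
      show "\<And>n. AE r in lborel. norm (indicator {..t} r * (exp (rate * (r - t)) * G (\<lambda>s. u n s r) s))
          \<le> rate * (indicator {..t} r * exp (rate * (r - t)))"
        using G_bounds(3)[OF u_adm] by (intro AE_I2) (simp add: abs_mult indicator_def mult.commute)
    qed
  qed
  \<comment> \<open>Regularity is gained twice from the fixed-point equation: a measurable integrand
    makes \<open>U\<close> continuous, and then the continuous integrand makes it
    differentiable.\<close>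
  have U_eq: "U s = memory rate (\<lambda>r. G (\<lambda>s. U s r) s)" for s by (rule ext) (rule fixed_point)
  have U_cont: "isCont (U s) t" for s t
    by (subst U_eq) (rule memory_continuous[OF rate_pos G_measurable[OF U_adm] G_bounds(3)[OF U_adm]])
  have G_cont: "isCont (\<lambda>r. G (\<lambda>s. U s r) s) t" for s t
    unfolding G_def rhs_def
    by (intro continuous_intros U_cont isCont_o2[OF U_cont f_isCont])
  have "(U s has_real_derivative rhs (\<lambda>s. U s t) s) (at t)" for s t
  proof -
    have "(memory rate (\<lambda>r. G (\<lambda>s. U s r) s) has_real_derivative
        G (\<lambda>s. U s t) s - rate * memory rate (\<lambda>r. G (\<lambda>s. U s r) s) t) (at t)"
      by (rule memory_deriv[OF rate_pos G_cont G_bounds(3)[OF U_adm]])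
    then have "(U s has_real_derivative G (\<lambda>s. U s t) s - rate * U s t) (at t)"
      unfolding U_eq[symmetric] .
    then show ?thesis by (simp add: G_def)
  qed
  then show ?thesis using U01 LU lim unfolding u_def by blast
qed

text \<open>Since \<open>V\<close> lies below \<open>L\<close> on the whole interval, monotonicity
  of \<open>G\<close> replaces the nonlinear comparison by a linear one with a given integrand. This
  serves the pieces of the starting subsolution that enter at a finite time.\<close>

lemma subsolution_le_relax_from:
  assumes L: "admissible L" and l: "l \<le> t"
    and V: "\<And>r. l \<le> r \<Longrightarrow> r \<le> t \<Longrightarrow> sub_at V s r"
    and le: "\<And>r s. l \<le> r \<Longrightarrow> r \<le> t \<Longrightarrow> V s r \<le> L s r" and lb: "\<And>r. l \<le> r \<Longrightarrow> r \<le> t \<Longrightarrow> - 3 \<le> V s r"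
  shows "exp (rate * t) * (V s t - relax L s t) \<le> exp (rate * l) * (V s l - relax L s l)"
proof -
  have "\<exists>Vd. \<forall>r. l \<le> r \<and> r \<le> t \<longrightarrow> (V s has_real_derivative Vd r) (at r) \<and> Vd r \<le> rhs (\<lambda>s. V s r) s"
    using V unfolding sub_at_def by (intro choice) blast
  then obtain Vd where Vd: "\<And>r. l \<le> r \<Longrightarrow> r \<le> t \<Longrightarrow> (V s has_real_derivative Vd r) (at r)"
    "\<And>r. l \<le> r \<Longrightarrow> r \<le> t \<Longrightarrow> Vd r \<le> rhs (\<lambda>s. V s r) s" by blast
  show ?thesis unfolding relax_def
  proof (rule sub_le_memory[OF rate_pos G_measurable[OF L] G_bounds(3)[OF L] l Vd(1)])
    fix r assume r: "l \<le> r" "r \<le> t"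
    have "L s r \<le> 3" using admissibleD(3)[OF L, of s r] by simp
    then have "G (\<lambda>s. V s r) s \<le> G (\<lambda>s. L s r) s" by (intro G_mono le lb r)
    then show "Vd r + rate * V s r \<le> G (\<lambda>s. L s r) s" using Vd(2)[OF r] by (simp add: G_def)
  qed
qed

lemma subsolution_le_relax:
  assumes L: "admissible L"
    and V: "\<And>r. r \<le> t \<Longrightarrow> sub_at V s r"
    and le: "\<And>r s. r \<le> t \<Longrightarrow> V s r \<le> L s r" and lb: "\<And>r. r \<le> t \<Longrightarrow> - 3 \<le> V s r"
  shows "V s t \<le> relax L s t"
proof -
  have "\<exists>Vd. \<forall>r. r \<le> t \<longrightarrow> (V s has_real_derivative Vd r) (at r) \<and> Vd r \<le> rhs (\<lambda>s. V s r) s"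
    using V unfolding sub_at_def by (intro choice) blast
  then obtain Vd where Vd: "\<And>r. r \<le> t \<Longrightarrow> (V s has_real_derivative Vd r) (at r)"
    "\<And>r. r \<le> t \<Longrightarrow> Vd r \<le> rhs (\<lambda>s. V s r) s" by blast
  show ?thesis unfolding relax_def
  proof (rule entire_sub_le_memory[OF rate_pos G_measurable[OF L] G_bounds(3)[OF L] Vd(1), where A = 1])
    fix r assume r: "r \<le> t"
    have L1: "L s r \<le> 1" by (rule admissibleD[OF L])
    then show "V s r \<le> 1" using le[OF r, of s] by simp
    have "G (\<lambda>s. V s r) s \<le> G (\<lambda>s. L s r) s" using L1 by (intro G_mono le lb r) simp
    then show "Vd r + rate * V s r \<le> G (\<lambda>s. L s r) s" using Vd(2)[OF r] by (simp add: G_def)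
  qed
qed

text \<open>The order is demanded at s and at the sites that interact with s, so \<open>V\<close>
  may fail to dominate elsewhere. This is what permits two upper bounds to be matched along a moving
  point.\<close>

lemma relax_le_supersolution_from:
  assumes u: "admissible u" and l: "l \<le> t"
    and V: "\<And>r. l \<le> r \<Longrightarrow> r \<le> t \<Longrightarrow> super_at V s r"
    and le: "\<And>r. l \<le> r \<Longrightarrow> r \<le> t \<Longrightarrow> u s r \<le> V s r"
      "\<And>r k. l \<le> r \<Longrightarrow> r \<le> t \<Longrightarrow> k \<in> S \<Longrightarrow> u (s - k) r \<le> V (s - k) r"
    and ub: "\<And>r. l \<le> r \<Longrightarrow> r \<le> t \<Longrightarrow> V s r \<le> 3"
  shows "exp (rate * l) * (V s l - relax u s l) \<le> exp (rate * t) * (V s t - relax u s t)"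
proof -
  have "\<exists>Vd. \<forall>r. l \<le> r \<and> r \<le> t \<longrightarrow> (V s has_real_derivative Vd r) (at r) \<and> Vd r \<ge> rhs (\<lambda>s. V s r) s"
    using V unfolding super_at_def by (intro choice) blast
  then obtain Vd where Vd: "\<And>r. l \<le> r \<Longrightarrow> r \<le> t \<Longrightarrow> (V s has_real_derivative Vd r) (at r)"
    "\<And>r. l \<le> r \<Longrightarrow> r \<le> t \<Longrightarrow> Vd r \<ge> rhs (\<lambda>s. V s r) s" by blast
  show ?thesis unfolding relax_def
  proof (rule memory_le_super[OF rate_pos G_measurable[OF u] G_bounds(3)[OF u] l Vd(1)])
    fix r assume r: "l \<le> r" "r \<le> t"
    have "- 3 \<le> u s r" using admissibleD(2)[OF u, of s r] by simp
    then have "G (\<lambda>s. u s r) s \<le> G (\<lambda>s. V s r) s" by (intro G_mono le ub r)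
    then show "G (\<lambda>s. u s r) s \<le> Vd r + rate * V s r" using Vd(2)[OF r] by (simp add: G_def)
  qed
qed

lemma relax_le_supersolution:
  assumes u: "admissible u"
    and V: "\<And>r. r \<le> t \<Longrightarrow> super_at V s r"
    and le: "\<And>r. r \<le> t \<Longrightarrow> u s r \<le> V s r" "\<And>r k. r \<le> t \<Longrightarrow> k \<in> S \<Longrightarrow> u (s - k) r \<le> V (s - k) r"
    and ub: "\<And>r. r \<le> t \<Longrightarrow> V s r \<le> 3"
  shows "relax u s t \<le> V s t"
proof -
  have "\<exists>Vd. \<forall>r. r \<le> t \<longrightarrow> (V s has_real_derivative Vd r) (at r) \<and> Vd r \<ge> rhs (\<lambda>s. V s r) s"
    using V unfolding super_at_def by (intro choice) blast
  then obtain Vd where Vd: "\<And>r. r \<le> t \<Longrightarrow> (V s has_real_derivative Vd r) (at r)"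
    "\<And>r. r \<le> t \<Longrightarrow> Vd r \<ge> rhs (\<lambda>s. V s r) s" by blast
  show ?thesis unfolding relax_def
  proof (rule entire_memory_le_super[OF rate_pos G_measurable[OF u] G_bounds(3)[OF u] Vd(1), where A = 0])
    fix r assume r: "r \<le> t"
    have u0: "0 \<le> u s r" by (rule admissibleD[OF u])
    then have u3: "- 3 \<le> u s r" by simp
    from u0 show "0 \<le> V s r" using le(1)[OF r] by simp
    have "G (\<lambda>s. u s r) s \<le> G (\<lambda>s. V s r) s" by (intro G_mono le ub r u3)
    then show "G (\<lambda>s. u s r) s \<le> Vd r + rate * V s r" using Vd(2)[OF r] by (simp add: G_def)
  qed
qed

end

lemma exp_rate_at_bot: "r > 0 \<Longrightarrow> ((\<lambda>t::real. exp (r * t)) \<longlongrightarrow> 0) at_bot"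
  by (rule filterlim_compose[OF exp_at_bot])
     (rule filterlim_tendsto_pos_mult_at_bot[OF tendsto_const _ filterlim_ident])

section \<open>Three fronts\<close>

text \<open>The front from \<open>1\<close> to \<open>0\<close> enters as \<open>g\<close>, read from right to left, with speed \<open>- cG\<close>; the
  front from \<open>0\<close> to \<open>a\<close> is \<open>a - P\<close>, with speed \<open>- cP\<close>; the front from \<open>a\<close> to \<open>1\<close> is \<open>a + Q\<close>,
  with speed \<open>cQ\<close>.\<close>

locale three_fronts =
  reaction S J N1 N2 f f' C +
  pair: front_pair S J N1 N2 x "\<lambda>s w. f s (a + w)" "\<lambda>s w. f' s (a + w)" cQ cP Q Q' P P' a "1 - a" C \<delta> \<eta> +
  G: front S J N1 N2 "\<lambda>k. - x k" cG f f' g g' 1 C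
  for S J N1 N2 f f' C x cQ cP Q Q' P P' a \<delta> \<eta> cG g g' +
  assumes cG_gt: "cP < cG"
    and f_stable: "\<And>s w. \<bar>w\<bar> \<le> \<eta> \<Longrightarrow> f' s w \<le> - \<delta>"
    and finite_range_f: "finite (range f)"
    and left_decay: "\<exists>K>0. \<exists>lam>0. \<forall>s y. a - P s (- y) \<le> K * exp (lam * y)"
begin

lemma f_stable_1: "\<bar>w - 1\<bar> \<le> \<eta> \<Longrightarrow> f' s w \<le> - \<delta>"
  using pair.stable_\<beta>[of "w - a" s] by simp

lemma a_bounds: "0 < a" "a < 1" using pair.P.b_pos pair.Q.b_pos by auto

lemma cG_pos: "cG > 0" using cG_gt pair.cP_pos by simp

text \<open>Changing the sign of w and of x exchanges the two profiles. The supersolution of the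
  reflected pair, subtracted from a, is a subsolution of the original problem, so the long estimate
  is made once.\<close>

sublocale flip: front_pair S J N1 N2 "\<lambda>k. - x k" "\<lambda>s w. - f s (a + - w)" "\<lambda>s w. f' s (a + - w)"
  cP cQ P P' Q Q' "1 - a" a C \<delta> \<eta>
proof (intro front_pair.intro front_pair_axioms.intro)
  show "front S J N1 N2 (\<lambda>k. - x k) cP (\<lambda>s w. - f s (a + - w)) (\<lambda>s w. f' s (a + - w)) P P' a C"
    by (rule pair.P.front_axioms)
  show "front S J N1 N2 (\<lambda>k. - (- x k)) cQ (\<lambda>s w. - (- f s (a + - (- w)))) (\<lambda>s w. f' s (a + - (- w))) Q Q' (1 - a) C"
    using pair.Q.front_axioms by simp
  fix s v w
  show "cP > 0" "cQ > 0" "\<delta> > 0" "\<eta> > 0" "4 * \<eta> \<le> 1 - a" "4 * \<eta> \<le> a"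
    using pair.cP_pos pair.cQ_pos pair.\<delta>_pos pair.\<eta>_pos pair.\<eta>_le by auto
  show "\<bar>f' s (a + - w)\<bar> \<le> C" if "\<bar>w\<bar> \<le> 3" using pair.bd3[of "- w" s] that by simp
  show "\<bar>f' s (a + - v) - f' s (a + - w)\<bar> \<le> C * \<bar>v - w\<bar>" if "\<bar>v\<bar> \<le> 3" "\<bar>w\<bar> \<le> 3"
    using pair.lip3[of "- v" "- w" s] that by (simp add: abs_minus_commute)
  show "f' s (a + - w) \<le> - \<delta>" if "\<bar>w - a\<bar> \<le> \<eta>"
    using pair.stable_\<alpha>[of "- w" s] that by (simp add: abs_minus_commute)
  show "f' s (a + - w) \<le> - \<delta>" if "\<bar>w + (1 - a)\<bar> \<le> \<eta>"
    using pair.stable_\<beta>[of "- w" s] that by (simp add: algebra_simps abs_le_iff)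
  show "\<delta> \<le> f' s (a + - w)" if "\<bar>w\<bar> \<le> \<eta>" using pair.unstable[of "- w" s] that by simp
  show "- f s (a + - a) = 0" "- f s (a + - (- (1 - a))) = 0" using f_0 f_1 by simp_all
  show "- f s (a + - w) > 0" if "0 < w" "w < a" using pair.h_neg[of "- w" s] that by simp
  show "- f s (a + - w) < 0" if "- (1 - a) < w" "w < 0" using pair.h_pos[of "- w" s] that by simp
qed

section \<open>Super- and subsolutions built from the last two fronts\<close>

lemma rhs_offset:
  "rhs (\<lambda>s. a + w s) s = (\<Sum>k\<in>S. J k * w (s - k)) - w s + f s (a + w s)"
  by (simp add: rhs_def distrib_left sum.distrib sum_distrib_right[symmetric] sum_J)

lemma rhs_offset_minus:
  "rhs (\<lambda>s. a - w s) s = - ((\<Sum>k\<in>S. J k * w (s - k)) - w s - f s (a - w s))"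
  by (simp add: rhs_def right_diff_distrib sum_subtractf sum_distrib_right[symmetric] sum_J)

definition upper where "upper \<kappa> K s t = a + pair.W \<kappa> K s t"

definition lower where "lower \<kappa> K s t = a - flip.W \<kappa> K s t"

lemma upper_supersolution:
  "\<exists>\<kappa>0>0. \<forall>\<kappa>. 0 < \<kappa> \<and> \<kappa> \<le> \<kappa>0 \<longrightarrow> (\<exists>K>0. \<exists>T. \<forall>t\<le>T. \<forall>s. super_at (upper \<kappa> K) s t)"
proof -
  have "super_at (upper \<kappa> K) s t"
    if D: "(pair.W \<kappa> K s has_real_derivative D) (at t)"
      "D \<ge> (\<Sum>k\<in>S. J k * pair.W \<kappa> K (s - k) t) - pair.W \<kappa> K s t + f s (a + pair.W \<kappa> K s t)" for \<kappa> K s t D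
    using DERIV_add[OF DERIV_const[of a] D(1)] D(2)
    unfolding super_at_def upper_def[abs_def] rhs_offset by auto
  then show ?thesis using pair.W_supersolution by meson
qed

lemma lower_subsolution:
  "\<exists>\<kappa>0>0. \<forall>\<kappa>. 0 < \<kappa> \<and> \<kappa> \<le> \<kappa>0 \<longrightarrow> (\<exists>K>0. \<exists>T. \<forall>t\<le>T. \<forall>s. sub_at (lower \<kappa> K) s t)"
proof -
  have "sub_at (lower \<kappa> K) s t"
    if D: "(flip.W \<kappa> K s has_real_derivative D) (at t)"
      "D \<ge> (\<Sum>k\<in>S. J k * flip.W \<kappa> K (s - k) t) - flip.W \<kappa> K s t + - f s (a + - flip.W \<kappa> K s t)" for \<kappa> K s t D
    using DERIV_diff[OF DERIV_const[of a] D(1)] D(2)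
    unfolding sub_at_def lower_def[abs_def] rhs_offset_minus by (auto intro!: exI[of _ "- D"])
  then show ?thesis using flip.W_supersolution by meson
qed

text \<open>\<open>m\<close> is the midpoint of the first two fronts. On its left, the supersolution \<open>upper\<close> is
  replaced by \<open>cap\<close>, which lies below \<open>upper\<close> at distance \<open>1\<close> to the left of \<open>m\<close> and above it at
  distance \<open>1\<close> to the right.\<close>

definition m where "m t = (cG + cP) / 2 * t"

text \<open>At x = m this equals a * exp (\<kappa> * t), the level that \<open>upper\<close>
  approaches between the first two fronts. One unit away it differs from that level by the factor
  exp \<sigma> or exp (- \<sigma>), a gap of order e that errors of order e^2 cannot close.\<close>

definition tilt where "tilt \<kappa> \<sigma> s t = a * exp (\<kappa> * t) * exp (\<sigma> * (x s - m t))"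

definition cap where
  "cap \<kappa> \<sigma> \<rho> s t = g s (- x s + cG * t + \<rho> * exp (\<kappa> * t)) + tilt \<kappa> \<sigma> s t"

lemma tilt_pos: "tilt \<kappa> \<sigma> s t > 0" by (simp add: tilt_def a_bounds)

text \<open>The added term is a small perturbation of a front between two stable states: near 0 and
  1 the slope - \<delta> controls it, and in the front zone the shift by \<rho> does. The
  restriction x \<le> m + 1 keeps it below \<eta> / 2. \<sigma> is chosen before \<kappa>, so it
  does not restrict \<kappa>.\<close>

lemma cap_supersolution:
  "\<exists>\<sigma>>0. \<forall>\<kappa>>0. \<exists>\<rho>>0. \<exists>T. \<forall>t\<le>T. \<forall>s. x s \<le> m t + 1 \<longrightarrow> super_at (cap \<kappa> \<sigma> \<rho>) s t"
proof -
  \<comment> \<open>Relative cost of the factor exp (\<sigma> * (x - m)), from dispersal and from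
    the motion of m. It vanishes at \<sigma> = 0, so a small positive \<sigma> keeps it below
    \<delta> / 2.\<close>
  define F where "F = (\<lambda>\<sigma>. \<sigma> * ((cG + cP) / 2) + ((\<Sum>k\<in>S. J k * exp (- \<sigma> * x k)) - 1))"
  have F0: "F 0 = 0" by (simp add: F_def sum_J)
  have "isCont F 0" unfolding F_def by (intro continuous_intros)
  then have "(F \<longlongrightarrow> 0) (at 0)" unfolding isCont_def F0 .
  then have "\<forall>\<^sub>F \<sigma> in at 0. F \<sigma> < \<delta> / 2"
    by (rule order_tendstoD) (use pair.\<delta>_pos in simp)
  then obtain d where d: "d > 0" "\<And>\<sigma>. \<sigma> \<noteq> 0 \<Longrightarrow> dist \<sigma> 0 < d \<Longrightarrow> F \<sigma> < \<delta> / 2"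
    unfolding eventually_at by blast
  define \<sigma> where "\<sigma> = d / 2"
  have \<sigma>: "\<sigma> > 0" "F \<sigma> \<le> \<delta> / 2"
    using d(1) d(2)[of "d / 2"] by (auto simp: \<sigma>_def dist_real_def)
  have "\<exists>\<rho>>0. \<exists>T. \<forall>t\<le>T. \<forall>s. x s \<le> m t + 1 \<longrightarrow> super_at (cap \<kappa> \<sigma> \<rho>) s t"
    if \<kappa>: "\<kappa> > 0" for \<kappa>
  proof -
    obtain M where M: "\<And>s y. y \<le> - M \<Longrightarrow> g s y \<le> \<eta> / 2" "\<And>s y. y \<ge> M \<Longrightarrow> 1 - \<eta> / 2 \<le> g s y"
      using G.uniform_limits[of "\<eta> / 2"] pair.\<eta>_pos by auto
    obtain c0 where c0: "c0 > 0" "\<And>s y. \<bar>y\<bar> \<le> M \<Longrightarrow> g' s y \<ge> c0"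
      using G.g'_lower_bound[OF cG_pos, of M] by blast
    \<comment> \<open>Chosen so that \<rho> * \<kappa> * e * c0 equals (C + \<delta> / 2) * a * exp
      \<sigma> * e, which for x \<le> m + 1 is at least C + \<delta> / 2 times the added term: C for
      the reaction, \<delta> / 2 for \<open>F\<close>.\<close>
    define \<rho> where "\<rho> = (C + \<delta> / 2) * (a * exp \<sigma>) / (\<kappa> * c0)"
    have C\<delta>: "C + \<delta> / 2 > 0" using pair.Q.C_nonneg pair.\<delta>_pos by (intro add_nonneg_pos) auto
    have \<rho>: "\<rho> > 0" using C\<delta> a_bounds \<kappa> c0 by (simp add: \<rho>_def)
    define T where "T = ln (\<eta> / (2 * exp \<sigma>)) / \<kappa>"
    show ?thesis
    proof (rule exI[of _ \<rho>], rule conjI[OF \<rho>], rule exI[of _ T], intro allI impI)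
      fix t s assume t: "t \<le> T" and xs: "x s \<le> m t + 1"
      define e where "e = exp (\<kappa> * t)"
      have e_pos: "e > 0" by (simp add: e_def)
      have "\<kappa> * t \<le> ln (\<eta> / (2 * exp \<sigma>))" using t \<kappa> by (simp add: T_def field_simps)
      then have "e \<le> \<eta> / (2 * exp \<sigma>)" unfolding e_def using pair.\<eta>_pos
        by (metis divide_pos_pos exp_gt_zero exp_le_cancel_iff exp_ln mult_pos_pos zero_less_numeral)
      then have e_le: "e * exp \<sigma> \<le> \<eta> / 2" by (simp add: field_simps)
      define E where "E = tilt \<kappa> \<sigma> s t"
      have E_pos: "E > 0" by (simp add: E_def tilt_pos)
      have "exp (\<sigma> * (x s - m t)) \<le> exp \<sigma>" using xs \<sigma> by (simp add: mult_left_le)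
      then have E_e: "E \<le> (a * exp \<sigma>) * e"
        unfolding E_def tilt_def e_def using a_bounds by (simp add: mult.assoc mult.commute mult_left_mono)
      also have "\<dots> \<le> 1 * (e * exp \<sigma>)" using a_bounds e_pos by (simp add: mult_left_le_one_le mult.commute mult.left_commute)
      finally have E_\<eta>: "E \<le> \<eta> / 2" using e_le by simp
      define y where "y = - x s + cG * t + \<rho> * e"
      have de: "((\<lambda>t. exp (\<kappa> * t)) has_real_derivative \<kappa> * e) (at t)"
        unfolding e_def by (rule DERIV_exp_mult)
      have dy: "((\<lambda>t. - x s + cG * t + \<rho> * exp (\<kappa> * t)) has_real_derivative cG + \<rho> * (\<kappa> * e)) (at t)"
        by (rule DERIV_cong[OF DERIV_add[OF DERIV_add[OF DERIV_const DERIV_cmult[OF DERIV_ident]] DERIV_cmult[OF de]]]) simp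
      have dg: "((\<lambda>t. g s (- x s + cG * t + \<rho> * exp (\<kappa> * t))) has_real_derivative g' s y * (cG + \<rho> * (\<kappa> * e))) (at t)"
        unfolding y_def e_def by (rule DERIV_chain2[OF G.g_deriv dy[unfolded e_def]])
      have dE: "(tilt \<kappa> \<sigma> s has_real_derivative E * (\<kappa> - \<sigma> * ((cG + cP) / 2))) (at t)"
      proof -
        have eq: "tilt \<kappa> \<sigma> s = (\<lambda>t. a * exp (\<kappa> * t + \<sigma> * (x s - (cG + cP) / 2 * t)))"
          by (rule ext) (simp add: tilt_def m_def exp_add)
        have "((\<lambda>t. \<kappa> * t + \<sigma> * (x s - (cG + cP) / 2 * t)) has_real_derivative \<kappa> - \<sigma> * ((cG + cP) / 2)) (at t)"
          by (rule DERIV_cong[OF DERIV_add[OF DERIV_cmult[OF DERIV_ident]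
                DERIV_cmult[OF DERIV_diff[OF DERIV_const DERIV_cmult[OF DERIV_ident]]]]]) simp
        from DERIV_cmult[OF DERIV_chain2[OF DERIV_exp this], of a]
        show ?thesis unfolding eq[symmetric]
          by (rule DERIV_cong) (simp add: E_def eq)
      qed
      define D where "D = g' s y * (cG + \<rho> * (\<kappa> * e)) + E * (\<kappa> - \<sigma> * ((cG + cP) / 2))"
      have "(cap \<kappa> \<sigma> \<rho> s has_real_derivative D) (at t)"
        using DERIV_add[OF dg dE] unfolding cap_def[abs_def] D_def .
      moreover have "rhs (\<lambda>s. cap \<kappa> \<sigma> \<rho> s t) s \<le> D"
      proof -
        have cap: "cap \<kappa> \<sigma> \<rho> s t = g s y + E" by (simp add: cap_def y_def E_def e_def)
        have capk: "cap \<kappa> \<sigma> \<rho> (s - k) t = g (s - k) (y - - x k) + E * exp (- \<sigma> * x k)" for k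
        proof -
          have "tilt \<kappa> \<sigma> (s - k) t = E * exp (- \<sigma> * x k)"
            by (simp add: tilt_def E_def pair.Q.x_diff exp_add[symmetric] algebra_simps)
          then show ?thesis by (simp add: cap_def y_def e_def pair.Q.x_diff algebra_simps)
        qed
        have "(\<Sum>k\<in>S. J k * cap \<kappa> \<sigma> \<rho> (s - k) t)
            = (\<Sum>k\<in>S. J k * g (s - k) (y - - x k)) + E * (\<Sum>k\<in>S. J k * exp (- \<sigma> * x k))"
          unfolding capk by (simp add: distrib_left sum.distrib sum_distrib_left mult.left_commute)
        also have "(\<Sum>k\<in>S. J k * g (s - k) (y - - x k)) = cG * g' s y + g s y - f s (g s y)"
          using G.g_eq[of s y] by simp
        finally have JA: "(\<Sum>k\<in>S. J k * cap \<kappa> \<sigma> \<rho> (s - k) t)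
            = cG * g' s y + g s y - f s (g s y) + E * (\<Sum>k\<in>S. J k * exp (- \<sigma> * x k))" .
        have diff: "D - rhs (\<lambda>s. cap \<kappa> \<sigma> \<rho> s t) s = \<rho> * \<kappa> * e * g' s y + E * \<kappa> - E * F \<sigma> - (f s (g s y + E) - f s (g s y))"
          unfolding rhs_def JA cap D_def F_def by (simp add: algebra_simps)
        have EF: "E * F \<sigma> \<le> E * (\<delta> / 2)" using \<sigma> E_pos by (intro mult_left_mono) auto
        have E\<kappa>: "E * \<kappa> \<ge> 0" using E_pos \<kappa> by simp
        have S0: "\<rho> * \<kappa> * e * g' s y \<ge> 0" using \<rho> \<kappa> e_pos G.g'_nonneg[of s y] by simp
        have g01: "0 \<le> g s y" "g s y \<le> 1" by (rule G.g_nonneg G.g_le)+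
        consider "y \<le> - M" | "y \<ge> M" | "\<bar>y\<bar> \<le> M" by linarith
        then have "f s (g s y + E) - f s (g s y) \<le> \<rho> * \<kappa> * e * g' s y - E * (\<delta> / 2)"
        proof cases
          case 1
          have "f s (g s y + E) - f s (g s y) \<le> - \<delta> * (g s y + E - g s y)"
          proof (rule deriv_le_imp_diff_le[OF f_deriv])
            fix u assume "g s y \<le> u" "u \<le> g s y + E"
            then show "f' s u \<le> - \<delta>" using M(1)[OF 1, of s] E_\<eta> g01 by (intro f_stable) auto
          qed (use E_pos in simp)
          moreover have "E * \<delta> \<ge> E * (\<delta> / 2)" using E_pos pair.\<delta>_pos by simp
          ultimately show ?thesis using S0 by (simp add: mult.commute)
        next
          case 2
          have "f s (g s y + E) - f s (g s y) \<le> - \<delta> * (g s y + E - g s y)"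
          proof (rule deriv_le_imp_diff_le[OF f_deriv])
            fix u assume "g s y \<le> u" "u \<le> g s y + E"
            then show "f' s u \<le> - \<delta>" using M(2)[OF 2, of s] E_\<eta> g01 pair.\<eta>_pos by (intro f_stable_1) auto
          qed (use E_pos in simp)
          moreover have "E * \<delta> \<ge> E * (\<delta> / 2)" using E_pos pair.\<delta>_pos by simp
          ultimately show ?thesis using S0 by (simp add: mult.commute)
        next
          case 3
          have "f s (g s y + E) - f s (g s y) \<le> C * (g s y + E - g s y)"
          proof (rule deriv_le_imp_diff_le[OF f_deriv])
            fix u assume "g s y \<le> u" "u \<le> g s y + E"
            then show "f' s u \<le> C"
              using f'_bound[of u s] E_\<eta> g01 pair.\<eta>_le a_bounds by (simp add: abs_le_iff)
          qed (use E_pos in simp)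
          then have 1: "f s (g s y + E) - f s (g s y) \<le> C * E" by simp
          have "(C + \<delta> / 2) * E \<le> (C + \<delta> / 2) * ((a * exp \<sigma>) * e)"
            using E_e C\<delta> by (intro mult_left_mono) auto
          also have "\<dots> = \<rho> * \<kappa> * e * c0" using \<kappa> c0 by (simp add: \<rho>_def)
          also have "\<dots> \<le> \<rho> * \<kappa> * e * g' s y" using c0(2)[OF 3, of s] \<rho> \<kappa> e_pos by (intro mult_left_mono) auto
          finally have "(C + \<delta> / 2) * E \<le> \<rho> * \<kappa> * e * g' s y" .
          moreover have "(C + \<delta> / 2) * E = C * E + E * (\<delta> / 2)" by (simp add: algebra_simps)
          ultimately show ?thesis using 1 by linarith
        qed
        then show ?thesis using diff EF E\<kappa> by linarith
      qed
      ultimately show "super_at (cap \<kappa> \<sigma> \<rho>) s t"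
        unfolding super_at_def by blast
    qed
  qed
  then show ?thesis using \<sigma> by blast
qed

text \<open>This wave moves with the speed of \<open>m\<close>, faster than the front \<open>a - P\<close> from which it is built;
  the gain absorbs the error of lifting the limit \<open>a\<close> on the right to \<open>a + \<nu>\<close>.\<close>

definition retreat where "retreat \<nu> b s t = a + \<nu> - (1 + 2 * \<nu> / a) * P s (- x s + m t + b)"

text \<open>The factor 1 + 2 * \<nu> / a puts the limit on the left at - \<nu>, below the stable
  state 0. There the reaction helps; near a the lift by \<nu> gains \<delta> * \<nu> because a is
  unstable; in between the excess speed r, multiplied by the slope of the profile, gains a fixed
  amount. No time-dependent correction enters, so all phases and times are covered.\<close>

lemma retreat_subsolution:
  "\<exists>\<nu>>0. \<nu> \<le> (1 - a) / 4 \<and> 2 * \<nu> / a \<le> 1 \<and> (\<forall>b s t. sub_at (retreat \<nu> b) s t)"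
proof -
  note C0 = pair.Q.C_nonneg and \<eta>0 = pair.\<eta>_pos and \<delta>0 = pair.\<delta>_pos
  \<comment> \<open>For p \<le> \<theta> the scaling error, at most 4 * C / a * \<nu> * \<theta>,
    does not exceed the unstable gain \<delta> * \<nu>.\<close>
  define \<theta> where "\<theta> = min (\<eta> / 2) (\<delta> * a / (4 * C + 1))"
  have \<theta>: "\<theta> > 0" "\<theta> \<le> \<eta> / 2" "4 * C * \<theta> \<le> \<delta> * a"
  proof -
    show "\<theta> > 0" using a_bounds C0 \<eta>0 \<delta>0 by (simp add: \<theta>_def)
    show "\<theta> \<le> \<eta> / 2" unfolding \<theta>_def by (rule min.cobounded1)
    have "4 * C * \<theta> \<le> (4 * C + 1) * (\<delta> * a / (4 * C + 1))"
      using C0 \<open>\<theta> > 0\<close> by (intro mult_mono) (auto simp: \<theta>_def)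
    then show "4 * C * \<theta> \<le> \<delta> * a" using C0 by simp
  qed
  obtain M where M: "\<And>s y. y \<le> - M \<Longrightarrow> P s y \<le> \<theta> / 2" "\<And>s y. y \<ge> M \<Longrightarrow> a - \<theta> / 2 \<le> P s y"
    using pair.P.uniform_limits[of "\<theta> / 2"] \<theta> by auto
  obtain c0 where c0: "c0 > 0" "\<And>s y. \<bar>y\<bar> \<le> M \<Longrightarrow> P' s y \<ge> c0"
    using pair.P.g'_lower_bound[OF pair.cP_pos, of M] by blast
  define r where "r = (cG - cP) / 2"
  have r: "r > 0" using cG_gt by (simp add: r_def)
  define A where "A = 4 * C / a + C + 1"
  have A: "A > 0" using C0 a_bounds by (simp add: A_def add_nonneg_pos)
  \<comment> \<open>The last entry makes the total error A * \<nu> in the intermediate range at most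
    r * c0, the gain from the excess speed.\<close>
  define \<nu> where "\<nu> = Min {(1 - a) / 4, \<eta>, a / 2, r * c0 / A}"
  have \<nu>: "\<nu> > 0" using a_bounds \<eta>0 r c0 A unfolding \<nu>_def by (subst Min_gr_iff) auto
  have \<nu>_le: "\<nu> \<le> (1 - a) / 4" "\<nu> \<le> \<eta>" "\<nu> \<le> a / 2" "\<nu> \<le> r * c0 / A" unfolding \<nu>_def by (rule Min_le; simp)+
  define c where "c = 2 * \<nu> / a"
  have c: "0 < c" "c \<le> 1" using \<nu> \<nu>_le a_bounds by (auto simp: c_def)
  have h0: "f s (a + 0) = 0" for s using pair.Q.h_0 by simp
  have main: "(1 + c) * f s (a + - P s y) - f s (a + (\<nu> - (1 + c) * P s y)) \<le> (1 + c) * r * P' s y" for s y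
  proof -
    define p where "p = P s y"
    have p: "0 \<le> p" "p \<le> a" "p \<le> 1" using pair.P.g_nonneg[of s y] pair.P.g_le[of s y] a_bounds by (auto simp: p_def)
    have S0: "(1 + c) * r * P' s y \<ge> 0" using c r pair.P.g'_nonneg[of s y] by simp
    have sc: "\<bar>f s (a + (1 + c) * (- p)) - (1 + c) * f s (a + - p)\<bar> \<le> 2 * C * \<bar>c\<bar> * (- p)\<^sup>2"
      by (rule scaling_error[OF pair.Q.h_deriv pair.lip3 h0 _ _ C0]) (use c p in auto)
    have cp2: "2 * C * c * p\<^sup>2 \<le> 4 * C / a * \<nu> * p"
    proof -
      have "2 * C * c * p\<^sup>2 \<le> 2 * C * c * p"
        using p C0 c by (intro mult_left_mono) (auto simp: power2_eq_square mult_left_le_one_le)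
      then show ?thesis by (simp add: c_def mult.assoc)
    qed
    have sc2: "(1 + c) * f s (a + - p) \<le> f s (a + - ((1 + c) * p)) + 4 * C / a * \<nu> * p"
      using sc cp2 c by simp
    consider "p \<ge> a - \<eta> / 2" | "p \<le> \<theta>" | "\<theta> < p" "p < a - \<eta> / 2" by linarith
    then show ?thesis
    proof cases
      case 1
      have cp: "\<nu> \<le> c * p" "c * p \<le> 2 * \<nu>"
      proof -
        have "a / 2 \<le> p" using 1 pair.\<eta>_le \<eta>0 a_bounds by linarith
        then have "c * (a / 2) \<le> c * p" using c by (intro mult_left_mono) auto
        then show "\<nu> \<le> c * p" using a_bounds by (simp add: c_def)
        have "c * p \<le> c * a" using p c by (intro mult_left_mono) auto
        then show "c * p \<le> 2 * \<nu>" using a_bounds by (simp add: c_def)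
      qed
      have "f s (a - p) - f s (a - p - (c * p - \<nu>)) \<le> - \<delta> * (a - p - (a - p - (c * p - \<nu>)))"
        by (rule deriv_le_imp_diff_le[OF f_deriv]) (use cp 1 p \<nu>_le in \<open>auto intro!: f_stable\<close>)
      moreover have "\<delta> * (c * p - \<nu>) \<ge> 0" using cp \<delta>0 by simp
      ultimately have 2: "f s (a - p) \<le> f s (a - p - (c * p - \<nu>))" by simp
      have "f s (a + - p) \<le> 0" using p by (intro pair.h_nonpos) auto
      then have "c * f s (a + - p) \<le> 0" using c by (simp add: mult_nonneg_nonpos)
      moreover have eq: "a - p - (c * p - \<nu>) = a + (\<nu> - (1 + c) * p)" by (simp add: algebra_simps)
      have "f s (a + - p) \<le> f s (a + (\<nu> - (1 + c) * p))" using 2 unfolding eq by simp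
      moreover have "(1 + c) * f s (a + - p) = f s (a + - p) + c * f s (a + - p)"
        by (simp only: distrib_right mult_1)
      ultimately show ?thesis using S0 unfolding p_def[symmetric] by linarith
    next
      case 2
      have cp: "0 \<le> (1 + c) * p" "(1 + c) * p \<le> \<eta>"
        using mult_mono[of "1 + c" 2 p "\<eta> / 2"] 2 \<theta> c p by auto
      have "(- f s (a + (\<nu> - (1 + c) * p))) - (- f s (a + - ((1 + c) * p))) \<le> - \<delta> * ((\<nu> - (1 + c) * p) - - ((1 + c) * p))"
        by (rule deriv_le_imp_diff_le[of "\<lambda>w. - f s (a + w)" "\<lambda>w. - f' s (a + w)"])
           (use cp \<nu> \<nu>_le in \<open>auto intro!: DERIV_minus pair.Q.h_deriv pair.unstable\<close>)
      then have 3: "f s (a + - ((1 + c) * p)) + \<delta> * \<nu> \<le> f s (a + (\<nu> - (1 + c) * p))" by simp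
      have "4 * C / a * \<nu> * p \<le> 4 * C / a * \<nu> * \<theta>" using 2 C0 a_bounds \<nu> by (intro mult_left_mono) auto
      also have "\<dots> = (4 * C * \<theta>) * (\<nu> / a)" by simp
      also have "\<dots> \<le> (\<delta> * a) * (\<nu> / a)" using \<theta> \<nu> a_bounds by (intro mult_right_mono) auto
      also have "\<dots> = \<delta> * \<nu>" using a_bounds by simp
      finally show ?thesis using sc2 3 S0 unfolding p_def[symmetric] by linarith
    next
      case 3
      have "\<not> y \<le> - M" using M(1)[of y s] 3 \<theta> by (auto simp: p_def)
      moreover have "\<not> y \<ge> M" using M(2)[of y s] 3 \<theta> \<eta>0 by (auto simp: p_def)
      ultimately have P': "P' s y \<ge> c0" by (intro c0) auto
      have cp: "0 \<le> (1 + c) * p" "(1 + c) * p \<le> 2" using mult_mono[of "1 + c" 2 p 1] c p by auto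
      have "(- f s (a + (\<nu> - (1 + c) * p))) - (- f s (a + - ((1 + c) * p))) \<le> C * ((\<nu> - (1 + c) * p) - - ((1 + c) * p))"
      proof (rule deriv_le_imp_diff_le[of "\<lambda>w. - f s (a + w)" "\<lambda>w. - f' s (a + w)"])
        fix u assume "- ((1 + c) * p) \<le> u" "u \<le> \<nu> - (1 + c) * p"
        then have "\<bar>u\<bar> \<le> 3" using cp \<nu> \<nu>_le a_bounds by (auto simp: abs_le_iff)
        then show "- f' s (a + u) \<le> C" using pair.bd3[of u s] by (simp add: abs_le_iff)
      qed (use \<nu> in \<open>auto intro!: DERIV_minus pair.Q.h_deriv\<close>)
      then have 4: "f s (a + - ((1 + c) * p)) - C * \<nu> \<le> f s (a + (\<nu> - (1 + c) * p))" by simp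
      have "4 * C / a * \<nu> * p \<le> 4 * C / a * \<nu> * 1" using p C0 a_bounds \<nu> by (intro mult_left_mono) auto
      then have "4 * C / a * \<nu> * p + C * \<nu> \<le> A * \<nu>" using \<nu> by (simp add: A_def algebra_simps)
      also have "\<dots> \<le> A * (r * c0 / A)" using \<nu>_le A by (intro mult_left_mono) auto
      also have "\<dots> = 1 * r * c0" using A by simp
      also have "\<dots> \<le> (1 + c) * r * P' s y" using P' c r c0 by (intro mult_mono) auto
      finally show ?thesis using sc2 4 unfolding p_def[symmetric] by linarith
    qed
  qed
  have "sub_at (retreat \<nu> b) s t" for b s t
  proof -
    define y where "y = - x s + m t + b"
    have dy: "((\<lambda>t. - x s + m t + b) has_real_derivative (cG + cP) / 2) (at t)"
      unfolding m_def
      by (rule DERIV_cong[OF DERIV_add[OF DERIV_add[OF DERIV_const DERIV_cmult[OF DERIV_ident]] DERIV_const]]) simp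
    define D where "D = 0 - (1 + c) * (P' s y * ((cG + cP) / 2))"
    have "(retreat \<nu> b s has_real_derivative D) (at t)"
      using DERIV_diff[OF DERIV_const DERIV_cmult[OF DERIV_chain2[OF pair.P.g_deriv dy]]]
      unfolding retreat_def[abs_def] D_def y_def c_def .
    moreover have "D \<le> rhs (\<lambda>s. retreat \<nu> b s t) s"
    proof -
      have w: "retreat \<nu> b s t = a - ((1 + c) * P s (- x s + m t + b) - \<nu>)" for s
        by (simp add: retreat_def c_def)
      have sh: "- x (s - k) + m t + b = y - - x k" for k by (simp add: y_def pair.Q.x_diff)
      have "(\<Sum>k\<in>S. J k * ((1 + c) * P (s - k) (- x (s - k) + m t + b) - \<nu>))
          = (\<Sum>k\<in>S. (1 + c) * (J k * P (s - k) (y - - x k)) - J k * \<nu>)"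
        unfolding sh by (intro sum.cong refl) (simp add: right_diff_distrib mult.left_commute)
      also have "\<dots> = (1 + c) * (\<Sum>k\<in>S. J k * P (s - k) (y - - x k)) - \<nu>"
        by (simp add: sum_subtractf sum_distrib_left[symmetric] sum_distrib_right[symmetric] sum_J)
      also have "(\<Sum>k\<in>S. J k * P (s - k) (y - - x k)) = cP * P' s y + P s y + f s (a + - P s y)"
        using pair.P.g_eq[of s y] by simp
      finally have JP: "(\<Sum>k\<in>S. J k * ((1 + c) * P (s - k) (- x (s - k) + m t + b) - \<nu>))
        = (1 + c) * (cP * P' s y + P s y + f s (a + - P s y)) - \<nu>" .
      have "rhs (\<lambda>s. retreat \<nu> b s t) s - D = (1 + c) * r * P' s y
          - ((1 + c) * f s (a + - P s y) - f s (a + (\<nu> - (1 + c) * P s y)))"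
        unfolding w rhs_offset_minus JP D_def y_def[symmetric] r_def by (simp add: field_simps)
      then show ?thesis using main[of s y] by linarith
    qed
    ultimately show ?thesis unfolding sub_at_def by blast
  qed
  then show ?thesis using \<nu> \<nu>_le c unfolding c_def by blast
qed

text \<open>Seen from m, the first two fronts recede linearly at speed r and the third even faster,
  so their tails near m are O(e^2) for \<kappa> \<le> l * r / 2. The margins by \<open>R0\<close>
  cover the sites that interact with the unit neighbourhood of m.\<close>

lemma separation:
  "\<exists>\<kappa>1>0. \<forall>\<kappa>. 0 < \<kappa> \<and> \<kappa> \<le> \<kappa>1 \<longrightarrow> (\<forall>(K::real) (\<rho>::real). 0 \<le> K \<and> 0 \<le> \<rho> \<longrightarrow> (\<exists>H>0. \<forall>t\<le>0. \<forall>s.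
     (x s \<le> m t + 1 + pair.Q.R0 \<longrightarrow> Q s (x s + cQ * t + K * exp (\<kappa> * t)) \<le> H * (exp (\<kappa> * t))\<^sup>2 \<and>
        a - P s (- x s + cP * t - K * exp (\<kappa> * t)) \<le> H * (exp (\<kappa> * t))\<^sup>2) \<and>
     (x s \<ge> m t - 1 - pair.Q.R0 \<longrightarrow> g s (- x s + cG * t + \<rho> * exp (\<kappa> * t)) \<le> H * (exp (\<kappa> * t))\<^sup>2)))"
proof -
  define R where "R = pair.Q.R0"
  obtain K1 l1 where 1: "K1 > 0" "l1 > 0" "\<And>s y. Q s y \<le> K1 * exp (l1 * y)"
    using pair.Q_decay by blast
  obtain K2 l2 where 2: "K2 > 0" "l2 > 0" "\<And>s y. a - P s (- y) \<le> K2 * exp (l2 * y)"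
    using left_decay by blast
  have "\<exists>K>0. \<exists>lam>0. \<forall>s y. g s y \<le> K * exp (lam * y)"
  proof (rule G.exp_decay[of "- 1" \<delta> \<eta>])
    fix s w assume w: "0 \<le> w" "w \<le> \<eta>"
    have "f s w - f s 0 \<le> - \<delta> * (w - 0)"
      by (rule deriv_le_imp_diff_le[OF f_deriv]) (use w in \<open>auto intro!: f_stable\<close>)
    then show "- 1 * f s w \<ge> \<delta> * w" by (simp add: f_0)
  qed (use pair.\<delta>_pos pair.\<eta>_pos in auto)
  then obtain K3 l3 where 3: "K3 > 0" "l3 > 0" "\<And>s y. g s y \<le> K3 * exp (l3 * y)" by blast
  define r where "r = (cG - cP) / 2"
  have r: "r > 0" using cG_gt by (simp add: r_def)
  define l where "l = min l1 (min l2 l3)"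
  have l: "l > 0" "l \<le> l1" "l \<le> l2" "l \<le> l3" using 1 2 3 by (auto simp: l_def)
  define \<kappa>1 where "\<kappa>1 = l * r / 2"
  have \<kappa>1: "\<kappa>1 > 0" using l r by (simp add: \<kappa>1_def)
  have gen: "Kj * exp (lj * y) \<le> Kj * exp (lj * B) * (exp (\<kappa> * t))\<^sup>2"
    if "Kj > 0" "l \<le> lj" "y \<le> r * t + B" "t \<le> 0" "0 < \<kappa>" "\<kappa> \<le> \<kappa>1" for Kj lj y B t \<kappa>
  proof -
    have lj: "lj > 0" using that l by simp
    have "2 * \<kappa> \<le> l * r" using that by (simp add: \<kappa>1_def)
    also have "\<dots> \<le> lj * r" using that r by (intro mult_right_mono) auto
    finally have "2 * \<kappa> \<le> lj * r" .
    then have "lj * r * t \<le> 2 * \<kappa> * t" using that by (simp add: mult_right_mono_neg)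
    then have "lj * y \<le> lj * B + 2 * (\<kappa> * t)"
      using mult_left_mono[OF that(3), of lj] lj by (simp add: algebra_simps)
    then have "exp (lj * y) \<le> exp (lj * B + 2 * (\<kappa> * t))" by simp
    also have "\<dots> = exp (lj * B) * (exp (\<kappa> * t))\<^sup>2" by (simp add: exp_add exp_double)
    finally show ?thesis using that by simp
  qed
  show ?thesis
  proof (rule exI[of _ \<kappa>1], rule conjI[OF \<kappa>1], intro allI impI)
    fix \<kappa> K \<rho> :: real assume \<kappa>: "0 < \<kappa> \<and> \<kappa> \<le> \<kappa>1" and K\<rho>: "0 \<le> K \<and> 0 \<le> \<rho>"
    define H1 where "H1 = K1 * exp (l1 * (1 + R + K))"
    define H2 where "H2 = K2 * exp (l2 * (1 + R + K))"
    define H3 where "H3 = K3 * exp (l3 * (1 + R + \<rho>))"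
    define H where "H = H1 + H2 + H3"
    have Hj: "H1 > 0" "H2 > 0" "H3 > 0" using 1 2 3 by (auto simp: H1_def H2_def H3_def)
    have H: "H > 0" "H1 \<le> H" "H2 \<le> H" "H3 \<le> H" using Hj by (auto simp: H_def)
    show "\<exists>H>0. \<forall>t\<le>0. \<forall>s.
     (x s \<le> m t + 1 + pair.Q.R0 \<longrightarrow> Q s (x s + cQ * t + K * exp (\<kappa> * t)) \<le> H * (exp (\<kappa> * t))\<^sup>2 \<and>
        a - P s (- x s + cP * t - K * exp (\<kappa> * t)) \<le> H * (exp (\<kappa> * t))\<^sup>2) \<and>
     (x s \<ge> m t - 1 - pair.Q.R0 \<longrightarrow> g s (- x s + cG * t + \<rho> * exp (\<kappa> * t)) \<le> H * (exp (\<kappa> * t))\<^sup>2)"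
      unfolding R_def[symmetric]
    proof (rule exI[of _ H], rule conjI[OF H(1)], intro allI impI)
      fix t s assume t: "t \<le> (0::real)"
      define e where "e = exp (\<kappa> * t)"
      have e1: "0 < e" "e \<le> 1" using \<kappa> t by (auto simp: e_def mult_le_0_iff)
      have Ke: "K * e \<le> K" "\<rho> * e \<le> \<rho>" using K\<rho> e1 by (simp_all add: mult_left_le)
      have up: "Hj * e\<^sup>2 \<le> H * e\<^sup>2" if "Hj \<le> H" for Hj using that by (intro mult_right_mono) auto
      have mt: "m t = r * t + cP * t" by (simp add: m_def r_def field_simps)
      have A: "Q s (x s + cQ * t + K * e) \<le> H * e\<^sup>2 \<and> a - P s (- x s + cP * t - K * e) \<le> H * e\<^sup>2"
        if xs: "x s \<le> m t + 1 + R"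
      proof
        have "cP * t \<le> 0" "cQ * t \<le> 0" using t pair.cP_pos pair.cQ_pos by (auto simp: mult_le_0_iff)
        then have "x s + cQ * t + K * e \<le> r * t + (1 + R + K)" using xs mt Ke by linarith
        then have "K1 * exp (l1 * (x s + cQ * t + K * e)) \<le> H1 * e\<^sup>2"
          unfolding H1_def e_def using 1 l t \<kappa> by (intro gen) auto
        then show "Q s (x s + cQ * t + K * e) \<le> H * e\<^sup>2"
          using 1(3)[of s "x s + cQ * t + K * e"] up[OF H(2)] by linarith
        have "x s - cP * t + K * e \<le> r * t + (1 + R + K)" using xs mt Ke by linarith
        then have "K2 * exp (l2 * (x s - cP * t + K * e)) \<le> H2 * e\<^sup>2"
          unfolding H2_def e_def using 2 l t \<kappa> by (intro gen) auto
        moreover have eq: "- x s + cP * t - K * e = - (x s - cP * t + K * e)" by simp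
        ultimately show "a - P s (- x s + cP * t - K * e) \<le> H * e\<^sup>2"
          unfolding eq using 2(3)[of s "x s - cP * t + K * e"] up[OF H(3)] by linarith
      qed
      have B: "g s (- x s + cG * t + \<rho> * e) \<le> H * e\<^sup>2" if xs: "x s \<ge> m t - 1 - R"
      proof -
        have "cG * t - m t = r * t" by (simp add: m_def r_def field_simps)
        then have "- x s + cG * t + \<rho> * e \<le> r * t + (1 + R + \<rho>)" using xs Ke by linarith
        then have "K3 * exp (l3 * (- x s + cG * t + \<rho> * e)) \<le> H3 * e\<^sup>2"
          unfolding H3_def e_def using 3 l t \<kappa> by (intro gen) auto
        then show ?thesis using 3(3)[of s "- x s + cG * t + \<rho> * e"] up[OF H(4)] by linarith
      qed
      show "(x s \<le> m t + 1 + R \<longrightarrow> Q s (x s + cQ * t + K * exp (\<kappa> * t)) \<le> H * (exp (\<kappa> * t))\<^sup>2 \<and>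
          a - P s (- x s + cP * t - K * exp (\<kappa> * t)) \<le> H * (exp (\<kappa> * t))\<^sup>2) \<and>
        (x s \<ge> m t - 1 - R \<longrightarrow> g s (- x s + cG * t + \<rho> * exp (\<kappa> * t)) \<le> H * (exp (\<kappa> * t))\<^sup>2)"
        using A B unfolding e_def by blast
    qed
  qed
qed

section \<open>Explicit forms, bounds and order of the super- and subsolution\<close>

lemma upper_eq:
  "upper \<kappa> K s t = a + (1 + exp (\<kappa> * t)) * Q s (x s + cQ * t + K * exp (\<kappa> * t))
     - (1 - exp (\<kappa> * t)) * P s (- x s + cP * t - K * exp (\<kappa> * t))"
  by (simp add: upper_def pair.W_def)

lemma lower_eq:
  "lower \<kappa> K s t = a + (1 - exp (\<kappa> * t)) * Q s (x s + cQ * t - K * exp (\<kappa> * t))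
     - (1 + exp (\<kappa> * t)) * P s (- x s + cP * t + K * exp (\<kappa> * t))"
  by (simp add: lower_def flip.W_def)

lemma upper_bounds:
  assumes "0 < \<kappa>" "t \<le> 0"
  shows "a * exp (\<kappa> * t) \<le> upper \<kappa> K s t" "upper \<kappa> K s t \<le> 2"
proof -
  define e where "e = exp (\<kappa> * t)"
  have e: "0 < e" "e \<le> 1" using assms by (auto simp: e_def mult_le_0_iff)
  define q where "q = Q s (x s + cQ * t + K * e)"
  define p where "p = P s (- x s + cP * t - K * e)"
  have q: "0 \<le> q" "q \<le> 1 - a" and p: "0 \<le> p" "p \<le> a"
    by (simp_all add: q_def p_def pair.Q.g_nonneg pair.Q.g_le pair.P.g_nonneg pair.P.g_le)
  have "(1 - e) * p \<le> (1 - e) * a" "0 \<le> (1 - e) * p" using e p by (auto intro: mult_left_mono)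
  moreover have "0 \<le> (1 + e) * q" "(1 + e) * q \<le> 2 * (1 - a)"
    using mult_mono[of "1 + e" 2 q "1 - a"] e q by auto
  ultimately show "a * exp (\<kappa> * t) \<le> upper \<kappa> K s t" "upper \<kappa> K s t \<le> 2"
    unfolding upper_eq e_def[symmetric] q_def[symmetric] p_def[symmetric]
    using a_bounds by (auto simp: algebra_simps)
qed

lemma lower_bounds:
  assumes "0 < \<kappa>" "t \<le> 0"
  shows "- 1 \<le> lower \<kappa> K s t" "lower \<kappa> K s t \<le> 1"
proof -
  define e where "e = exp (\<kappa> * t)"
  have e: "0 < e" "e \<le> 1" using assms by (auto simp: e_def mult_le_0_iff)
  define q where "q = Q s (x s + cQ * t - K * e)"
  define p where "p = P s (- x s + cP * t + K * e)"
  have q: "0 \<le> q" "q \<le> 1 - a" and p: "0 \<le> p" "p \<le> a"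
    by (simp_all add: q_def p_def pair.Q.g_nonneg pair.Q.g_le pair.P.g_nonneg pair.P.g_le)
  have "(1 - e) * q \<le> 1 * (1 - a)" "0 \<le> (1 - e) * q"
    using mult_mono[of "1 - e" 1 q "1 - a"] e q by auto
  moreover have "0 \<le> (1 + e) * p" "(1 + e) * p \<le> 2 * a"
    using mult_mono[of "1 + e" 2 p a] e p by auto
  ultimately show "- 1 \<le> lower \<kappa> K s t" "lower \<kappa> K s t \<le> 1"
    unfolding lower_eq e_def[symmetric] q_def[symmetric] p_def[symmetric]
    using a_bounds by (auto simp: algebra_simps)
qed

lemma lower_le_upper:
  assumes "0 < \<kappa>" "t \<le> 0" "0 \<le> K1" "0 \<le> K2"
  shows "lower \<kappa> K2 s t \<le> upper \<kappa> K1 s t"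
proof -
  define e where "e = exp (\<kappa> * t)"
  have e: "0 < e" "e \<le> 1" using assms by (auto simp: e_def mult_le_0_iff)
  have K: "0 \<le> K1 * e" "0 \<le> K2 * e" using assms e by auto
  have "(1 - e) * Q s (x s + cQ * t - K2 * e) \<le> (1 + e) * Q s (x s + cQ * t + K1 * e)"
    using e K by (intro mult_mono pair.Q.g_mono pair.Q.g_nonneg) auto
  moreover have "(1 - e) * P s (- x s + cP * t - K1 * e) \<le> (1 + e) * P s (- x s + cP * t + K2 * e)"
    using e K by (intro mult_mono pair.P.g_mono pair.P.g_nonneg) auto
  ultimately show ?thesis unfolding lower_eq upper_eq e_def[symmetric] by linarith
qed

text \<open>Supplies the linear comparison equation y' = \<gamma> * (1 - y), whose spatially
  constant solutions are subsolutions that approach 1 exponentially. Near 1 the stable slope gives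
  the bound, elsewhere compactness does.\<close>

lemma f_lower_linear:
  assumes y0: "a < y0" "y0 < 1"
  shows "\<exists>\<gamma>>0. \<forall>s y. y0 \<le> y \<and> y \<le> 1 \<longrightarrow> \<gamma> * (1 - y) \<le> f s y"
proof -
  have "\<exists>\<gamma>>0. \<forall>v\<in>range f. \<forall>y. y0 \<le> y \<and> y \<le> 1 \<longrightarrow> \<gamma> * (1 - y) \<le> v y"
  proof (rule finite_uniform_small[OF finite_range_f])
    fix v assume "v \<in> range f"
    then obtain s where v: "v = f s" by blast
    have near: "\<delta> * (1 - y) \<le> f s y" if "1 - \<eta> \<le> y" "y \<le> 1" for y
    proof -
      have "f s 1 - f s y \<le> - \<delta> * (1 - y)"
        by (rule deriv_le_imp_diff_le[OF f_deriv]) (use that in \<open>auto intro!: f_stable_1\<close>)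
      then show ?thesis by (simp add: f_1)
    qed
    have pos: "f s y > 0" if "a < y" "y < 1" for y
      using pair.h_pos[of "y - a" s] that by simp
    have "\<exists>\<mu>>0. \<forall>y. y0 \<le> y \<and> y \<le> 1 - \<eta> \<longrightarrow> \<mu> \<le> f s y"
    proof (cases "y0 \<le> 1 - \<eta>")
      case True
      then have "\<exists>z\<in>{y0..1 - \<eta>}. \<forall>y\<in>{y0..1 - \<eta>}. f s z \<le> f s y"
        by (intro continuous_attains_inf continuous_at_imp_continuous_on ballI f_isCont) auto
      then obtain z where z: "z \<in> {y0..1 - \<eta>}" "\<forall>y\<in>{y0..1 - \<eta>}. f s z \<le> f s y" by blast
      then show ?thesis using pos[of z] y0 pair.\<eta>_pos by (intro exI[of _ "f s z"]) auto
    next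
      case False
      then show ?thesis by (intro exI[of _ 1]) auto
    qed
    then obtain \<mu> where \<mu>: "\<mu> > 0" "\<And>y. y0 \<le> y \<Longrightarrow> y \<le> 1 - \<eta> \<Longrightarrow> \<mu> \<le> f s y" by blast
    show "\<exists>e>0. \<forall>e'. 0 < e' \<and> e' \<le> e \<longrightarrow> (\<forall>y. y0 \<le> y \<and> y \<le> 1 \<longrightarrow> e' * (1 - y) \<le> v y)"
    proof (rule exI[of _ "min \<delta> \<mu>"], intro conjI allI impI)
      show "0 < min \<delta> \<mu>" using \<mu> pair.\<delta>_pos by simp
      fix e' y assume e': "0 < e' \<and> e' \<le> min \<delta> \<mu>" and y: "y0 \<le> y \<and> y \<le> 1"
      show "e' * (1 - y) \<le> v y"
      proof (cases "y \<le> 1 - \<eta>")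
        case True
        have "e' * (1 - y) \<le> \<mu> * 1" using e' y y0 a_bounds by (intro mult_mono) auto
        then show ?thesis using \<mu>(2)[of y] True y v by simp
      next
        case False
        have "e' * (1 - y) \<le> \<delta> * (1 - y)" using e' y by (intro mult_right_mono) auto
        then show ?thesis using near[of y] False y v by simp
      qed
    qed
  qed
  then show ?thesis by blast
qed

text \<open>Collects what the two limits require: bounds from both sides for early times and
  exponential convergence to 1. The upper bounds are divided at m, while the lower bounds hold at
  all sites.\<close>

theorem merging_solution:
  obtains U \<kappa> K1 K2 \<sigma> \<rho> t0 where "0 < \<kappa>" "0 \<le> K1" "0 \<le> K2" "0 < \<sigma>" "0 \<le> \<rho>" "t0 \<le> (0::real)"
    "\<And>s t. (U s has_real_derivative rhs (\<lambda>s. U s t) s) (at t)"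
    "\<And>s t. 0 \<le> U s t" "\<And>s t. U s t \<le> 1"
    "\<And>s t. g s (- x s + cG * t) \<le> U s t"
    "\<And>s t. t \<le> t0 \<Longrightarrow> lower \<kappa> K2 s t \<le> U s t"
    "\<And>s t. t \<le> t0 \<Longrightarrow> x s \<le> m t \<Longrightarrow> U s t \<le> cap \<kappa> \<sigma> \<rho> s t"
    "\<And>s t. t \<le> t0 \<Longrightarrow> m t \<le> x s \<Longrightarrow> U s t \<le> upper \<kappa> K1 s t"
    "\<exists>\<gamma>>0. \<exists>c t1. \<forall>s t. t \<ge> t1 \<longrightarrow> 1 - c * exp (- \<gamma> * t) \<le> U s t"
proof -
  define R where "R = pair.Q.R0"
  have R: "R \<ge> 0" unfolding R_def by (rule pair.Q.R0_nonneg)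
  have xk: "\<bar>x k\<bar> \<le> R" if "k \<in> S" for k unfolding R_def by (rule pair.Q.x_le_R0[OF that])
  obtain \<kappa>u where \<kappa>u0: "\<kappa>u > 0" and \<kappa>u: "\<forall>\<kappa>. 0 < \<kappa> \<and> \<kappa> \<le> \<kappa>u \<longrightarrow> (\<exists>K>0. \<exists>T. \<forall>t\<le>T. \<forall>s. super_at (upper \<kappa> K) s t)"
    by (rule exE[OF upper_supersolution], erule conjE) (rule that)
  obtain \<kappa>l where \<kappa>l0: "\<kappa>l > 0" and \<kappa>l: "\<forall>\<kappa>. 0 < \<kappa> \<and> \<kappa> \<le> \<kappa>l \<longrightarrow> (\<exists>K>0. \<exists>T. \<forall>t\<le>T. \<forall>s. sub_at (lower \<kappa> K) s t)"
    by (rule exE[OF lower_subsolution], erule conjE) (rule that)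
  obtain \<sigma> where \<sigma>: "\<sigma> > 0" and cap_ex: "\<forall>\<kappa>>0. \<exists>\<rho>>0. \<exists>T. \<forall>t\<le>T. \<forall>s. x s \<le> m t + 1 \<longrightarrow> super_at (cap \<kappa> \<sigma> \<rho>) s t"
    by (rule exE[OF cap_supersolution], erule conjE) (rule that)
  obtain \<kappa>1 where \<kappa>10: "\<kappa>1 > 0" and \<kappa>1: "\<forall>\<kappa>. 0 < \<kappa> \<and> \<kappa> \<le> \<kappa>1 \<longrightarrow> (\<forall>K \<rho>. 0 \<le> K \<and> 0 \<le> \<rho> \<longrightarrow> (\<exists>H>0. \<forall>t\<le>0. \<forall>s.
     (x s \<le> m t + 1 + pair.Q.R0 \<longrightarrow> Q s (x s + cQ * t + K * exp (\<kappa> * t)) \<le> H * (exp (\<kappa> * t))\<^sup>2 \<and>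
        a - P s (- x s + cP * t - K * exp (\<kappa> * t)) \<le> H * (exp (\<kappa> * t))\<^sup>2) \<and>
     (x s \<ge> m t - 1 - pair.Q.R0 \<longrightarrow> g s (- x s + cG * t + \<rho> * exp (\<kappa> * t)) \<le> H * (exp (\<kappa> * t))\<^sup>2)))"
    by (rule exE[OF separation], erule conjE) (rule that)
  define \<kappa> where "\<kappa> = min \<kappa>u (min \<kappa>l \<kappa>1)"
  have \<kappa>: "\<kappa> > 0" "\<kappa> \<le> \<kappa>u" "\<kappa> \<le> \<kappa>l" "\<kappa> \<le> \<kappa>1" using \<kappa>u0 \<kappa>l0 \<kappa>10 by (simp_all add: \<kappa>_def)
  obtain K1 T1 where K1: "K1 > 0" and up: "\<And>s t. t \<le> T1 \<Longrightarrow> super_at (upper \<kappa> K1) s t"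
    using \<kappa>u[rule_format, OF conjI[OF \<kappa>(1,2)]] by blast
  obtain K2 T2 where K2: "K2 > 0" and low: "\<And>s t. t \<le> T2 \<Longrightarrow> sub_at (lower \<kappa> K2) s t"
    using \<kappa>l[rule_format, OF conjI[OF \<kappa>(1,3)]] by blast
  obtain \<rho> T3 where \<rho>: "\<rho> > 0" and capd: "\<And>s t. t \<le> T3 \<Longrightarrow> x s \<le> m t + 1 \<Longrightarrow> super_at (cap \<kappa> \<sigma> \<rho>) s t"
    using cap_ex[rule_format, OF \<kappa>(1)] by blast
  obtain H where H: "H > 0" and
    sepQ: "\<And>s t. t \<le> 0 \<Longrightarrow> x s \<le> m t + 1 + R \<Longrightarrow> Q s (x s + cQ * t + K1 * exp (\<kappa> * t)) \<le> H * (exp (\<kappa> * t))\<^sup>2" and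
    sepP: "\<And>s t. t \<le> 0 \<Longrightarrow> x s \<le> m t + 1 + R \<Longrightarrow> a - P s (- x s + cP * t - K1 * exp (\<kappa> * t)) \<le> H * (exp (\<kappa> * t))\<^sup>2" and
    sepG: "\<And>s t. t \<le> 0 \<Longrightarrow> x s \<ge> m t - 1 - R \<Longrightarrow> g s (- x s + cG * t + \<rho> * exp (\<kappa> * t)) \<le> H * (exp (\<kappa> * t))\<^sup>2"
    using \<kappa>1[rule_format, OF conjI[OF \<kappa>(1,4)] conjI[OF less_imp_le[OF K1] less_imp_le[OF \<rho>]]]
    unfolding R_def by blast
  \<comment> \<open>The second and third entries separate \<open>upper\<close> from
    \<open>cap\<close> one unit to the right and to the left of m. The fourth makes
    \<open>lower\<close> nonpositive left of m + 1 and \<open>g\<close> at most \<open>upper\<close>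
    right of m - 1. The last keeps the added term of \<open>cap\<close> at most 1.\<close>
  define e0 where "e0 = Min {1 / 2, a * (exp \<sigma> - 1) / (3 * H), a * (1 - exp (- \<sigma>)) / H, a / (4 * H), 1 / exp \<sigma>}"
  have e0: "e0 > 0" using a_bounds H \<sigma> unfolding e0_def by (subst Min_gr_iff) auto
  have e0_le: "e0 \<le> 1 / 2" "e0 \<le> a * (exp \<sigma> - 1) / (3 * H)" "e0 \<le> a * (1 - exp (- \<sigma>)) / H" "e0 \<le> a / (4 * H)" "e0 \<le> 1 / exp \<sigma>"
    unfolding e0_def by (rule Min_le; simp)+
  define t0 where "t0 = Min {0, T1, T2, T3, ln e0 / \<kappa>}"
  have t0: "t0 \<le> 0" "t0 \<le> T1" "t0 \<le> T2" "t0 \<le> T3" "t0 \<le> ln e0 / \<kappa>"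
    unfolding t0_def by (rule Min_le; simp)+
  have e: "0 < exp (\<kappa> * t)" "exp (\<kappa> * t) \<le> 1 / 2" "3 * H * exp (\<kappa> * t) \<le> a * (exp \<sigma> - 1)"
    "H * exp (\<kappa> * t) \<le> a * (1 - exp (- \<sigma>))" "4 * H * exp (\<kappa> * t) \<le> a" "exp (\<kappa> * t) * exp \<sigma> \<le> 1" if "t \<le> t0" for t
  proof -
    have "t \<le> ln e0 / \<kappa>" using that t0 by linarith
    then have "\<kappa> * t \<le> ln e0" using \<kappa> by (simp add: field_simps)
    then have le: "exp (\<kappa> * t) \<le> e0" using e0 by (metis exp_le_cancel_iff exp_ln)
    show "0 < exp (\<kappa> * t)" by simp
    show "exp (\<kappa> * t) \<le> 1 / 2" using le e0_le by linarith
    show "3 * H * exp (\<kappa> * t) \<le> a * (exp \<sigma> - 1)" using order_trans[OF le e0_le(2)] H by (simp add: field_simps)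
    show "H * exp (\<kappa> * t) \<le> a * (1 - exp (- \<sigma>))" using order_trans[OF le e0_le(3)] H by (simp add: field_simps)
    show "4 * H * exp (\<kappa> * t) \<le> a" using order_trans[OF le e0_le(4)] H by (simp add: field_simps)
    show "exp (\<kappa> * t) * exp \<sigma> \<le> 1" using order_trans[OF le e0_le(5)] by (simp add: field_simps)
  qed
  have ee: "H * (exp (\<kappa> * t))\<^sup>2 = (H * exp (\<kappa> * t)) * exp (\<kappa> * t)" for t by (simp add: power2_eq_square)
  have tilt_le: "tilt \<kappa> \<sigma> s t \<le> a * exp (\<kappa> * t) * exp (\<sigma> * d)" if "x s - m t \<le> d" for s t d
    unfolding tilt_def using that \<sigma> a_bounds by (intro mult_left_mono) auto
  have tilt_ge: "tilt \<kappa> \<sigma> s t \<ge> a * exp (\<kappa> * t) * exp (\<sigma> * d)" if "x s - m t \<ge> d" for s t d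
    unfolding tilt_def using that \<sigma> a_bounds by (intro mult_left_mono) auto
  \<comment> \<open>In this strip \<open>upper\<close> exceeds a * e by at most 3 * H * e^2, whereas
    the added term of \<open>cap\<close> is at least a * e * exp \<sigma>.\<close>
  have upper_le_cap: "upper \<kappa> K1 s t \<le> cap \<kappa> \<sigma> \<rho> s t"
    if t: "t \<le> t0" and xs: "m t + 1 \<le> x s" "x s \<le> m t + 1 + R" for s t
  proof -
    have t00: "t \<le> 0" using t t0 by linarith
    define E where "E = exp (\<kappa> * t)"
    define q where "q = Q s (x s + cQ * t + K1 * E)"
    define p where "p = P s (- x s + cP * t - K1 * E)"
    have q: "q \<le> H * E\<^sup>2" "0 \<le> q" and p: "a - p \<le> H * E\<^sup>2" "p \<le> a"
      using sepQ[OF t00 xs(2)] sepP[OF t00 xs(2)] by (simp_all add: q_def p_def E_def pair.Q.g_nonneg pair.P.g_le)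
    have E: "0 < E" "E \<le> 1 / 2" using e(1,2)[OF t] unfolding E_def by blast+
    have "(1 + E) * q \<le> 2 * (H * E\<^sup>2)" using E q by (intro mult_mono) auto
    moreover have "(1 - E) * (a - p) \<le> 1 * (H * E\<^sup>2)" using E p by (intro mult_mono) auto
    moreover have "upper \<kappa> K1 s t = E * a + (1 - E) * (a - p) + (1 + E) * q"
      by (simp add: upper_eq q_def p_def E_def algebra_simps)
    ultimately have "upper \<kappa> K1 s t \<le> E * a + (3 * H * E) * E" by (simp add: power2_eq_square)
    also have "\<dots> \<le> E * a + (a * (exp \<sigma> - 1)) * E"
      using e(3)[OF t] by (intro add_left_mono mult_right_mono) (auto simp: E_def)
    also have "\<dots> = a * E * exp (\<sigma> * 1)" by (simp add: algebra_simps)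
    also have "\<dots> \<le> tilt \<kappa> \<sigma> s t" unfolding E_def using xs by (intro tilt_ge) simp
    also have "\<dots> \<le> cap \<kappa> \<sigma> \<rho> s t" by (simp add: cap_def G.g_nonneg)
    finally show ?thesis .
  qed
  have cap_le_upper: "cap \<kappa> \<sigma> \<rho> s t \<le> upper \<kappa> K1 s t"
    if t: "t \<le> t0" and xs: "m t - 1 - R \<le> x s" "x s \<le> m t - 1" for s t
  proof -
    have t00: "t \<le> 0" using t t0 by linarith
    define E where "E = exp (\<kappa> * t)"
    have "cap \<kappa> \<sigma> \<rho> s t \<le> (H * E) * E + a * E * exp (\<sigma> * (- 1))"
      unfolding cap_def E_def using sepG[OF t00 xs(1)] tilt_le[of s t "- 1"] xs(2) unfolding ee by (intro add_mono) auto
    also have "\<dots> \<le> (a * (1 - exp (- \<sigma>))) * E + a * E * exp (\<sigma> * (- 1))"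
      using e(4)[OF t] by (intro add_right_mono mult_right_mono) (auto simp: E_def)
    also have "\<dots> = a * E" by (simp add: algebra_simps)
    also have "\<dots> \<le> upper \<kappa> K1 s t" unfolding E_def by (rule upper_bounds[OF \<kappa>(1) t00])
    finally show ?thesis .
  qed
  have g_le_upper: "g s (- x s + cG * t) \<le> upper \<kappa> K1 s t" if t: "t \<le> t0" and xs: "m t - 1 \<le> x s" for s t
  proof -
    have t00: "t \<le> 0" using t t0 by linarith
    define E where "E = exp (\<kappa> * t)"
    have "g s (- x s + cG * t) \<le> g s (- x s + cG * t + \<rho> * E)"
      by (rule G.g_mono) (use \<rho> in \<open>simp add: E_def\<close>)
    also have "\<dots> \<le> (H * E) * E" using sepG[OF t00, of s] xs R unfolding ee E_def by simp
    also have "\<dots> \<le> a * E"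
    proof (rule mult_right_mono)
      have "0 \<le> H * E" using H by (simp add: E_def)
      then show "H * E \<le> a" using e(5)[OF t] unfolding E_def by linarith
    qed (simp add: E_def)
    also have "\<dots> \<le> upper \<kappa> K1 s t" unfolding E_def by (rule upper_bounds[OF \<kappa>(1) t00])
    finally show ?thesis .
  qed
  have lower_le_cap: "lower \<kappa> K2 s t \<le> cap \<kappa> \<sigma> \<rho> s t" if t: "t \<le> t0" and xs: "x s \<le> m t + 1" for s t
  proof -
    have t00: "t \<le> 0" using t t0 by linarith
    define E where "E = exp (\<kappa> * t)"
    have E: "0 < E" "E \<le> 1" using e(1,2)[OF t] unfolding E_def by linarith+
    \<comment> \<open>The tail bounds are available for the shift \<open>K1\<close>; by monotonicity
      these values also control the profiles with the opposite shift \<open>K2\<close>.\<close>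
    define q where "q = Q s (x s + cQ * t + K1 * E)"
    define p where "p = P s (- x s + cP * t - K1 * E)"
    have xs': "x s \<le> m t + 1 + R" using xs R by simp
    have q: "q \<le> H * E\<^sup>2" "0 \<le> q" and p: "a - p \<le> H * E\<^sup>2" "p \<le> a" "0 \<le> p"
      using sepQ[OF t00 xs'] sepP[OF t00 xs'] by (simp_all add: q_def p_def E_def pair.Q.g_nonneg pair.P.g_le pair.P.g_nonneg)
    have K: "0 \<le> K1 * E" "0 \<le> K2 * E" using K1 K2 E by auto
    have "Q s (x s + cQ * t - K2 * E) \<le> q" unfolding q_def using K by (intro pair.Q.g_mono) simp
    then have "(1 - E) * Q s (x s + cQ * t - K2 * E) \<le> 1 * q"
      using E by (intro mult_mono) (auto simp: pair.Q.g_nonneg)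
    moreover have "p \<le> P s (- x s + cP * t + K2 * E)" unfolding p_def using K by (intro pair.P.g_mono) simp
    then have "(1 + E) * p \<le> (1 + E) * P s (- x s + cP * t + K2 * E)" using E by (intro mult_left_mono) auto
    ultimately have "lower \<kappa> K2 s t \<le> a + q - (1 + E) * p"
      unfolding lower_eq E_def[symmetric] by linarith
    also have "\<dots> = (1 + E) * (a - p) + q - a * E" by (simp add: algebra_simps)
    also have "\<dots> \<le> 2 * (H * E\<^sup>2) + H * E\<^sup>2 - a * E"
    proof -
      have "(1 + E) * (a - p) \<le> 2 * (H * E\<^sup>2)" using E p by (intro mult_mono) auto
      then show ?thesis using q by linarith
    qed
    also have "\<dots> = (3 * H * E - a) * E" by (simp add: power2_eq_square algebra_simps)
    also have "\<dots> \<le> 0"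
    proof -
      have "3 * H * E \<le> 4 * H * E" using H E by simp
      then have "3 * H * E - a \<le> 0" using e(5)[OF t] by (simp add: E_def)
      then show ?thesis using E by (simp add: mult_nonpos_nonneg)
    qed
    also have "0 \<le> cap \<kappa> \<sigma> \<rho> s t" using tilt_pos[of \<kappa> \<sigma> s t] by (simp add: cap_def G.g_nonneg)
    finally show ?thesis .
  qed
  have g_le_cap: "g s (- x s + cG * t) \<le> cap \<kappa> \<sigma> \<rho> s t" for s t
  proof -
    have "g s (- x s + cG * t) \<le> g s (- x s + cG * t + \<rho> * exp (\<kappa> * t))"
      by (rule G.g_mono) (use \<rho> in simp)
    then show ?thesis using tilt_pos[of \<kappa> \<sigma> s t] by (simp add: cap_def)
  qed
  obtain \<nu> where \<nu>: "\<nu> > 0" "\<nu> \<le> (1 - a) / 4" "2 * \<nu> / a \<le> 1" and ret: "\<And>b s t. sub_at (retreat \<nu> b) s t"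
    using retreat_subsolution by blast
  have \<nu>4: "4 * \<nu> \<le> 1 - a" using \<nu>(2) by (simp add: field_simps)
  then have \<nu>a: "a + \<nu> \<le> 1" using \<nu>(1) a_bounds by linarith
  have ret_le: "retreat \<nu> b s t \<le> a + \<nu>" and ret_ge: "- 3 \<le> retreat \<nu> b s t" for b s t
  proof -
    define p where "p = P s (- x s + m t + b)"
    have p: "0 \<le> p" "p \<le> a" by (simp_all add: p_def pair.P.g_nonneg pair.P.g_le)
    have c: "0 \<le> 2 * \<nu> / a" using \<nu> a_bounds by simp
    have "(1 + 2 * \<nu> / a) * p \<le> 2 * a" using c \<nu> p a_bounds by (intro mult_mono) auto
    moreover have "0 \<le> (1 + 2 * \<nu> / a) * p" using c p by simp
    ultimately show "retreat \<nu> b s t \<le> a + \<nu>" "- 3 \<le> retreat \<nu> b s t"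
      using \<nu>(1) \<nu>4 a_bounds unfolding retreat_def p_def[symmetric] by linarith+
  qed
  obtain MQ where MQ: "\<And>s y. y \<ge> MQ \<Longrightarrow> 1 - a - (1 - a) / 4 \<le> Q s y"
    using pair.Q.uniform_limits[of "(1 - a) / 4"] a_bounds by auto
  obtain MP where MP: "\<And>s y. y \<le> - MP \<Longrightarrow> P s y \<le> (1 - a) / 12"
    using pair.P.uniform_limits[of "(1 - a) / 12"] a_bounds by auto
  define E0 where "E0 = exp (\<kappa> * t0)"
  have E0: "0 < E0" "E0 \<le> 1 / 2" using e(1,2)[OF order_refl] unfolding E0_def by blast+
  \<comment> \<open>To the right of this point \<open>lower\<close> has reached a + \<nu> at time
    \<open>t0\<close>; to the left of it the phase b below makes the retreating wave nonpositive. So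
    the wave can take over at \<open>t0\<close> without rising above \<open>g\<close> and
    \<open>lower\<close>.\<close>
  define X0 where "X0 = max (MQ - cQ * t0 + K2 * E0) (MP + cP * t0 + K2 * E0)"
  have right: "a + \<nu> \<le> lower \<kappa> K2 s t0" if "X0 \<le> x s" for s
  proof -
    have "MQ \<le> x s + cQ * t0 - K2 * E0" "- x s + cP * t0 + K2 * E0 \<le> - MP"
      using that by (auto simp: X0_def)
    then have p: "P s (- x s + cP * t0 + K2 * E0) \<le> (1 - a) / 12"
      and q0: "1 - a - (1 - a) / 4 \<le> Q s (x s + cQ * t0 - K2 * E0)"
      using MQ MP by blast+
    have q: "3 / 4 * (1 - a) \<le> Q s (x s + cQ * t0 - K2 * E0)" using q0 by (simp add: field_simps)
    define A where "A = (1 - E0) * Q s (x s + cQ * t0 - K2 * E0)"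
    define B where "B = (1 + E0) * P s (- x s + cP * t0 + K2 * E0)"
    have "1 / 2 * (3 / 4 * (1 - a)) \<le> A"
      unfolding A_def using E0 q a_bounds by (intro mult_mono) auto
    then have A: "3 - 3 * a \<le> 8 * A" by simp
    have "B \<le> 3 / 2 * ((1 - a) / 12)"
      unfolding B_def using E0 p a_bounds by (intro mult_mono) (simp_all add: pair.P.g_nonneg)
    then have B: "8 * B \<le> 1 - a" by simp
    have "lower \<kappa> K2 s t0 = a + A - B" by (simp add: lower_eq A_def B_def E0_def)
    then show ?thesis using \<nu>4 A B by linarith
  qed
  obtain MP2 where MP2: "\<And>s y. y \<ge> MP2 \<Longrightarrow> a - \<nu> / 2 \<le> P s y"
    using pair.P.uniform_limits[of "\<nu> / 2"] \<nu> by auto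
  define b where "b = MP2 + X0 - m t0"
  have left: "retreat \<nu> b s t0 \<le> 0" if "x s \<le> X0" for s
  proof -
    have "a - \<nu> / 2 \<le> P s (- x s + m t0 + b)" by (rule MP2) (use that in \<open>simp add: b_def\<close>)
    then have "(1 + 2 * \<nu> / a) * (a - \<nu> / 2) \<le> (1 + 2 * \<nu> / a) * P s (- x s + m t0 + b)"
      using \<nu> a_bounds by (intro mult_left_mono) auto
    moreover have "(1 + 2 * \<nu> / a) * (a - \<nu> / 2) = a + 2 * \<nu> - (1 + 2 * \<nu> / a) * (\<nu> / 2)"
      using a_bounds by (simp add: field_simps)
    moreover have "(1 + 2 * \<nu> / a) * (\<nu> / 2) \<le> 2 * (\<nu> / 2)" using \<nu> by (intro mult_right_mono) auto
    ultimately show ?thesis unfolding retreat_def by linarith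
  qed
  have ret_start: "retreat \<nu> b s t0 \<le> max (g s (- x s + cG * t0)) (lower \<kappa> K2 s t0)" for s
    using left[of s] right[of s] ret_le[of b s t0] G.g_nonneg[of s "- x s + cG * t0"]
    by (cases "x s \<le> X0") auto
  define y0 where "y0 = a + \<nu> / 2"
  have y0: "a < y0" "y0 < 1" "0 < y0" using \<nu> \<nu>a a_bounds by (auto simp: y0_def)
  obtain \<gamma> where \<gamma>: "\<gamma> > 0" "\<And>s y. y0 \<le> y \<Longrightarrow> y \<le> 1 \<Longrightarrow> \<gamma> * (1 - y) \<le> f s y"
    using f_lower_linear[OF y0(1,2)] by blast
  obtain MG where MG: "\<And>s y. y \<ge> MG \<Longrightarrow> 1 - (1 - y0) \<le> g s y"
    using G.uniform_limits[of "1 - y0"] y0 by auto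
  obtain MP3 where MP3: "\<And>s y. y \<le> - MP3 \<Longrightarrow> P s y \<le> \<nu> / 4"
    using pair.P.uniform_limits[of "\<nu> / 4"] \<nu> by auto
  define r where "r = (cG - cP) / 2"
  have r: "r > 0" using cG_gt by (simp add: r_def)
  \<comment> \<open>\<open>g\<close> advances relative to the retreating wave at speed r. At this
    time the two zones overlap: each site is either behind \<open>g\<close>, with value at least
    \<open>y0\<close>, or far enough into the raised part of the wave.\<close>
  define t1 where "t1 = max (t0 + 1) ((MG + b + MP3) / r)"
  have t1: "t0 < t1" "MG + b + MP3 \<le> r * t1"
  proof -
    show "t0 < t1" by (simp add: t1_def)
    have "(MG + b + MP3) / r \<le> t1" by (simp add: t1_def)
    then show "MG + b + MP3 \<le> r * t1" using r by (simp add: field_simps)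
  qed
  have y0_start: "y0 \<le> max (g s (- x s + cG * t1)) (retreat \<nu> b s t1)" for s
  proof (cases "- x s + cG * t1 \<ge> MG")
    case True
    then show ?thesis using MG[OF True, of s] by simp
  next
    case False
    have "cG * t1 - m t1 = r * t1" by (simp add: m_def r_def field_simps)
    then have "- x s + m t1 + b \<le> - MP3" using False t1 by linarith
    then have "P s (- x s + m t1 + b) \<le> \<nu> / 4" by (rule MP3)
    then have "(1 + 2 * \<nu> / a) * P s (- x s + m t1 + b) \<le> 2 * (\<nu> / 4)"
      using \<nu> by (intro mult_mono) (auto simp: pair.P.g_nonneg)
    then have "y0 \<le> retreat \<nu> b s t1" unfolding retreat_def y0_def by simp
    then show ?thesis by simp
  qed
  define Y where "Y = (\<lambda>t. 1 - (1 - y0) * exp (- \<gamma> * (t - t1)))"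
  \<comment> \<open>The value 0 before \<open>t1\<close> is a filler, dominated by g \<ge> 0. The
    pieces need not agree at \<open>t0\<close> and \<open>t1\<close>: at each switch the new piece
    starts below the maximum of pieces already known to lie below \<open>relax L\<close>.\<close>
  define L where "L = (\<lambda>s t. max (g s (- x s + cG * t))
    (if t \<le> t0 then lower \<kappa> K2 s t else max (retreat \<nu> b s t) (if t < t1 then 0 else Y t)))"
  have gL: "g s (- x s + cG * t) \<le> L s t" for s t by (simp add: L_def)
  have lowL: "lower \<kappa> K2 s t \<le> L s t" if "t \<le> t0" for s t using that by (simp add: L_def)
  have retL: "retreat \<nu> b s t \<le> L s t" if "t0 \<le> t" for s t
    using that ret_start[of s] by (cases "t = t0") (auto simp: L_def)
  have YL: "Y t \<le> L s t" if "t1 \<le> t" for s t using that t1 by (simp add: L_def)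
  have g01: "0 \<le> g s y" "g s y \<le> 1" for s y by (rule G.g_nonneg G.g_le)+
  have L_adm: "admissible L"
    unfolding admissible_def
  proof (intro conjI allI)
    fix s
    have [measurable]: "g s \<in> borel_measurable borel" "Q s \<in> borel_measurable borel" "P s \<in> borel_measurable borel"
      by (intro borel_measurable_continuous_onI G.g_cont pair.Q.g_cont pair.P.g_cont)+
    show "L s \<in> borel_measurable borel"
      unfolding L_def lower_eq retreat_def m_def Y_def by measurable
    fix t
    show "0 \<le> L s t" using g01(1) gL order_trans by blast
    have "lower \<kappa> K2 s t \<le> 1" if "t \<le> t0" using that t0 lower_bounds(2)[OF \<kappa>(1), of t] by simp
    moreover have "retreat \<nu> b s t \<le> 1" using ret_le[of b s t] \<nu>a by linarith
    moreover have "Y t \<le> 1" using y0 by (simp add: Y_def)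
    ultimately show "L s t \<le> 1" using g01(2) by (simp add: L_def)
  qed
  have g_sol: "((\<lambda>t. g s (- x s + cG * t)) has_real_derivative rhs (\<lambda>s. g s (- x s + cG * t)) s) (at t)" for s t
  proof -
    have "((\<lambda>t. - x s + cG * t) has_real_derivative cG) (at t)"
      by (rule DERIV_cong[OF DERIV_add[OF DERIV_const DERIV_cmult[OF DERIV_ident]]]) simp
    from DERIV_chain2[OF G.g_deriv this]
    have "((\<lambda>t. g s (- x s + cG * t)) has_real_derivative g' s (- x s + cG * t) * cG) (at t)" .
    moreover have "g' s (- x s + cG * t) * cG = rhs (\<lambda>s. g s (- x s + cG * t)) s"
    proof -
      have sh: "- x (s - k) + cG * t = - x s + cG * t - - x k" for k by (simp add: pair.Q.x_diff)
      show ?thesis unfolding rhs_def sh using G.g_eq[of s "- x s + cG * t"] by (simp add: mult.commute)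
    qed
    ultimately show ?thesis by simp
  qed
  have g_relax: "g s (- x s + cG * t) \<le> relax L s t" for s t
  proof (rule subsolution_le_relax[OF L_adm, of t "\<lambda>s t. g s (- x s + cG * t)"])
    fix r
    show "sub_at (\<lambda>s t. g s (- x s + cG * t)) s r" unfolding sub_at_def using g_sol by blast
    show "g s (- x s + cG * r) \<le> L s r" for s by (rule gL)
    show "- 3 \<le> g s (- x s + cG * r)" using g01(1)[of s "- x s + cG * r"] by simp
  qed
  have low_relax: "lower \<kappa> K2 s t \<le> relax L s t" if t: "t \<le> t0" for s t
  proof (rule subsolution_le_relax[OF L_adm])
    fix r assume r: "r \<le> t"
    show "sub_at (lower \<kappa> K2) s r"
      using r t t0 by (intro low) simp
    show "lower \<kappa> K2 s r \<le> L s r" for s using r t by (intro lowL) simp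
    show "- 3 \<le> lower \<kappa> K2 s r" using lower_bounds(1)[OF \<kappa>(1), of r K2 s] r t t0 by simp
  qed
  have ret_relax: "retreat \<nu> b s t \<le> relax L s t" if t: "t0 \<le> t" for s t
  proof (rule le_of_exp_mult)
    show "exp (rate * t) * (retreat \<nu> b s t - relax L s t) \<le> exp (rate * t0) * (retreat \<nu> b s t0 - relax L s t0)"
      by (rule subsolution_le_relax_from[OF L_adm t ret]) (rule retL ret_ge; assumption)+
    show "retreat \<nu> b s t0 - relax L s t0 \<le> 0"
      using ret_start[of s] g_relax[of s t0] low_relax[of t0 s] by auto
  qed
  have Y_relax: "Y t \<le> relax L s t" if t: "t1 \<le> t" for s t
  proof (rule le_of_exp_mult)
    have Yd: "sub_at (\<lambda>s. Y) s r" and Y3: "- 3 \<le> Y r" if r: "t1 \<le> r" for r s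
    proof -
      have "((\<lambda>t. - \<gamma> * (t - t1)) has_real_derivative - \<gamma>) (at r)"
        by (rule DERIV_cong[OF DERIV_cmult[OF DERIV_diff[OF DERIV_ident DERIV_const]]]) simp
      from DERIV_diff[OF DERIV_const DERIV_cmult[OF DERIV_chain2[OF DERIV_exp this]]]
      have "(Y has_real_derivative 0 - (1 - y0) * (exp (- \<gamma> * (r - t1)) * - \<gamma>)) (at r)" unfolding Y_def .
      moreover have "0 - (1 - y0) * (exp (- \<gamma> * (r - t1)) * - \<gamma>) = \<gamma> * (1 - Y r)" by (simp add: Y_def)
      ultimately have dY: "(Y has_real_derivative \<gamma> * (1 - Y r)) (at r)" by (simp only:)
      have "exp (- \<gamma> * (r - t1)) \<le> 1" using r \<gamma> by (simp add: mult_nonneg_nonneg)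
      then have le: "(1 - y0) * exp (- \<gamma> * (r - t1)) \<le> 1 - y0" using y0 by (intro mult_left_le) auto
      have ge: "0 \<le> (1 - y0) * exp (- \<gamma> * (r - t1))" using y0 by simp
      have Yr: "y0 \<le> Y r" "Y r \<le> 1" unfolding Y_def using le ge by linarith+
      have "rhs (\<lambda>s. Y r) s = f s (Y r)" by (simp add: rhs_def sum_distrib_right[symmetric] sum_J)
      then show "sub_at (\<lambda>s. Y) s r"
        unfolding sub_at_def using dY \<gamma>(2)[OF Yr, of s] by auto
      show "- 3 \<le> Y r" using Yr y0 by simp
    qed
    show "exp (rate * t) * (Y t - relax L s t) \<le> exp (rate * t1) * (Y t1 - relax L s t1)"
      by (rule subsolution_le_relax_from[OF L_adm t, of "\<lambda>s. Y"]) (rule Yd YL Y3; assumption)+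
    have "Y t1 = y0" by (simp add: Y_def)
    then show "Y t1 - relax L s t1 \<le> 0"
      using y0_start[of s] g_relax[of s t1] ret_relax[of t1 s] t1 by auto
  qed
  have sub: "L s t \<le> relax L s t" for s t
  proof -
    have "0 \<le> relax L s t" by (rule admissibleD(2)[OF relax_admissible[OF L_adm]])
    then show ?thesis
      using g_relax[of s t] low_relax[of t s] ret_relax[of t s] Y_relax[of t s] by (auto simp: L_def)
  qed
  obtain U where U: "\<And>s t. (U s has_real_derivative rhs (\<lambda>s. U s t) s) (at t)"
    "\<And>s t. 0 \<le> U s t" "\<And>s t. U s t \<le> 1" "\<And>s t. L s t \<le> U s t"
    and lim: "\<And>s t. (\<lambda>n. (relax ^^ n) L s t) \<longlonglongrightarrow> U s t"
    using entire_solution_above[OF L_adm sub] by blast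
  have m_mono: "m r \<le> m t" if "r \<le> t" for r t
    unfolding m_def using that cG_pos pair.cP_pos by (intro mult_left_mono) auto
  have adm: "admissible ((relax ^^ n) L)" for n
    by (induction n) (simp_all add: L_adm relax_admissible)
  \<comment> \<open>The two bounds are proved on overlapping half-lines. An interacting site beyond
    the end of one half-line lies within \<open>R\<close> of it, where the other bound and the
    crossing of \<open>cap\<close> and \<open>upper\<close> take over; so both go through the
    induction together.\<close>
  have inv: "t \<le> t0 \<Longrightarrow> (x s \<le> m t + 1 \<longrightarrow> (relax ^^ n) L s t \<le> cap \<kappa> \<sigma> \<rho> s t) \<and>
      (m t - 1 \<le> x s \<longrightarrow> (relax ^^ n) L s t \<le> upper \<kappa> K1 s t)" for n s t
  proof (induction n arbitrary: s t)
    case 0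
    have "lower \<kappa> K2 s t \<le> upper \<kappa> K1 s t"
      using 0 t0 K1 K2 \<kappa> by (intro lower_le_upper) auto
    then show ?case
      using 0 g_le_cap[of s t] lower_le_cap[OF 0, of s] g_le_upper[OF 0, of s] by (simp add: L_def)
  next
    case (Suc n)
    define u where "u = (relax ^^ n) L"
    have u: "admissible u" unfolding u_def by (rule adm)
    have IH: "x s \<le> m r + 1 \<Longrightarrow> u s r \<le> cap \<kappa> \<sigma> \<rho> s r" "m r - 1 \<le> x s \<Longrightarrow> u s r \<le> upper \<kappa> K1 s r"
      if "r \<le> t0" for s r using Suc.IH[OF that, of s] by (auto simp: u_def)
    have nb_cap: "u s r \<le> cap \<kappa> \<sigma> \<rho> s r" if "r \<le> t0" "x s \<le> m r + 1 + R" for s r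
      using IH[OF that(1), of s] upper_le_cap[OF that(1), of s] that(2) by (cases "x s \<le> m r + 1") auto
    have nb_upper: "u s r \<le> upper \<kappa> K1 s r" if "r \<le> t0" "m r - 1 - R \<le> x s" for s r
      using IH[OF that(1), of s] cap_le_upper[OF that(1), of s] that(2) by (cases "m r - 1 \<le> x s") auto
    \<comment> \<open>m increases with time, so a site to the right of m - 1 has been there at all
      earlier times, and the comparison over the whole past applies.\<close>
    have B: "relax u s t \<le> upper \<kappa> K1 s t" if t: "t \<le> t0" and xs: "m t - 1 \<le> x s" for s t
    proof (rule relax_le_supersolution[OF u])
      fix r assume r: "r \<le> t"
      have mr: "m r - 1 \<le> x s" using m_mono[OF r] xs by simp
      show "super_at (upper \<kappa> K1) s r"
        using r t t0 by (intro up) simp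
      show "u s r \<le> upper \<kappa> K1 s r" using r t mr by (intro IH(2)) auto
      show "u (s - k) r \<le> upper \<kappa> K1 (s - k) r" if "k \<in> S" for k
        using r t mr xk[OF that] by (intro nb_upper) (auto simp: pair.Q.x_diff abs_le_iff)
      show "upper \<kappa> K1 s r \<le> 3" using upper_bounds(2)[OF \<kappa>(1), of r K1 s] r t t0 by simp
    qed
    have A: "relax u s t \<le> cap \<kappa> \<sigma> \<rho> s t" if t: "t \<le> t0" and xs: "x s \<le> m t + 1" for s t
    proof -
      define mm where "mm = (cG + cP) / 2"
      have mm: "mm > 0" using cG_pos pair.cP_pos by (simp add: mm_def)
      \<comment> \<open>A site left of m + 1 entered this region at the time l with m l = x - 1.
        There the bound by \<open>upper\<close>, just proved, is below \<open>cap\<close> by the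
        crossing and serves as the initial order.\<close>
      define l where "l = (x s - 1) / mm"
      have ml: "m l = x s - 1" using mm by (simp add: m_def mm_def[symmetric] l_def)
      have "x s - 1 \<le> t * mm" using xs by (simp add: m_def mm_def[symmetric] mult.commute)
      then have lt: "l \<le> t" unfolding l_def using mm by (simp only: pos_divide_le_eq)
      show ?thesis
      proof (rule le_of_exp_mult)
        have "exp (rate * l) * (cap \<kappa> \<sigma> \<rho> s l - relax u s l) \<le> exp (rate * t) * (cap \<kappa> \<sigma> \<rho> s t - relax u s t)"
        proof (rule relax_le_supersolution_from[OF u lt])
          fix r assume r: "l \<le> r" "r \<le> t"
          have mr: "x s \<le> m r + 1" using m_mono[OF r(1)] ml by simp
          have rt: "r \<le> t0" using r t by simp
          show "super_at (cap \<kappa> \<sigma> \<rho>) s r"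
            using rt t0 mr by (intro capd) auto
          show "u s r \<le> cap \<kappa> \<sigma> \<rho> s r" by (rule IH(1)[OF rt mr])
          show "u (s - k) r \<le> cap \<kappa> \<sigma> \<rho> (s - k) r" if "k \<in> S" for k
            using rt mr xk[OF that] by (intro nb_cap) (auto simp: pair.Q.x_diff abs_le_iff)
          have "tilt \<kappa> \<sigma> s r \<le> a * exp (\<kappa> * r) * exp (\<sigma> * 1)" using mr by (intro tilt_le) simp
          also have "\<dots> \<le> 1 * (exp (\<kappa> * r) * exp \<sigma>)" using a_bounds by simp
          also have "\<dots> \<le> 1" using e(6)[OF rt] by simp
          finally show "cap \<kappa> \<sigma> \<rho> s r \<le> 3" using g01(2)[of s "- x s + cG * r + \<rho> * exp (\<kappa> * r)"] unfolding cap_def by linarith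
        qed
        then show "exp (rate * t) * (relax u s t - cap \<kappa> \<sigma> \<rho> s t) \<le> exp (rate * l) * (relax u s l - cap \<kappa> \<sigma> \<rho> s l)"
          by (simp add: algebra_simps)
        have lt0: "l \<le> t0" using lt t by simp
        have "relax u s l \<le> upper \<kappa> K1 s l" using ml by (intro B[OF lt0]) simp
        also have "\<dots> \<le> cap \<kappa> \<sigma> \<rho> s l" using ml R by (intro upper_le_cap[OF lt0]) auto
        finally show "relax u s l - cap \<kappa> \<sigma> \<rho> s l \<le> 0" by simp
      qed
    qed
    have eq: "(relax ^^ Suc n) L = relax u" by (simp add: u_def)
    show ?case unfolding eq using A[OF Suc.prems, of s] B[OF Suc.prems, of s] by blast
  qed
  have U_cap: "U s t \<le> cap \<kappa> \<sigma> \<rho> s t" if "t \<le> t0" "x s \<le> m t" for s t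
    by (rule LIMSEQ_le_const2[OF lim]) (use inv[OF that(1), of s] that(2) in auto)
  have U_upper: "U s t \<le> upper \<kappa> K1 s t" if "t \<le> t0" "x s \<ge> m t" for s t
    by (rule LIMSEQ_le_const2[OF lim]) (use inv[OF that(1), of s] that(2) in auto)
  have U_one: "1 - ((1 - y0) * exp (\<gamma> * t1)) * exp (- \<gamma> * t) \<le> U s t" if "t1 \<le> t" for s t
  proof -
    have "Y t = 1 - ((1 - y0) * exp (\<gamma> * t1)) * exp (- \<gamma> * t)"
      by (simp add: Y_def exp_add[symmetric] algebra_simps)
    then show ?thesis using order_trans[OF YL[OF that] U(4)] by simp
  qed
  show ?thesis
  proof (rule that[of \<kappa> K1 K2 \<sigma> \<rho> t0 U])
    show "0 < \<kappa>" "0 \<le> K1" "0 \<le> K2" "0 < \<sigma>" "0 \<le> \<rho>" "t0 \<le> 0"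
      using \<kappa>(1) K1 K2 \<sigma> \<rho> t0(1) by simp_all
    show "(U s has_real_derivative rhs (\<lambda>s. U s t) s) (at t)" "0 \<le> U s t" "U s t \<le> 1" for s t
      by (rule U)+
    show "g s (- x s + cG * t) \<le> U s t" for s t by (rule order_trans[OF gL U(4)])
    show "lower \<kappa> K2 s t \<le> U s t" if "t \<le> t0" for s t by (rule order_trans[OF lowL[OF that] U(4)])
    show "U s t \<le> cap \<kappa> \<sigma> \<rho> s t" if "t \<le> t0" "x s \<le> m t" for s t by (rule U_cap[OF that])
    show "U s t \<le> upper \<kappa> K1 s t" if "t \<le> t0" "m t \<le> x s" for s t by (rule U_upper[OF that])
    show "\<exists>\<gamma>>0. \<exists>c t1. \<forall>s t. t \<ge> t1 \<longrightarrow> 1 - c * exp (- \<gamma> * t) \<le> U s t"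
      using \<gamma>(1) U_one by blast
  qed
qed

text \<open>The bounds squeeze \<open>U\<close> up to shifts and amplitudes of order e, which
  Lipschitz continuity of the profiles absorbs, and up to the tail of the profile that does not
  belong to the zone. The error function is independent of the site, so it bounds the suprema
  directly.\<close>

theorem asymptotics:
  "\<exists>U. (\<forall>s t. (U s has_real_derivative rhs (\<lambda>s. U s t) s) (at t)) \<and>
    (\<forall>s t. 0 \<le> U s t \<and> U s t \<le> 1) \<and>
    (\<exists>err t0. (err \<longlongrightarrow> 0) at_top \<and> (\<forall>s. \<forall>t\<ge>t0. \<bar>U s t - 1\<bar> \<le> err t)) \<and>
    (\<exists>err t0. (err \<longlongrightarrow> 0) at_bot \<and> (\<forall>s. \<forall>t\<le>t0. 0 \<le> err t \<and>
      (x s \<le> (cG + cP) / 2 * t \<longrightarrow> \<bar>U s t - g s (- x s + cG * t)\<bar> \<le> err t) \<and>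
      ((cG + cP) / 2 * t \<le> x s \<and> x s \<le> (cP - cQ) / 2 * t \<longrightarrow> \<bar>U s t - (a - P s (- x s + cP * t))\<bar> \<le> err t) \<and>
      ((cP - cQ) / 2 * t \<le> x s \<longrightarrow> \<bar>U s t - (a + Q s (x s + cQ * t))\<bar> \<le> err t)))"
proof (rule merging_solution)
  fix U \<kappa> K1 K2 \<sigma> \<rho> t0
  assume c: "0 < \<kappa>" "0 \<le> K1" "0 \<le> K2" "0 < \<sigma>" "0 \<le> \<rho>" "t0 \<le> (0::real)"
    and U: "\<And>s t. (U s has_real_derivative rhs (\<lambda>s. U s t) s) (at t)"
    and U01: "\<And>s t. 0 \<le> U s t" "\<And>s t. U s t \<le> 1"
    and U_g: "\<And>s t. g s (- x s + cG * t) \<le> U s t"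
    and U_low: "\<And>s t. t \<le> t0 \<Longrightarrow> lower \<kappa> K2 s t \<le> U s t"
    and U_cap: "\<And>s t. t \<le> t0 \<Longrightarrow> x s \<le> m t \<Longrightarrow> U s t \<le> cap \<kappa> \<sigma> \<rho> s t"
    and U_up: "\<And>s t. t \<le> t0 \<Longrightarrow> m t \<le> x s \<Longrightarrow> U s t \<le> upper \<kappa> K1 s t"
    and U_one: "\<exists>\<gamma>>0. \<exists>c t1. \<forall>s t. t \<ge> t1 \<longrightarrow> 1 - c * exp (- \<gamma> * t) \<le> U s t"
  obtain \<gamma> d t1 where \<gamma>: "\<gamma> > 0" "\<And>s t. t \<ge> t1 \<Longrightarrow> 1 - d * exp (- \<gamma> * t) \<le> U s t"
    using U_one by blast
  have top: "\<exists>err t0. (err \<longlongrightarrow> 0) at_top \<and> (\<forall>s. \<forall>t\<ge>t0. \<bar>U s t - 1\<bar> \<le> err t)"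
  proof (intro exI conjI allI impI)
    have "filterlim (\<lambda>t. - \<gamma> * t) at_bot at_top"
      by (rule filterlim_tendsto_neg_mult_at_bot[OF tendsto_const _ filterlim_ident]) (use \<gamma> in simp)
    then have "((\<lambda>t. exp (- \<gamma> * t)) \<longlongrightarrow> 0) at_top" by (rule filterlim_compose[OF exp_at_bot])
    then show "((\<lambda>t. d * exp (- \<gamma> * t)) \<longlongrightarrow> 0) at_top" by (rule tendsto_mult_right_zero)
    fix s t assume "t1 \<le> t"
    then show "\<bar>U s t - 1\<bar> \<le> d * exp (- \<gamma> * t)" using \<gamma>(2)[of t s] U01(2)[of s t] by (simp add: abs_le_iff)
  qed
  obtain KQ lQ where KQ: "KQ > 0" "lQ > 0" "\<And>s y. Q s y \<le> KQ * exp (lQ * y)" using pair.Q_decay by blast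
  obtain KP lP where KP: "KP > 0" "lP > 0" "\<And>s y. P s y \<le> KP * exp (lP * y)" using pair.P_decay by blast
  define LQ where "LQ = (1 + C) / cQ"
  define LP where "LP = (1 + C) / cP"
  define LG where "LG = (1 + C) / cG"
  have lipQ: "\<bar>Q s y - Q s z\<bar> \<le> LQ * \<bar>y - z\<bar>" for s y z unfolding LQ_def by (rule pair.Q.g_lip[OF pair.cQ_pos])
  have lipP: "\<bar>P s y - P s z\<bar> \<le> LP * \<bar>y - z\<bar>" for s y z unfolding LP_def by (rule pair.P.g_lip[OF pair.cP_pos])
  have lipG: "\<bar>g s y - g s z\<bar> \<le> LG * \<bar>y - z\<bar>" for s y z unfolding LG_def by (rule G.g_lip[OF cG_pos])
  have L0: "LQ \<ge> 0" "LP \<ge> 0" "LG \<ge> 0"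
    using pair.Q.C_nonneg pair.cQ_pos pair.cP_pos cG_pos by (auto simp: LQ_def LP_def LG_def)
  \<comment> \<open>At the boundary x = (cP - cQ) / 2 * t both profile arguments equal w * t, so w
    is the speed at which the foreign profile recedes from the middle and right zones.\<close>
  define w where "w = (cP + cQ) / 2"
  have w: "w > 0" using pair.cQ_pos pair.cP_pos by (simp add: w_def)
  define M where "M = LG * \<rho> + (LP + LQ) * (K1 + K2) + 1"
  \<comment> \<open>The factor 2 bounds the amplitude 1 + e, and exp (lQ * K1) bounds the effect of
    the shift.\<close>
  define DQ where "DQ = 2 * KQ * exp (lQ * K1)"
  define DP where "DP = 2 * KP * exp (lP * K2)"
  define err where "err = (\<lambda>t. M * exp (\<kappa> * t) + DQ * exp (lQ * w * t) + DP * exp (lP * w * t))"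
  have M: "LG * \<rho> + 1 \<le> M" "LP * K1 + 1 \<le> M" "LP * K2 + 1 \<le> M" "LQ * K1 + 1 \<le> M" "LQ * K2 + 1 \<le> M" "0 \<le> M"
    using L0 c by (auto simp: M_def distrib_left distrib_right add_increasing add_increasing2)
  have D0: "DQ \<ge> 0" "DP \<ge> 0" using KQ KP by (auto simp: DQ_def DP_def)
  have "(err \<longlongrightarrow> 0 + 0 + 0) at_bot"
    unfolding err_def using c w KQ KP
    by (intro tendsto_add tendsto_mult_right_zero exp_rate_at_bot) auto
  then have err: "(err \<longlongrightarrow> 0) at_bot" by simp
  have "0 \<le> err t \<and>
      (x s \<le> m t \<longrightarrow> \<bar>U s t - g s (- x s + cG * t)\<bar> \<le> err t) \<and>
      (m t \<le> x s \<and> x s \<le> (cP - cQ) / 2 * t \<longrightarrow> \<bar>U s t - (a - P s (- x s + cP * t))\<bar> \<le> err t) \<and>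
      ((cP - cQ) / 2 * t \<le> x s \<longrightarrow> \<bar>U s t - (a + Q s (x s + cQ * t))\<bar> \<le> err t)" if t: "t \<le> t0" for s t
  proof -
    define e where "e = exp (\<kappa> * t)"
    have e: "0 < e" "e \<le> 1" using c t by (auto simp: e_def mult_le_0_iff)
    define y where "y = - x s + cP * t"
    define z where "z = x s + cQ * t"
    have p1: "0 \<le> P s u" "P s u \<le> 1" and q1: "0 \<le> Q s u" "Q s u \<le> 1" for u
      using pair.P.g_nonneg[of s u] pair.P.g_le[of s u] pair.Q.g_nonneg[of s u] pair.Q.g_le[of s u] a_bounds by auto
    have ep: "0 \<le> e * P s u" "e * P s u \<le> e" "0 \<le> e * Q s u" "e * Q s u \<le> e" for u
      using p1 q1 e by (auto simp: mult_left_le)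
    have sh: "0 \<le> LQ * (K1 * e)" "0 \<le> LQ * (K2 * e)" "0 \<le> LP * (K1 * e)" "0 \<le> LP * (K2 * e)"
      using L0 c e by auto
    have tail0: "0 \<le> DQ * exp (lQ * w * t)" "0 \<le> DP * exp (lP * w * t)" using D0 by auto
    have errM: "M * e \<le> err t" using tail0 by (simp add: err_def e_def)
    have Me: "LG * (\<rho> * e) + e \<le> M * e" "LP * (K1 * e) + e \<le> M * e" "LP * (K2 * e) + e \<le> M * e"
      "LQ * (K1 * e) + e \<le> M * e" "LQ * (K2 * e) + e \<le> M * e"
      using M(1-5)[THEN mult_right_mono[OF _ less_imp_le[OF e(1)]]] by (simp_all add: algebra_simps)
    have low: "a + (1 - e) * Q s (z - K2 * e) - (1 + e) * P s (y + K2 * e) \<le> U s t"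
      using U_low[OF t, of s] unfolding lower_eq y_def z_def e_def .
    have up: "U s t \<le> a + (1 + e) * Q s (z + K1 * e) - (1 - e) * P s (y - K1 * e)" if "m t \<le> x s"
      using U_up[OF t that] unfolding upper_eq y_def z_def e_def .
    have e0: "0 \<le> err t" using errM M e by (meson mult_nonneg_nonneg less_imp_le order_trans)
    have one: "\<bar>U s t - g s (- x s + cG * t)\<bar> \<le> err t" if xs: "x s \<le> m t"
    proof -
      have "U s t \<le> g s (- x s + cG * t + \<rho> * e) + tilt \<kappa> \<sigma> s t"
        using U_cap[OF t xs] unfolding cap_def e_def .
      moreover have "g s (- x s + cG * t + \<rho> * e) - g s (- x s + cG * t) \<le> LG * (\<rho> * e)"
        using lipG[of s "- x s + cG * t + \<rho> * e" "- x s + cG * t"] c e by (simp add: abs_le_iff)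
      moreover have "tilt \<kappa> \<sigma> s t \<le> 1 * e * 1"
        unfolding tilt_def e_def[symmetric] using xs c e a_bounds
        by (intro mult_mono) (auto simp: mult_le_0_iff)
      ultimately show ?thesis using U_g[of s t] Me errM by (simp add: abs_le_iff)
    qed
    have two: "\<bar>U s t - (a - P s y)\<bar> \<le> err t" if xs: "m t \<le> x s" "x s \<le> (cP - cQ) / 2 * t"
    proof -
      have "z + K1 * e \<le> w * t + K1"
      proof -
        have "z \<le> (cP - cQ) / 2 * t + cQ * t" using xs by (simp add: z_def)
        also have "\<dots> = w * t" by (simp add: w_def field_simps)
        finally show ?thesis using c e mult_left_le[of e K1] by linarith
      qed
      then have "exp (lQ * (z + K1 * e)) \<le> exp (lQ * (w * t + K1))" using KQ by simp
      then have "KQ * exp (lQ * (z + K1 * e)) \<le> KQ * exp (lQ * (w * t + K1))" using KQ by simp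
      then have "2 * Q s (z + K1 * e) \<le> 2 * (KQ * exp (lQ * (w * t + K1)))"
        using KQ(3)[of s "z + K1 * e"] by linarith
      also have "\<dots> = DQ * exp (lQ * w * t)" by (simp add: DQ_def distrib_left exp_add algebra_simps)
      finally have Qs: "2 * Q s (z + K1 * e) \<le> DQ * exp (lQ * w * t)" .
      have "U s t - (a - P s y) \<le> (1 + e) * Q s (z + K1 * e) + (P s y - P s (y - K1 * e)) + e * P s (y - K1 * e)"
        using up[OF xs(1)] by (simp add: algebra_simps)
      also have "\<dots> \<le> 2 * Q s (z + K1 * e) + LP * (K1 * e) + e"
      proof -
        have "(1 + e) * Q s (z + K1 * e) \<le> 2 * Q s (z + K1 * e)" using e q1 by (intro mult_right_mono) auto
        moreover have "P s y - P s (y - K1 * e) \<le> LP * (K1 * e)"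
          using lipP[of s y "y - K1 * e"] c e by (simp add: abs_le_iff)
        ultimately show ?thesis using ep(2)[of "y - K1 * e"] by linarith
      qed
      finally have 1: "U s t - (a - P s y) \<le> err t" using Qs Me tail0 by (simp add: err_def e_def)
      have "- (LP * (K2 * e) + e) \<le> U s t - (a - P s y)"
      proof -
        have "0 \<le> (1 - e) * Q s (z - K2 * e)" using e q1 by simp
        moreover have "P s (y + K2 * e) - P s y \<le> LP * (K2 * e)"
          using lipP[of s "y + K2 * e" y] c e by (simp add: abs_le_iff)
        moreover have "(1 + e) * P s (y + K2 * e) = P s (y + K2 * e) + e * P s (y + K2 * e)" by (simp add: distrib_right)
        ultimately show ?thesis using low ep(2)[of "y + K2 * e"] by linarith
      qed
      then show ?thesis using 1 Me errM by (simp add: abs_le_iff)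
    qed
    have three: "\<bar>U s t - (a + Q s z)\<bar> \<le> err t" if xs: "(cP - cQ) / 2 * t \<le> x s"
    proof -
      have t0': "t \<le> 0" using t c by simp
      have mx: "m t \<le> x s"
      proof -
        have "(cG + cP) / 2 * t \<le> (cP - cQ) / 2 * t"
          using t0' cG_pos pair.cQ_pos by (intro mult_right_mono_neg) auto
        then show ?thesis using xs by (simp add: m_def)
      qed
      have "y + K2 * e \<le> w * t + K2"
      proof -
        have "y \<le> - ((cP - cQ) / 2 * t) + cP * t" using xs by (simp add: y_def)
        also have "\<dots> = w * t" by (simp add: w_def field_simps)
        finally show ?thesis using c e mult_left_le[of e K2] by linarith
      qed
      then have "exp (lP * (y + K2 * e)) \<le> exp (lP * (w * t + K2))" using KP by simp
      then have "KP * exp (lP * (y + K2 * e)) \<le> KP * exp (lP * (w * t + K2))" using KP by simp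
      then have "2 * P s (y + K2 * e) \<le> 2 * (KP * exp (lP * (w * t + K2)))"
        using KP(3)[of s "y + K2 * e"] by linarith
      also have "\<dots> = DP * exp (lP * w * t)" by (simp add: DP_def distrib_left exp_add algebra_simps)
      finally have Ps: "2 * P s (y + K2 * e) \<le> DP * exp (lP * w * t)" .
      have "(1 + e) * P s (y + K2 * e) \<le> 2 * P s (y + K2 * e)" using e p1 by (intro mult_right_mono) auto
      moreover have "Q s z - Q s (z - K2 * e) \<le> LQ * (K2 * e)"
        using lipQ[of s z "z - K2 * e"] c e by (simp add: abs_le_iff)
      moreover have "(1 - e) * Q s (z - K2 * e) = Q s (z - K2 * e) - e * Q s (z - K2 * e)" by (simp add: left_diff_distrib)
      ultimately have "- (LQ * (K2 * e) + e + 2 * P s (y + K2 * e)) \<le> U s t - (a + Q s z)"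
        using low ep(4)[of "z - K2 * e"] by linarith
      then have 1: "- err t \<le> U s t - (a + Q s z)" using Ps Me tail0 by (simp add: err_def e_def)
      have "0 \<le> (1 - e) * P s (y - K1 * e)" using e p1 by simp
      moreover have "Q s (z + K1 * e) - Q s z \<le> LQ * (K1 * e)"
        using lipQ[of s "z + K1 * e" z] c e by (simp add: abs_le_iff)
      moreover have "(1 + e) * Q s (z + K1 * e) = Q s (z + K1 * e) + e * Q s (z + K1 * e)" by (simp add: distrib_right)
      ultimately have "U s t - (a + Q s z) \<le> LQ * (K1 * e) + e"
        using up[OF mx] ep(4)[of "z + K1 * e"] by linarith
      then show ?thesis using 1 Me errM by (simp add: abs_le_iff)
    qed
    show ?thesis using e0 one two three unfolding y_def z_def by blast
  qed
  then have bot: "\<exists>err t0. (err \<longlongrightarrow> 0) at_bot \<and> (\<forall>s. \<forall>t\<le>t0. 0 \<le> err t \<and>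
      (x s \<le> (cG + cP) / 2 * t \<longrightarrow> \<bar>U s t - g s (- x s + cG * t)\<bar> \<le> err t) \<and>
      ((cG + cP) / 2 * t \<le> x s \<and> x s \<le> (cP - cQ) / 2 * t \<longrightarrow> \<bar>U s t - (a - P s (- x s + cP * t))\<bar> \<le> err t) \<and>
      ((cP - cQ) / 2 * t \<le> x s \<longrightarrow> \<bar>U s t - (a + Q s (x s + cQ * t))\<bar> \<le> err t))"
    unfolding m_def by (intro exI[of _ err] exI[of _ t0] conjI err) blast
  show ?thesis by (rule exI[of _ U], intro conjI allI U U01 top bot)
qed

end

section \<open>The theorem\<close>

text \<open>Finite range turns the infinite sums into sums over a box. The box is symmetric because
  evenness of the kernel is exploited by reflecting the summation index.\<close>

lemma kernel_lattice:
  assumes J: "kernel_ok J" and N: "N1 > 0" "N2 > 0"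
  obtains S where "lattice S (\<lambda>k. J (fst k) (snd k)) N1 N2"
    "\<And>u i j. conv J u i j = (\<Sum>k\<in>S. J (fst k) (snd k) * u (i - fst k) (j - snd k))"
proof -
  obtain k0 where k0: "k0 > 0" "\<And>k1 k2. \<bar>k1\<bar> > k0 \<or> \<bar>k2\<bar> > k0 \<Longrightarrow> J k1 k2 = 0"
    using J unfolding kernel_ok_def by blast
  define S where "S = {- k0..k0} \<times> {- k0..k0}"
  have out: "J (fst k) (snd k) = 0" if "k \<notin> S" for k
  proof (rule k0(2))
    show "\<bar>fst k\<bar> > k0 \<or> \<bar>snd k\<bar> > k0" using that by (cases k) (simp add: S_def, linarith)
  qed
  have fin: "finite S" by (simp add: S_def)
  have red: "infsum (\<lambda>(k1, k2). J k1 k2 * w k1 k2) UNIV = (\<Sum>k\<in>S. J (fst k) (snd k) * w (fst k) (snd k))" for w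
  proof -
    have "infsum (\<lambda>(k1, k2). J k1 k2 * w k1 k2) UNIV = infsum (\<lambda>k. J (fst k) (snd k) * w (fst k) (snd k)) S"
      by (rule infsum_cong_neutral) (use out in \<open>auto simp: case_prod_beta\<close>)
    then show ?thesis using fin by simp
  qed
  show thesis
  proof (rule that)
    show "conv J u i j = (\<Sum>k\<in>S. J (fst k) (snd k) * u (i - fst k) (j - snd k))" for u i j
      unfolding conv_def by (rule red)
    show "lattice S (\<lambda>k. J (fst k) (snd k)) N1 N2"
    proof
      have "((\<lambda>(k1, k2). J k1 k2) has_sum 1) UNIV" using J by (simp add: kernel_ok_def)
      then have "infsum (\<lambda>(k1, k2). J k1 k2) UNIV = 1" by (rule infsumI)
      then show "(\<Sum>k\<in>S. J (fst k) (snd k)) = 1" using red[of "\<lambda>_ _. 1"] by simp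
      show "- k \<in> S" if "k \<in> S" for k using that by (cases k) (auto simp: S_def uminus_prod_def)
      show "J (fst k) (snd k) \<ge> 0" "J (fst (- k)) (snd (- k)) = J (fst k) (snd k)" for k
        using J by (simp_all add: kernel_ok_def)
    qed (use fin N in auto)
  qed
qed

lemma C2_bound:
  assumes v: "C2_fun v"
  shows "\<exists>B>0. (\<forall>w. \<bar>w\<bar> \<le> 4 \<longrightarrow> \<bar>deriv v w\<bar> \<le> B) \<and>
    (\<forall>w z. \<bar>w\<bar> \<le> 4 \<and> \<bar>z\<bar> \<le> 4 \<longrightarrow> \<bar>deriv v w - deriv v z\<bar> \<le> B * \<bar>w - z\<bar>)"
proof -
  have d1: "continuous_on {-4..4} (deriv v)"
    using v unfolding C2_fun_def
    by (intro continuous_at_imp_continuous_on ballI differentiable_imp_continuous_within) blast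
  have d2: "continuous_on {-4..4} (deriv (deriv v))"
    using v unfolding C2_fun_def by (meson continuous_on_subset subset_UNIV)
  have bd: "\<exists>B. \<forall>w\<in>{-4..4}. \<bar>u w\<bar> \<le> B" if "continuous_on {-4..4} u" for u :: "real \<Rightarrow> real"
    using compact_imp_bounded[OF compact_continuous_image[OF that compact_Icc]]
    by (auto simp: bounded_iff)
  obtain B1 B2 where B: "\<And>w. w \<in> {-4..4} \<Longrightarrow> \<bar>deriv v w\<bar> \<le> B1" "\<And>w. w \<in> {-4..4} \<Longrightarrow> \<bar>deriv (deriv v) w\<bar> \<le> B2"
    using bd[OF d1] bd[OF d2] by blast
  have dd: "(deriv v has_real_derivative deriv (deriv v) w) (at w)" for w
    using v unfolding C2_fun_def by (simp add: DERIV_deriv_iff_real_differentiable)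
  define B where "B = max 1 (max B1 B2)"
  have "\<bar>deriv v w - deriv v z\<bar> \<le> B * \<bar>w - z\<bar>" if "\<bar>w\<bar> \<le> 4" "\<bar>z\<bar> \<le> 4" for w z
  proof -
    have "norm (deriv v w - deriv v z) \<le> B * norm (w - z)"
    proof (rule field_differentiable_bound[of "{-4..4}" "deriv v" "deriv (deriv v)"])
      fix u :: real assume "u \<in> {-4..4}"
      then show "norm (deriv (deriv v) u) \<le> B" using B(2)[of u] by (simp add: B_def)
    qed (use that in \<open>auto intro: has_field_derivative_at_within dd\<close>)
    then show ?thesis by simp
  qed
  moreover have "\<bar>deriv v w\<bar> \<le> B" if "\<bar>w\<bar> \<le> 4" for w
  proof -
    have "\<bar>deriv v w\<bar> \<le> B1" using that by (intro B(1)) (simp add: abs_le_iff)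
    also have "B1 \<le> B" by (simp add: B_def)
    finally show ?thesis .
  qed
  ultimately show ?thesis by (intro exI[of _ B]) (auto simp: B_def)
qed

lemma sign_near:
  fixes u :: "real \<Rightarrow> real"
  assumes "isCont u c" "u c > 0"
  shows "\<exists>e>0. \<forall>w. \<bar>w - c\<bar> \<le> e \<longrightarrow> u w \<ge> e"
proof -
  have "(u \<longlongrightarrow> u c) (at c)" using assms by (simp add: isCont_def)
  then have "\<forall>\<^sub>F w in at c. u w > u c / 2" by (rule order_tendstoD) (use assms in simp)
  then obtain d where d: "d > 0" "\<And>w. w \<noteq> c \<Longrightarrow> dist w c < d \<Longrightarrow> u w > u c / 2"
    unfolding eventually_at by blast
  show ?thesis
  proof (intro exI[of _ "min (d / 2) (u c / 2)"] conjI allI impI)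
    fix w assume w: "\<bar>w - c\<bar> \<le> min (d / 2) (u c / 2)"
    have "u w \<ge> u c / 2"
      using d(1) d(2)[of w] w assms(2) by (cases "w = c") (auto simp: dist_real_def)
    then show "min (d / 2) (u c / 2) \<le> u w" by simp
  qed (use d assms in auto)
qed

text \<open>One number e serves as radius of the neighbourhoods, as lower bound for the size of the
  slopes and, through 1 / e, as bound for the derivatives; each of these persists when e decreases.
  The radius 4 covers arguments a + w with \<bar>w\<bar> \<le> 3.\<close>

lemma nonlinearity_constants:
  fixes f :: "int \<times> int \<Rightarrow> real \<Rightarrow> real"
  assumes a: "0 < a" "a < 1" and fin: "finite (range f)" and C2: "\<And>s. C2_fun (f s)"
    and d0: "\<And>s. deriv (f s) 0 < 0" and d1: "\<And>s. deriv (f s) 1 < 0" and da: "\<And>s. deriv (f s) a > 0"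
  obtains C e where "e > 0" "4 * e \<le> a" "4 * e \<le> 1 - a"
    "\<And>s w. \<bar>w\<bar> \<le> 4 \<Longrightarrow> \<bar>deriv (f s) w\<bar> \<le> C"
    "\<And>s w z. \<bar>w\<bar> \<le> 4 \<Longrightarrow> \<bar>z\<bar> \<le> 4 \<Longrightarrow> \<bar>deriv (f s) w - deriv (f s) z\<bar> \<le> C * \<bar>w - z\<bar>"
    "\<And>s w. \<bar>w\<bar> \<le> e \<Longrightarrow> deriv (f s) w \<le> - e" "\<And>s w. \<bar>w - 1\<bar> \<le> e \<Longrightarrow> deriv (f s) w \<le> - e"
    "\<And>s w. \<bar>w - a\<bar> \<le> e \<Longrightarrow> deriv (f s) w \<ge> e"
proof -
  define Pr where "Pr = (\<lambda>(v::real \<Rightarrow> real) e. 4 * e \<le> a \<and> 4 * e \<le> 1 - a \<and>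
    (\<forall>w. \<bar>w\<bar> \<le> 4 \<longrightarrow> \<bar>deriv v w\<bar> \<le> 1 / e) \<and>
    (\<forall>w z. \<bar>w\<bar> \<le> 4 \<and> \<bar>z\<bar> \<le> 4 \<longrightarrow> \<bar>deriv v w - deriv v z\<bar> \<le> 1 / e * \<bar>w - z\<bar>) \<and>
    (\<forall>w. \<bar>w\<bar> \<le> e \<longrightarrow> deriv v w \<le> - e) \<and> (\<forall>w. \<bar>w - 1\<bar> \<le> e \<longrightarrow> deriv v w \<le> - e) \<and>
    (\<forall>w. \<bar>w - a\<bar> \<le> e \<longrightarrow> deriv v w \<ge> e))"
  have "\<exists>e>0. \<forall>v\<in>range f. Pr v e"
  proof (rule finite_uniform_small[OF fin])
    fix v assume "v \<in> range f"
    then obtain s where v: "v = f s" by blast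
    have C2v: "C2_fun v" unfolding v by (rule C2)
    have cont: "isCont (deriv v) w" for w
      using C2v unfolding C2_fun_def by (simp add: differentiable_imp_continuous_within)
    obtain B where B: "B > 0" "\<And>w. \<bar>w\<bar> \<le> 4 \<Longrightarrow> \<bar>deriv v w\<bar> \<le> B"
      "\<And>w z. \<bar>w\<bar> \<le> 4 \<Longrightarrow> \<bar>z\<bar> \<le> 4 \<Longrightarrow> \<bar>deriv v w - deriv v z\<bar> \<le> B * \<bar>w - z\<bar>"
      using C2_bound[OF C2v] by blast
    obtain e1 where e1: "e1 > 0" "\<And>w. \<bar>w\<bar> \<le> e1 \<Longrightarrow> - deriv v w \<ge> e1"
      using sign_near[where u = "\<lambda>w. - deriv v w" and c = 0] cont d0[of s] v by (auto intro: isCont_minus)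
    obtain e2 where e2: "e2 > 0" "\<And>w. \<bar>w - 1\<bar> \<le> e2 \<Longrightarrow> - deriv v w \<ge> e2"
      using sign_near[where u = "\<lambda>w. - deriv v w" and c = 1] cont d1[of s] v by (auto intro: isCont_minus)
    obtain e3 where e3: "e3 > 0" "\<And>w. \<bar>w - a\<bar> \<le> e3 \<Longrightarrow> deriv v w \<ge> e3"
      using sign_near[where u = "deriv v" and c = a] cont da[of s] v by auto
    define e0 where "e0 = Min {e1, e2, e3, 1 / B, a / 4, (1 - a) / 4}"
    have e0: "e0 > 0" using e1 e2 e3 B a unfolding e0_def by (subst Min_gr_iff) auto
    have e0_le: "e0 \<le> e1" "e0 \<le> e2" "e0 \<le> e3" "e0 \<le> 1 / B" "e0 \<le> a / 4" "e0 \<le> (1 - a) / 4"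
      unfolding e0_def by (rule Min_le; simp)+
    have "Pr v e" if e: "0 < e" "e \<le> e0" for e
      unfolding Pr_def
    proof (intro conjI allI impI)
      show "4 * e \<le> a" using e e0_le(5) by simp
      have "e \<le> (1 - a) / 4" using e e0_le(6) by linarith
      then show "4 * e \<le> 1 - a" by (simp add: field_simps)
      have "e \<le> 1 / B" using e e0_le(4) by linarith
      then have Be: "B \<le> 1 / e" using B e by (simp add: field_simps)
      show "\<bar>deriv v w\<bar> \<le> 1 / e" if "\<bar>w\<bar> \<le> 4" for w using B(2)[OF that] Be by linarith
      show "\<bar>deriv v w - deriv v z\<bar> \<le> 1 / e * \<bar>w - z\<bar>" if "\<bar>w\<bar> \<le> 4 \<and> \<bar>z\<bar> \<le> 4" for w z
      proof -
        have "\<bar>deriv v w - deriv v z\<bar> \<le> B * \<bar>w - z\<bar>" using B(3) that by blast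
        also have "\<dots> \<le> 1 / e * \<bar>w - z\<bar>" using Be by (rule mult_right_mono) simp
        finally show ?thesis .
      qed
      show "deriv v w \<le> - e" if "\<bar>w\<bar> \<le> e" for w using e1(2)[of w] that e e0_le(1) by linarith
      show "deriv v w \<le> - e" if "\<bar>w - 1\<bar> \<le> e" for w using e2(2)[of w] that e e0_le(2) by linarith
      show "deriv v w \<ge> e" if "\<bar>w - a\<bar> \<le> e" for w using e3(2)[of w] that e e0_le(3) by linarith
    qed
    then show "\<exists>e>0. \<forall>e'. 0 < e' \<and> e' \<le> e \<longrightarrow> Pr v e'" using e0 by blast
  qed
  then obtain e where e: "e > 0" and Pr: "\<And>s. Pr (f s) e" by blast
  show thesis
  proof (rule that[of e "1 / e"])
    note * = Pr[unfolded Pr_def]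
    show "e > 0" by (rule e)
    show "4 * e \<le> a" "4 * e \<le> 1 - a" using *[of undefined] by blast+
    show "\<bar>deriv (f s) w\<bar> \<le> 1 / e" if "\<bar>w\<bar> \<le> 4" for s w using *[of s] that by blast
    show "\<bar>deriv (f s) w - deriv (f s) z\<bar> \<le> 1 / e * \<bar>w - z\<bar>" if "\<bar>w\<bar> \<le> 4" "\<bar>z\<bar> \<le> 4" for s w z
      using *[of s] that by blast
    show "deriv (f s) w \<le> - e" if "\<bar>w\<bar> \<le> e" for s w using *[of s] that by blast
    show "deriv (f s) w \<le> - e" if "\<bar>w - 1\<bar> \<le> e" for s w using *[of s] that by blast
    show "deriv (f s) w \<ge> e" if "\<bar>w - a\<bar> \<le> e" for s w using *[of s] that by blast
  qed
qed

section \<open>Suprema over the zones and the passage from the hypotheses to the three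
  profiles\<close>

lemma sup0_bounds:
  assumes "\<And>y. y \<in> A \<Longrightarrow> 0 \<le> y" "\<And>y. y \<in> A \<Longrightarrow> y \<le> B" "0 \<le> B"
  shows "0 \<le> sup0 A" "sup0 A \<le> B"
proof -
  show "sup0 A \<le> B" using assms by (auto simp: sup0_def intro!: cSup_least)
  show "0 \<le> sup0 A"
  proof (cases "A = {}")
    case False
    then obtain y where y: "y \<in> A" by blast
    have "bdd_above A" using assms(2) by (rule bdd_aboveI)
    then have "y \<le> Sup A" using y by (intro cSup_upper)
    then show ?thesis using assms(1)[OF y] False by (simp add: sup0_def)
  qed (simp add: sup0_def)
qed

theorem theorem1p2:
  fixes J :: "int \<Rightarrow> int \<Rightarrow> real"
    and f :: "int \<Rightarrow> int \<Rightarrow> real \<Rightarrow> real"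
    and a \<theta> v_hat v1 v2 :: real
    and N1 N2 :: int
    and \<phi>1 \<phi>2 \<phi>3 :: "int \<Rightarrow> int \<Rightarrow> real \<Rightarrow> real"
  assumes a: "0 < a" "a < 1"
    and J: "kernel_ok J"
    and f: "hyp_f a N1 N2 f"
    and front1: "pulsating_front J f N1 N2 \<theta> v_hat 1 0 \<phi>1" "\<forall>i j. antimono (\<phi>1 i j)"
    and front2: "pulsating_front J f N1 N2 \<theta> v1 0 a \<phi>2" "\<forall>i j. mono (\<phi>2 i j)"
    and front3: "pulsating_front J f N1 N2 \<theta> v2 a 1 \<phi>3" "\<forall>i j. mono (\<phi>3 i j)"
    and speeds: "v_hat < v1" "v1 < v2"
  shows "\<exists>U \<omega>. entire_solution J f U \<and> (\<forall>i j t. 0 \<le> U i j t \<and> U i j t \<le> 1) \<and>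
     ((\<lambda>t. Sup {\<bar>U i j t - 1\<bar> | i j. True}) \<longlongrightarrow> 0) at_top \<and>
     (let x = (\<lambda>i j. real_of_int i * cos \<theta> + real_of_int j * sin \<theta>);
          m1 = (\<lambda>t. - ((v_hat + v1) * t / 2));
          m2 = (\<lambda>t. - ((v1 + v2) * t / 2))
      in ((\<lambda>t. sup0 {\<bar>U i j t - \<phi>1 i j (x i j + v_hat * t - \<omega>)\<bar> | i j. x i j \<le> m1 t}
              + sup0 {\<bar>U i j t - \<phi>2 i j (x i j + v1 * t + \<omega>)\<bar> | i j. m1 t \<le> x i j \<and> x i j \<le> m2 t}
              + sup0 {\<bar>U i j t - \<phi>3 i j (x i j + v2 * t + \<omega>)\<bar> | i j. x i j \<ge> m2 t})
          \<longlongrightarrow> 0) at_bot)"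
proof -
  have N: "N1 > 0" "N2 > 0" using f by (auto simp: hyp_f_def)
  obtain S where lat: "lattice S (\<lambda>k. J (fst k) (snd k)) N1 N2"
    and conv: "\<And>u i j. conv J u i j = (\<Sum>k\<in>S. J (fst k) (snd k) * u (i - fst k) (j - snd k))"
    using kernel_lattice[OF J N] by blast
  define J' where "J' = (\<lambda>k. J (fst k) (snd k))"
  define F where "F = (\<lambda>s. f (fst s) (snd s))"
  define x where "x = (\<lambda>s::int \<times> int. real_of_int (fst s) * cos \<theta> + real_of_int (snd s) * sin \<theta>)"
  interpret lattice S J' N1 N2 using lat unfolding J'_def .
  have f0: "F s 0 = 0" "F s a = 0" "F s 1 = 0" "deriv (F s) 0 < 0" "deriv (F s) 1 < 0" "deriv (F s) a > 0" "C2_fun (F s)" for s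
    using f unfolding hyp_f_def F_def by blast+
  have f_neg: "F s u < 0" if "0 < u" "u < a" for s u using f that unfolding hyp_f_def F_def by blast
  have f_pos: "F s u > 0" if "a < u" "u < 1" for s u using f that unfolding hyp_f_def F_def by blast
  have f_per: "F (i + N1, j) = F (i, j)" "F (i, j + N2) = F (i, j)" for i j
  proof -
    have "f i j = f (i + N1) j" "f i j = f i (j + N2)" using f unfolding hyp_f_def by blast+
    then show "F (i + N1, j) = F (i, j)" "F (i, j + N2) = F (i, j)" by (simp_all add: F_def)
  qed
  have fin: "finite (range F)" by (rule finite_range_periodic) (rule f_per)+
  obtain C e where e: "e > 0" "4 * e \<le> a" "4 * e \<le> 1 - a"
    and C: "\<And>s w. \<bar>w\<bar> \<le> 4 \<Longrightarrow> \<bar>deriv (F s) w\<bar> \<le> C"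
      "\<And>s w z. \<bar>w\<bar> \<le> 4 \<Longrightarrow> \<bar>z\<bar> \<le> 4 \<Longrightarrow> \<bar>deriv (F s) w - deriv (F s) z\<bar> \<le> C * \<bar>w - z\<bar>"
    and near0: "\<And>s w. \<bar>w\<bar> \<le> e \<Longrightarrow> deriv (F s) w \<le> - e"
    and near1: "\<And>s w. \<bar>w - 1\<bar> \<le> e \<Longrightarrow> deriv (F s) w \<le> - e"
    and neara: "\<And>s w. \<bar>w - a\<bar> \<le> e \<Longrightarrow> deriv (F s) w \<ge> e"
    by (rule nonlinearity_constants[OF a fin f0(7) f0(4) f0(5) f0(6)]) (rule that)
  note bounds = C near0 near1 neara
  define F' where "F' s = deriv (F s)" for s
  note C = bounds(1,2)[folded F'_def] and near0 = bounds(3)[folded F'_def]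
    and near1 = bounds(4)[folded F'_def] and neara = bounds(5)[folded F'_def]
  have F_deriv: "(F s has_real_derivative F' s w) (at w)" for s w
    using f0(7)[of s] unfolding F'_def C2_fun_def by (simp add: DERIV_deriv_iff_real_differentiable)
  have x_diff: "x (s - k) = x s - x k" for s k by (simp add: x_def algebra_simps)

  have profile: "(\<phi> (fst s) (snd s) has_real_derivative deriv (\<phi> (fst s) (snd s)) y) (at y)"
      "c * deriv (\<phi> (fst s) (snd s)) y = (\<Sum>k\<in>S. J' k * \<phi> (fst (s - k)) (snd (s - k)) (y - x k))
        - \<phi> (fst s) (snd s) y + F s (\<phi> (fst s) (snd s) y)"
      "(\<phi> (fst s) (snd s) \<longlongrightarrow> em) at_bot" "(\<phi> (fst s) (snd s) \<longlongrightarrow> ep) at_top"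
      "\<phi> (i + N1) j = \<phi> i j" "\<phi> i (j + N2) = \<phi> i j"
    if "pulsating_front J f N1 N2 \<theta> c em ep \<phi>" for c em ep \<phi> s y i j
  proof -
    show "(\<phi> (fst s) (snd s) has_real_derivative deriv (\<phi> (fst s) (snd s)) y) (at y)"
      using that unfolding pulsating_front_def C1_fun_def by (simp add: DERIV_deriv_iff_real_differentiable)
    show "(\<phi> (fst s) (snd s) \<longlongrightarrow> em) at_bot" "(\<phi> (fst s) (snd s) \<longlongrightarrow> ep) at_top"
      "\<phi> (i + N1) j = \<phi> i j" "\<phi> i (j + N2) = \<phi> i j"
      using that unfolding pulsating_front_def by blast+
    have "c * deriv (\<phi> (fst s) (snd s)) y =
        conv J (\<lambda>i' j'. \<phi> i' j' (y - real_of_int (fst s - i') * cos \<theta> - real_of_int (snd s - j') * sin \<theta>)) (fst s) (snd s)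
        - \<phi> (fst s) (snd s) y + f (fst s) (snd s) (\<phi> (fst s) (snd s) y)"
      using that unfolding pulsating_front_def by blast
    then show "c * deriv (\<phi> (fst s) (snd s)) y = (\<Sum>k\<in>S. J' k * \<phi> (fst (s - k)) (snd (s - k)) (y - x k))
        - \<phi> (fst s) (snd s) y + F s (\<phi> (fst s) (snd s) y)"
      unfolding conv by (simp add: F_def J'_def x_def diff_diff_eq)
  qed

  \<comment> \<open>\<open>P\<close> is reflected both in y and in value, so it is nondecreasing
    again and its limit 0 at -\<infinity> corresponds to the unstable state a; \<open>g\<close> is
    reflected in y alone. A reflection in y changes the sign of the speed.\<close>
  define Q where "Q = (\<lambda>s y. \<phi>3 (fst s) (snd s) y - a)"
  define Q' where "Q' = (\<lambda>s. deriv (\<phi>3 (fst s) (snd s)))"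
  define P where "P = (\<lambda>s y. a - \<phi>2 (fst s) (snd s) (- y))"
  define P' where "P' = (\<lambda>s y. deriv (\<phi>2 (fst s) (snd s)) (- y))"
  define g where "g = (\<lambda>s y. \<phi>1 (fst s) (snd s) (- y))"
  define g' where "g' = (\<lambda>s y. - deriv (\<phi>1 (fst s) (snd s)) (- y))"
  have const: "(\<Sum>k\<in>S. J' k * b) = b" for b by (simp add: sum_distrib_right[symmetric] sum_J)
  have refl_deriv: "((\<lambda>y. u (- y)) has_real_derivative - D) (at y)" if "(u has_real_derivative D) (at (- y))" for u :: "real \<Rightarrow> real" and D y
    using DERIV_chain2[OF that DERIV_minus[OF DERIV_ident]] by simp

  have shift_deriv: "((\<lambda>w. F s (a + w)) has_real_derivative F' s (a + w)) (at w)" for s w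
    using DERIV_shift[of "F s" "F' s (a + w)" w a] F_deriv by (simp add: add.commute)

  have frontQ: "front S J' N1 N2 x v2 (\<lambda>s w. F s (a + w)) (\<lambda>s w. F' s (a + w)) Q Q' (1 - a) C"
  proof
    show "x (s - k) = x s - x k" for s k by (rule x_diff)
    show "(Q s has_real_derivative Q' s y) (at y)" for s y
      unfolding Q_def Q'_def using DERIV_diff[OF profile(1)[OF front3(1)] DERIV_const] by simp
    show "v2 * Q' s y = (\<Sum>k\<in>S. J' k * Q (s - k) (y - x k)) - Q s y + F s (a + Q s y)" for s y
      using profile(2)[OF front3(1), of s y] by (simp add: Q_def Q'_def right_diff_distrib sum_subtractf const)
    show "Q s y \<le> Q s z" if "y \<le> z" for s y z
      using front3(2) that by (simp add: Q_def monoD)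
    show "(Q s \<longlongrightarrow> 0) at_bot" for s
      unfolding Q_def using tendsto_diff[OF profile(3)[OF front3(1)] tendsto_const[of a]] by simp
    show "(Q s \<longlongrightarrow> 1 - a) at_top" for s
      unfolding Q_def by (rule tendsto_diff[OF profile(4)[OF front3(1)] tendsto_const])
    show "Q (i + N1, j) = Q (i, j)" "Q (i, j + N2) = Q (i, j)" for i j
      by (simp_all add: Q_def profile(5,6)[OF front3(1)])
    show "((\<lambda>w. F s (a + w)) has_real_derivative F' s (a + w)) (at w)" for s w by (rule shift_deriv)
    show "\<bar>F' s (a + w)\<bar> \<le> C" if "\<bar>w\<bar> \<le> 1" for s w using that a by (intro C) auto
  qed (use a f0 in auto)
  have frontP: "front S J' N1 N2 (\<lambda>k. - x k) (- v1) (\<lambda>s w. - F s (a + - w)) (\<lambda>s w. F' s (a + - w)) P P' a C"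
  proof
    show "- x (s - k) = - x s - - x k" for s k by (simp add: x_diff)
    show "(P s has_real_derivative P' s y) (at y)" for s y
      unfolding P_def P'_def using DERIV_diff[OF DERIV_const refl_deriv[OF profile(1)[OF front2(1)]]] by simp
    show "- v1 * P' s y = (\<Sum>k\<in>S. J' k * P (s - k) (y - - x k)) - P s y + - F s (a + - P s y)" for s y
      using profile(2)[OF front2(1), of s "- y"] by (simp add: P_def P'_def right_diff_distrib sum_subtractf const)
    show "P s y \<le> P s z" if "y \<le> z" for s y z
      using front2(2) that by (simp add: P_def monoD)
    have top: "filterlim (uminus :: real \<Rightarrow> real) at_top at_bot" and bot: "filterlim (uminus :: real \<Rightarrow> real) at_bot at_top"
      by (rule filterlim_uminus_at_top_at_bot filterlim_uminus_at_bot_at_top)+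
    show "(P s \<longlongrightarrow> 0) at_bot" for s
      unfolding P_def using tendsto_diff[OF tendsto_const[of a] filterlim_compose[OF profile(4)[OF front2(1)] top]] by simp
    show "(P s \<longlongrightarrow> a) at_top" for s
      unfolding P_def using tendsto_diff[OF tendsto_const[of a] filterlim_compose[OF profile(3)[OF front2(1)] bot]] by simp
    show "P (i + N1, j) = P (i, j)" "P (i, j + N2) = P (i, j)" for i j
      by (simp_all add: P_def profile(5,6)[OF front2(1)])
    show "((\<lambda>w. - F s (a + - w)) has_real_derivative F' s (a + - w)) (at w)" for s w
      using DERIV_minus[OF refl_deriv[OF shift_deriv[of s "- w"]]] by simp
    show "\<bar>F' s (a + - w)\<bar> \<le> C" if "\<bar>w\<bar> \<le> 1" for s w using that a by (intro C) auto
  qed (use a f0 in auto)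
  have frontG: "front S J' N1 N2 (\<lambda>k. - x k) (- v_hat) F F' g g' 1 C"
  proof
    show "- x (s - k) = - x s - - x k" for s k by (simp add: x_diff)
    show "(g s has_real_derivative g' s y) (at y)" for s y
      unfolding g_def g'_def by (rule refl_deriv[OF profile(1)[OF front1(1)]])
    show "- v_hat * g' s y = (\<Sum>k\<in>S. J' k * g (s - k) (y - - x k)) - g s y + F s (g s y)" for s y
      using profile(2)[OF front1(1), of s "- y"] by (simp add: g_def g'_def)
    show "g s y \<le> g s z" if "y \<le> z" for s y z
      using front1(2) that by (simp add: g_def antimonoD)
    have top: "filterlim (uminus :: real \<Rightarrow> real) at_top at_bot" and bot: "filterlim (uminus :: real \<Rightarrow> real) at_bot at_top"
      by (rule filterlim_uminus_at_top_at_bot filterlim_uminus_at_bot_at_top)+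
    show "(g s \<longlongrightarrow> 0) at_bot" for s
      unfolding g_def by (rule filterlim_compose[OF profile(4)[OF front1(1)] top])
    show "(g s \<longlongrightarrow> 1) at_top" for s
      unfolding g_def by (rule filterlim_compose[OF profile(3)[OF front1(1)] bot])
    show "g (i + N1, j) = g (i, j)" "g (i, j + N2) = g (i, j)" for i j
      by (simp_all add: g_def profile(5,6)[OF front1(1)])
    show "(F s has_real_derivative F' s w) (at w)" for s w by (rule F_deriv)
    show "\<bar>F' s w\<bar> \<le> C" if "\<bar>w\<bar> \<le> 1" for s w using that by (intro C) auto
  qed (use f0 in auto)
  \<comment> \<open>The second front is read once more, unreflected, from its stable end 0. This
    gives the decay of a - P there, which the matching between the first two fronts
    requires.\<close>
  have frontR: "front S J' N1 N2 x v1 F F' (\<lambda>s. \<phi>2 (fst s) (snd s)) (\<lambda>s. deriv (\<phi>2 (fst s) (snd s))) a C"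
  proof
    show "x (s - k) = x s - x k" for s k by (rule x_diff)
    show "(\<phi>2 (fst s) (snd s) has_real_derivative deriv (\<phi>2 (fst s) (snd s)) y) (at y)" for s y
      by (rule profile(1)[OF front2(1)])
    show "v1 * deriv (\<phi>2 (fst s) (snd s)) y = (\<Sum>k\<in>S. J' k * \<phi>2 (fst (s - k)) (snd (s - k)) (y - x k))
      - \<phi>2 (fst s) (snd s) y + F s (\<phi>2 (fst s) (snd s) y)" for s y
      by (rule profile(2)[OF front2(1)])
    show "\<phi>2 (fst s) (snd s) y \<le> \<phi>2 (fst s) (snd s) z" if "y \<le> z" for s y z
      using front2(2) that by (simp add: monoD)
    show "(\<phi>2 (fst s) (snd s) \<longlongrightarrow> 0) at_bot" "(\<phi>2 (fst s) (snd s) \<longlongrightarrow> a) at_top" for s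
      by (rule profile(3,4)[OF front2(1)])+
    show "\<phi>2 (fst (i + N1, j)) (snd (i + N1, j)) = \<phi>2 (fst (i, j)) (snd (i, j))"
      "\<phi>2 (fst (i, j + N2)) (snd (i, j + N2)) = \<phi>2 (fst (i, j)) (snd (i, j))" for i j
      by (simp_all add: profile(5,6)[OF front2(1)])
    show "(F s has_real_derivative F' s w) (at w)" for s w by (rule F_deriv)
    show "\<bar>F' s w\<bar> \<le> C" if "\<bar>w\<bar> \<le> 1" for s w using that by (intro C) auto
  qed (use a f0 in auto)

  \<comment> \<open>Both signs come from \<open>speed_pos\<close>, as the reaction is positive
    between a and 1 and negative between 0 and a; the assumed order of the speeds then gives v_hat <
    0.\<close>
  have v2: "v2 > 0"
    by (rule front.speed_pos[OF frontQ]) (use f_pos f0 in auto)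
  have v1: "- v1 > 0"
    by (rule front.speed_pos[OF frontP]) (use f_neg f0 in auto)
  have decay: "\<exists>K>0. \<exists>lam>0. \<forall>s y. \<phi>2 (fst s) (snd s) y \<le> K * exp (lam * y)"
  proof (rule front.exp_decay[OF frontR, of "- 1" e e])
    fix s w assume w: "0 \<le> w" "w \<le> e"
    have "F s w - F s 0 \<le> - e * (w - 0)"
      by (rule deriv_le_imp_diff_le[OF F_deriv]) (use w in \<open>auto intro!: near0\<close>)
    then show "- 1 * F s w \<ge> e * w" by (simp add: f0)
  qed (use e in auto)

  interpret three_fronts S J' N1 N2 F F' C x v2 "- v1" Q Q' P P' a e e "- v_hat" g g'
  proof (intro three_fronts.intro reaction.intro reaction_axioms.intro front_pair.intro front_pair_axioms.intro
      three_fronts_axioms.intro)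
    show "lattice S J' N1 N2" by unfold_locales
    show "front S J' N1 N2 x v2 (\<lambda>s w. F s (a + w)) (\<lambda>s w. F' s (a + w)) Q Q' (1 - a) C" by (rule frontQ)
    show "front S J' N1 N2 (\<lambda>k. - x k) (- v1) (\<lambda>s w. - F s (a + - w)) (\<lambda>s w. F' s (a + - w)) P P' a C" by (rule frontP)
    show "front S J' N1 N2 (\<lambda>k. - x k) (- v_hat) F F' g g' 1 C" by (rule frontG)
    show "finite (range F)" by (rule fin)
    show "\<exists>K>0. \<exists>lam>0. \<forall>s y. a - P s (- y) \<le> K * exp (lam * y)"
      using decay by (simp add: P_def)
    show "v2 > 0" "- v1 > 0" "- v1 < - v_hat" using v2 v1 speeds by auto
    fix s v w
    show "(F s has_real_derivative F' s w) (at w)" by (rule F_deriv)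
    show "\<bar>F' s w\<bar> \<le> C" if "\<bar>w\<bar> \<le> 3" using that by (intro C) auto
    show "F s 0 = 0" "F s 1 = 0" by (rule f0)+
    show "\<bar>F' s (a + w)\<bar> \<le> C" if "\<bar>w\<bar> \<le> 3" using that a by (intro C) auto
    show "\<bar>F' s (a + v) - F' s (a + w)\<bar> \<le> C * \<bar>v - w\<bar>" if "\<bar>v\<bar> \<le> 3" "\<bar>w\<bar> \<le> 3"
      using C(2)[of "a + v" "a + w" s] that a by auto
    show "F' s (a + w) \<le> - e" if "\<bar>w - (1 - a)\<bar> \<le> e" using that by (intro near1) (simp add: algebra_simps)
    show "F' s (a + w) \<le> - e" if "\<bar>w + a\<bar> \<le> e" using that by (intro near0) (simp add: algebra_simps)
    show "e \<le> F' s (a + w)" if "\<bar>w\<bar> \<le> e" using that by (intro neara) simp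
    show "F s (a + (1 - a)) = 0" "F s (a + - a) = 0" using f0 by simp_all
    show "F s (a + w) > 0" if "0 < w" "w < 1 - a" using that by (intro f_pos) auto
    show "F s (a + w) < 0" if "- a < w" "w < 0" using that by (intro f_neg) auto
    show "F' s w \<le> - e" if "\<bar>w\<bar> \<le> e" using that by (rule near0)
  qed (use e in auto)

  obtain U where U: "\<And>s t. (U s has_real_derivative rhs (\<lambda>s. U s t) s) (at t)" "\<And>s t. 0 \<le> U s t" "\<And>s t. U s t \<le> 1"
    and top: "\<exists>err t0. (err \<longlongrightarrow> 0) at_top \<and> (\<forall>s. \<forall>t\<ge>t0. \<bar>U s t - 1\<bar> \<le> err t)"
    and bot: "\<exists>err t0. (err \<longlongrightarrow> 0) at_bot \<and> (\<forall>s. \<forall>t\<le>t0. 0 \<le> err t \<and>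
      (x s \<le> (- v_hat + - v1) / 2 * t \<longrightarrow> \<bar>U s t - g s (- x s + - v_hat * t)\<bar> \<le> err t) \<and>
      ((- v_hat + - v1) / 2 * t \<le> x s \<and> x s \<le> (- v1 - v2) / 2 * t \<longrightarrow> \<bar>U s t - (a - P s (- x s + - v1 * t))\<bar> \<le> err t) \<and>
      ((- v1 - v2) / 2 * t \<le> x s \<longrightarrow> \<bar>U s t - (a + Q s (x s + v2 * t))\<bar> \<le> err t))"
    using asymptotics by blast
  define V where "V = (\<lambda>i j. U (i, j))"
  have sol: "entire_solution J f V"
    unfolding entire_solution_def
  proof (intro allI)
    fix i j t
    have "rhs (\<lambda>s. U s t) (i, j) = conv J (\<lambda>i' j'. V i' j' t) i j - V i j t + f i j (V i j t)"
      unfolding rhs_def conv V_def by (simp add: J'_def F_def minus_prod_def)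
    then show "(V i j has_real_derivative conv J (\<lambda>i' j'. V i' j' t) i j - V i j t + f i j (V i j t)) (at t)"
      using U(1)[of "(i, j)" t] by (simp add: V_def)
  qed
  have lim_top: "((\<lambda>t. Sup {\<bar>V i j t - 1\<bar> | i j. True}) \<longlongrightarrow> 0) at_top"
  proof -
    obtain err t0 where err: "(err \<longlongrightarrow> 0) at_top" "\<And>s t. t \<ge> t0 \<Longrightarrow> \<bar>U s t - 1\<bar> \<le> err t"
      using top by blast
    show ?thesis
    proof (rule tendsto_sandwich[OF _ _ tendsto_const err(1)])
      have b: "0 \<le> Sup {\<bar>V i j t - 1\<bar> | i j. True} \<and> Sup {\<bar>V i j t - 1\<bar> | i j. True} \<le> err t" if t: "t0 \<le> t" for t
      proof -
        have ne: "{\<bar>V i j t - 1\<bar> | i j. True} \<noteq> {}" by blast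
        have le: "y \<le> err t" if "y \<in> {\<bar>V i j t - 1\<bar> | i j. True}" for y
          using that err(2)[OF t] by (auto simp: V_def)
        then have "sup0 {\<bar>V i j t - 1\<bar> | i j. True} = Sup {\<bar>V i j t - 1\<bar> | i j. True}"
          using ne by (simp only: sup0_def if_False)
        moreover have "0 \<le> err t" using err(2)[OF t, of "(0, 0)"] by linarith
        ultimately show ?thesis
          using sup0_bounds[of "{\<bar>V i j t - 1\<bar> | i j. True}" "err t"] le by fastforce
      qed
      show "\<forall>\<^sub>F t in at_top. 0 \<le> Sup {\<bar>V i j t - 1\<bar> | i j. True}"
        using eventually_ge_at_top[of t0] by eventually_elim (use b in blast)
      show "\<forall>\<^sub>F t in at_top. Sup {\<bar>V i j t - 1\<bar> | i j. True} \<le> err t"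
        using eventually_ge_at_top[of t0] by eventually_elim (use b in blast)
    qed
  qed
  define X where "X = (\<lambda>i j. real_of_int i * cos \<theta> + real_of_int j * sin \<theta>)"
  define m1 where "m1 = (\<lambda>t. - ((v_hat + v1) * t / 2))"
  define m2 where "m2 = (\<lambda>t. - ((v1 + v2) * t / 2))"
  have lim_bot: "((\<lambda>t. sup0 {\<bar>V i j t - \<phi>1 i j (X i j + v_hat * t - 0)\<bar> | i j. X i j \<le> m1 t}
              + sup0 {\<bar>V i j t - \<phi>2 i j (X i j + v1 * t + 0)\<bar> | i j. m1 t \<le> X i j \<and> X i j \<le> m2 t}
              + sup0 {\<bar>V i j t - \<phi>3 i j (X i j + v2 * t + 0)\<bar> | i j. X i j \<ge> m2 t}) \<longlongrightarrow> 0) at_bot"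
    (is "((\<lambda>t. sup0 (?A1 t) + sup0 (?A2 t) + sup0 (?A3 t)) \<longlongrightarrow> 0) at_bot")
  proof -
    obtain err t0 where err: "(err \<longlongrightarrow> 0) at_bot" and e0: "\<And>t. t \<le> t0 \<Longrightarrow> 0 \<le> err t"
      and E1: "\<And>s t. t \<le> t0 \<Longrightarrow> x s \<le> (- v_hat + - v1) / 2 * t \<Longrightarrow> \<bar>U s t - g s (- x s + - v_hat * t)\<bar> \<le> err t"
      and E2: "\<And>s t. t \<le> t0 \<Longrightarrow> (- v_hat + - v1) / 2 * t \<le> x s \<Longrightarrow> x s \<le> (- v1 - v2) / 2 * t \<Longrightarrow>
        \<bar>U s t - (a - P s (- x s + - v1 * t))\<bar> \<le> err t"
      and E3: "\<And>s t. t \<le> t0 \<Longrightarrow> (- v1 - v2) / 2 * t \<le> x s \<Longrightarrow> \<bar>U s t - (a + Q s (x s + v2 * t))\<bar> \<le> err t"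
      using bot by blast
    have m12: "(- v_hat + - v1) / 2 * t = m1 t" "(- v1 - v2) / 2 * t = m2 t" for t
      by (simp_all add: m1_def m2_def field_simps)
    have args: "- (- x s + - v_hat * t) = x s + v_hat * t" "- (- x s + - v1 * t) = x s + v1 * t" for s t
      by simp_all
    note E = E1[unfolded m12 g_def args] E2[unfolded m12 P_def args diff_diff_eq2 add_diff_cancel_left'] E3[unfolded m12 Q_def]
    have X: "X i j = x (i, j)" for i j by (simp add: X_def x_def)
    have A1: "0 \<le> sup0 (?A1 t) \<and> sup0 (?A1 t) \<le> err t" if t: "t \<le> t0" for t
    proof -
      have "0 \<le> y \<and> y \<le> err t" if "y \<in> ?A1 t" for y
        using that E(1)[OF t, of "(_, _)"] by (auto simp: V_def X)
      then show ?thesis using sup0_bounds[of "?A1 t" "err t"] e0[OF t] by blast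
    qed
    have A2: "0 \<le> sup0 (?A2 t) \<and> sup0 (?A2 t) \<le> err t" if t: "t \<le> t0" for t
    proof -
      have "0 \<le> y \<and> y \<le> err t" if "y \<in> ?A2 t" for y
        using that E(2)[OF t, of "(_, _)"] by (auto simp: V_def X)
      then show ?thesis using sup0_bounds[of "?A2 t" "err t"] e0[OF t] by blast
    qed
    have A3: "0 \<le> sup0 (?A3 t) \<and> sup0 (?A3 t) \<le> err t" if t: "t \<le> t0" for t
    proof -
      have "0 \<le> y \<and> y \<le> err t" if "y \<in> ?A3 t" for y
        using that E(3)[OF t, of "(_, _)"] by (auto simp: V_def X)
      then show ?thesis using sup0_bounds[of "?A3 t" "err t"] e0[OF t] by blast
    qed
    show ?thesis
    proof (rule tendsto_sandwich[OF _ _ tendsto_const tendsto_mult_right_zero[OF err, of 3]])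
      show "\<forall>\<^sub>F t in at_bot. 0 \<le> sup0 (?A1 t) + sup0 (?A2 t) + sup0 (?A3 t)"
        using eventually_le_at_bot[of t0]
      proof eventually_elim
        case (elim t)
        then show ?case using A1[OF elim] A2[OF elim] A3[OF elim] by linarith
      qed
      show "\<forall>\<^sub>F t in at_bot. sup0 (?A1 t) + sup0 (?A2 t) + sup0 (?A3 t) \<le> 3 * err t"
        using eventually_le_at_bot[of t0]
      proof eventually_elim
        case (elim t)
        then show ?case using A1[OF elim] A2[OF elim] A3[OF elim] by linarith
      qed
    qed
  qed
  show ?thesis
    by (rule exI[of _ V], rule exI[of _ 0], unfold Let_def, intro conjI allI sol lim_top
        lim_bot[unfolded X_def m1_def m2_def]) (simp_all add: V_def U)
qed

end
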